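(* Fix $\alpha\ge\frac{\log 3}{4\log 2}$, a regularity $s$ with $s>\frac{\log 3}{2\log 2}-2\alpha$ and $s\ge0$, and $\nu>0$. Then for all $u^0\in\dot H^s_{\mathcal M}$ there exists a unique, global smooth solution $u\in C\big([0,+\infty);\dot H^s_{\mathcal M}\big)$ of the Fourier-restricted hypodissipative Navier--Stokes equation with initial data $u^0$, and for all $0\le t<+\infty$, $$\|u(\cdot,t)\|_{\dot H^s}^2\le\|u^0\|_{\dot H^s}^2\exp\left(\frac{\mathcal C_s^2}{4(2\pi)^{4\alpha-\frac{\log 3}{2\log 2}}}\,\frac{\|u^0\|_{L^2}^2}{\nu^2}\right),$$ where $\mathcal C_s>0$ is an absolute constant depending only on $s$. Furthermore, for all $0\le t<+\infty$, $$\tfrac12\|u(\cdot,t)\|_{L^2}^2+\nu\int_0^t\|u(\cdot,\tau)\|_{\dot H^\alpha}^2\,d\tau=\tfrac12\|u^0\|_{L^2}^2.$$ Finally, $u\in C^\infty\big((0,+\infty)\times\mathbb T^3\big)$.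
   Context: Function spaces: $\mathbb T^3=\mathbb R^3/\mathbb Z^3$, $\hat u(k)=\int_{\mathbb T^3}u(x)e^{-2\pi i k\cdot x}\,dx$ for $k\in\mathbb Z^3$. For $s\ge0$, $\dot H^s=\dot H^s(\mathbb T^3;\mathbb R^3)$ is the space of mean-zero $L^2$ vector fields with $\|u\|_{\dot H^s}^2=\sum_{k\ne0}(4\pi^2|k|^2)^s|\hat u(k)|^2<\infty$. $(-\Delta)^\alpha$ is the Fourier multiplier $(4\pi^2|k|^2)^\alpha$. Frequencies: let $\sigma=(1,1,1)$. For integers $m\ge0$ let $k^m=2^{2m}\sigma+3^m(1,0,-1)$, $h^m=2^{2m+1}\sigma+3^m(1,1,-2)$, $j^m=2^{2m+1}\sigma+3^m(2,-1,-1)$. For $v\in\mathbb R^3$, $\mathcal P[v]$ is the set of all vectors obtained by permuting the entries of $v$. Let $\mathcal M^+_{2m}=\mathcal P[k^m]$, $\mathcal M^+_{2m+1}=\mathcal P[h^m]\cup\mathcal P[j^m]$, $\mathcal M^+=\bigcup_{n\ge0}\mathcal M_n^+$, $\mathcal M=\mathcal M^+\cup(-\mathcal M^+)$. For $k\in\mathcal M$ let $P_k^\perp(\sigma)=\sigma-\frac{k\cdot\sigma}{|k|^2}k$ and $v^k=P_k^\perp(\sigma)/|P_k^\perp(\sigma)|$. Constraint space: $\dot H^s_{\mathcal M}$ is the set of $u\in\dot H^s(\mathbb T^3;\mathbb R^3)$ with $\operatorname{supp}\hat u\subset\mathcal M$ and $\hat u(k)\in\operatorname{span}\{v^k\}$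 (complex multiples of $v^k$) for all $k\in\mathcal M$. The projection $\mathbb P_{\mathcal M}$ is given by $\widehat{\mathbb P_{\mathcal M}w}(k)=(v^k\cdot\hat w(k))v^k$ for $k\in\mathcal M$ and $0$ for $k\notin\mathcal M$; $(u\cdot\nabla)u=\nabla\cdot(u\otimes u)$ in the sense of distributions. Equation: the Fourier-restricted hypodissipative Navier--Stokes equation is $\partial_tu+\nu(-\Delta)^\alpha u+\mathbb P_{\mathcal M}((u\cdot\nabla)u)=0$. A solution $u\in C([0,T);\dot H^s_{\mathcal M})$ (with $s\ge0$, $s>\frac{\log3}{2\log2}-2\alpha$) is understood as a mild solution: for all $0<t<T$, $u(\cdot,t)=e^{-\nu t(-\Delta)^\alpha}u^0-\int_0^te^{-\nu(t-\tau)(-\Delta)^\alpha}\mathbb P_{\mathcal M}((u\cdot\nabla)u)(\cdot,\tau)\,d\tau$. *)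

theory Defs
  imports "HOL-Analysis.Analysis"
begin

subsection \<open>Function spaces on the torus\<close>

text \<open>
  Functions on the torus are functions on \<^typ>\<open>real^3\<close> that are invariant under integer
  translations; the integral over the torus is the Lebesgue integral over the unit cube.
  Elements of the \<open>L\<^sup>2\<close>-based spaces are represented by functions, and equality in these
  spaces is equality almost everywhere.
\<close>

definition rvec :: "int^3 \<Rightarrow> real^3" where
  "rvec k = (\<chi> i. real_of_int (k $ i))"

definition cvec :: "real^3 \<Rightarrow> complex^3" where
  "cvec v = (\<chi> i. complex_of_real (v $ i))"

definition torus_periodic :: "(real^3 \<Rightarrow> 'b) \<Rightarrow> bool" where
  "torus_periodic u \<longleftrightarrow> (\<forall>k x. u (x + rvec k) = u x)"

definition unit_cube :: "(real^3) set" where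
  "unit_cube = cbox 0 1"

definition ae_eq :: "(real^3 \<Rightarrow> real^3) \<Rightarrow> (real^3 \<Rightarrow> real^3) \<Rightarrow> bool" where
  "ae_eq u w \<longleftrightarrow> (AE x in lebesgue. u x = w x)"

definition L2_torus :: "(real^3 \<Rightarrow> real^3) set" where
  "L2_torus = {u. torus_periodic u \<and> u \<in> borel_measurable lebesgue \<and>
                  set_integrable lebesgue unit_cube (\<lambda>x. (norm (u x))\<^sup>2)}"

definition L2_norm_torus :: "(real^3 \<Rightarrow> real^3) \<Rightarrow> real" where
  "L2_norm_torus u = sqrt (LINT x:unit_cube|lebesgue. (norm (u x))\<^sup>2)"

definition scalar_fourier :: "(real^3 \<Rightarrow> real) \<Rightarrow> int^3 \<Rightarrow> complex" where
  "scalar_fourier f k =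
     (LINT x:unit_cube|lebesgue. complex_of_real (f x) * exp (- 2 * pi * \<i> * (rvec k \<bullet> x)))"

definition fourier :: "(real^3 \<Rightarrow> real^3) \<Rightarrow> int^3 \<Rightarrow> complex^3" where
  "fourier u k = (\<chi> i. scalar_fourier (\<lambda>x. u x $ i) k)"

text \<open>The symbol of \<open>(-\<Delta>)\<^sup>\<alpha>\<close>.\<close>

definition laplace_symbol :: "real \<Rightarrow> int^3 \<Rightarrow> real" where
  "laplace_symbol \<alpha> k = (4 * pi\<^sup>2 * (norm (rvec k))\<^sup>2) powr \<alpha>"

text \<open>The condition \<open>fourier u 0 = 0\<close> says that \<open>u\<close> has mean zero.\<close>

definition Hdot :: "real \<Rightarrow> (real^3 \<Rightarrow> real^3) set" where
  "Hdot s = {u \<in> L2_torus. fourier u 0 = 0 \<and>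
               (\<lambda>k. laplace_symbol s k * (norm (fourier u k))\<^sup>2) summable_on (UNIV - {0})}"

definition Hdot_norm :: "real \<Rightarrow> (real^3 \<Rightarrow> real^3) \<Rightarrow> real" where
  "Hdot_norm s u =
     sqrt (\<Sum>\<^sub>\<infinity>k\<in>UNIV - {0}. laplace_symbol s k * (norm (fourier u k))\<^sup>2)"


subsection \<open>The frequency set and the constraint space\<close>

definition sigma_vec :: "int^3" where
  "sigma_vec = vector [1, 1, 1]"

definition k_freq :: "nat \<Rightarrow> int^3" where
  "k_freq m = 2 ^ (2 * m) *s sigma_vec + 3 ^ m *s vector [1, 0, -1]"

definition h_freq :: "nat \<Rightarrow> int^3" where
  "h_freq m = 2 ^ (2 * m + 1) *s sigma_vec + 3 ^ m *s vector [1, 1, -2]"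

definition j_freq :: "nat \<Rightarrow> int^3" where
  "j_freq m = 2 ^ (2 * m + 1) *s sigma_vec + 3 ^ m *s vector [2, -1, -1]"

definition entry_perms :: "int^3 \<Rightarrow> (int^3) set" where
  "entry_perms v = {(\<chi> i. v $ p i) | p. bij p}"

definition M_shell :: "nat \<Rightarrow> (int^3) set" where
  "M_shell n = (if even n then entry_perms (k_freq (n div 2))
                else entry_perms (h_freq (n div 2)) \<union> entry_perms (j_freq (n div 2)))"

definition M_plus :: "(int^3) set" where
  "M_plus = (\<Union>n. M_shell n)"

definition M_set :: "(int^3) set" where
  "M_set = M_plus \<union> uminus ` M_plus"

definition perp_sigma :: "int^3 \<Rightarrow> real^3" where
  "perp_sigma k = rvec sigma_vec
     - ((rvec k \<bullet> rvec sigma_vec) / (norm (rvec k))\<^sup>2) *\<^sub>R rvec k"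

definition v_dir :: "int^3 \<Rightarrow> real^3" where
  "v_dir k = (1 / norm (perp_sigma k)) *\<^sub>R perp_sigma k"

definition HdotM :: "real \<Rightarrow> (real^3 \<Rightarrow> real^3) set" where
  "HdotM s = {u \<in> Hdot s. (\<forall>k. k \<notin> M_set \<longrightarrow> fourier u k = 0) \<and>
                          (\<forall>k\<in>M_set. \<exists>c::complex. fourier u k = c *s cvec (v_dir k))}"


subsection \<open>The equation\<close>

text \<open>
  Periodic vector-valued distributions are represented by the family of their Fourier
  coefficients, on which the operators below act.
\<close>

type_synonym coeffs = "int^3 \<Rightarrow> complex^3"

definition proj_M :: "coeffs \<Rightarrow> coeffs" where
  "proj_M w k = (if k \<in> M_set
                 then (\<Sum>i\<in>UNIV. complex_of_real (v_dir k $ i) * w k $ i) *s cvec (v_dir k)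
                 else 0)"

text \<open>
  Fourier coefficients of the distribution \<open>\<nabla> \<cdot> (u \<otimes> u)\<close>: for \<open>u\<close> in \<open>L\<^sup>2\<close> the products
  \<open>u\<^sub>j u\<^sub>i\<close> are integrable, and testing the distributional derivative \<open>\<partial>\<^sub>j (u\<^sub>j u\<^sub>i)\<close> against the
  character \<open>exp (-2\<pi>\<i> k \<bullet> x)\<close> gives the factor \<open>2\<pi>\<i> k\<^sub>j\<close>.
\<close>

definition div_tensor :: "(real^3 \<Rightarrow> real^3) \<Rightarrow> coeffs" where
  "div_tensor u k =
     (\<chi> i. \<Sum>j\<in>UNIV. 2 * pi * \<i> * of_int (k $ j) * scalar_fourier (\<lambda>x. u x $ j * u x $ i) k)"

text \<open>The operator \<open>exp (-r (-\<Delta>)\<^sup>\<alpha>)\<close>.\<close>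

definition dissipation_semigroup :: "real \<Rightarrow> real \<Rightarrow> coeffs \<Rightarrow> coeffs" where
  "dissipation_semigroup \<alpha> r c k = exp (- r * laplace_symbol \<alpha> k) *\<^sub>R c k"

definition time_continuous :: "real \<Rightarrow> ereal \<Rightarrow> (real \<Rightarrow> real^3 \<Rightarrow> real^3) \<Rightarrow> bool" where
  "time_continuous s T u \<longleftrightarrow>
     (let I = {t. 0 \<le> t \<and> ereal t < T} in
       (\<forall>t\<in>I. u t \<in> HdotM s) \<and>
       (\<forall>t\<^sub>0\<in>I. ((\<lambda>t. Hdot_norm s (\<lambda>x. u t x - u t\<^sub>0 x)) \<longlongrightarrow> 0) (at t\<^sub>0 within I)))"

text \<open>
  Mild solutions in \<open>C([0,T); HdotM s)\<close> with initial data \<open>u\<^sub>0\<close>. The Duhamel identity is an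
  identity of distributions; the time integral of a distribution-valued function is the
  distribution whose Fourier coefficients are the time integrals of the Fourier coefficients.
\<close>

definition mild_solution ::
    "real \<Rightarrow> real \<Rightarrow> real \<Rightarrow> ereal \<Rightarrow> (real^3 \<Rightarrow> real^3) \<Rightarrow> (real \<Rightarrow> real^3 \<Rightarrow> real^3) \<Rightarrow> bool" where
  "mild_solution \<alpha> \<nu> s T u\<^sub>0 u \<longleftrightarrow>
     time_continuous s T u \<and> ae_eq (u 0) u\<^sub>0 \<and>
     (\<forall>t k. 0 < t \<and> ereal t < T \<longrightarrow>
        set_integrable lborel {0..t}
          (\<lambda>\<tau>. dissipation_semigroup \<alpha> (\<nu> * (t - \<tau>)) (proj_M (div_tensor (u \<tau>))) k) \<and>
        fourier (u t) k = dissipation_semigroup \<alpha> (\<nu> * t) (fourier u\<^sub>0) k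
          - (LINT \<tau>:{0..t}|lborel.
               dissipation_semigroup \<alpha> (\<nu> * (t - \<tau>)) (proj_M (div_tensor (u \<tau>))) k))"


subsection \<open>Smooth functions\<close>

text \<open>These notions are meant for open \<open>S\<close>, where they are the usual classes \<open>C\<^sup>n\<close> and \<open>C\<^sup>\<infinity>\<close>.\<close>

fun Cn_on ::
    "nat \<Rightarrow> 'a::euclidean_space set \<Rightarrow> ('a \<Rightarrow> 'b::real_normed_vector) \<Rightarrow> bool" where
  "Cn_on 0 S f \<longleftrightarrow> continuous_on S f"
| "Cn_on (Suc n) S f \<longleftrightarrow>
     (\<forall>x\<in>S. f differentiable (at x)) \<and>
     (\<forall>v. Cn_on n S (\<lambda>x. frechet_derivative f (at x) v))"

definition Cinf_on :: "'a::euclidean_space set \<Rightarrow> ('a \<Rightarrow> 'b::real_normed_vector) \<Rightarrow> bool" where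
  "Cinf_on S f \<longleftrightarrow> (\<forall>n. Cn_on n S f)"

end

theory Submission
  imports Defs
begin

text \<open>
  A field in the constraint space is given by scalar amplitudes \<open>c\<^sub>k\<close>, and the equation becomes an
  infinite system of ordinary differential equations in which each mode meets a bounded number of
  triads \<open>p + q = k\<close>. The coordinate sums of the frequencies are \<open>\<plusminus>3 * 2\<^sup>n\<close>, hence only neighbouring
  levels interact; the direction \<open>v\<^sup>k\<close> is almost orthogonal to \<open>\<sigma>\<close>, hence the coefficients are only
  of size \<open>3\<^sup>n\<^sup>/\<^sup>2\<close> on the level of frequencies of size \<open>2\<^sup>n\<close>. The weighted sup norm
  \<open>sup\<^sub>k \<bar>k\<bar>\<^sup>s \<bar>c\<^sub>k\<bar>\<close> is subcritical for \<open>s > log 3 / (2 log 2) - 2\<alpha>\<close>: each Duhamel integral gains decay in \<open>k\<close>,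
  which gives uniqueness, solutions of a truncated system, and decay faster than any power of \<open>k\<close> at
  positive times. For positive times all sums converge absolutely; the energy identity follows from
  the antisymmetry of the coefficients under exchange of two legs of a triad. Since
  \<open>2\<alpha> \<ge> log 3 / (2 log 2)\<close>, the nonlinear flux of the \<open>H\<^sup>s\<close> norm is at most a multiple of
  \<open>\<parallel>u\<parallel>\<^sub>\<alpha> \<parallel>u\<parallel>\<^sub>s \<parallel>u\<parallel>\<^sub>s\<^sub>+\<^sub>\<alpha>\<close>, and the product of \<open>\<parallel>u\<parallel>\<^sub>s\<^sup>2\<close> with the exponential of a multiple of the \<open>L\<^sup>2\<close>
  energy is nonincreasing. This bound does not depend on the truncation, so the truncation is never active.
\<close>

subsection \<open>Geometry of the frequency set\<close>

text \<open>The equation is stated for products of merely square integrable fields, so reducing it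
  to amplitudes needs the convolution formula for the Fourier coefficients of such a product. That
  formula is the polarised identity of Parseval, hence completeness of the characters is proved on
  the way. The sup norm fits because the frequencies of a triad are comparable and few: the
  quadratic term reproduces a pointwise power bound without any convolution inequality, and a single
  mode is trivially bounded by the H^s norm. Time is handled by a weight exp (L t) rather than by
  short intervals: a large L acts as additional dissipation and makes the truncated problem a
  contraction on every interval at once. The obstacle at t = 0 is that the data lie only in H^s; the
  differential inequalities hold for t > 0 and are carried to t = 0 by a majorant of the amplitudes
  that does not depend on t. The constant C_s is made of the bound 324 for the number of triads per
  mode, the bound 128 for their coefficients, the loss 6^s from comparing frequencies within a
  triad, and a power of 2\<pi> left by the Laplace symbol.\<close>

definition freq :: "int^3 \<Rightarrow> real" where
  "freq k = norm (rvec k)"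

definition M_level :: "nat \<Rightarrow> (int^3) set" where
  "M_level n = M_shell n \<union> uminus ` M_shell n"

lemma M_set_eq_levels: "M_set = (\<Union>n. M_level n)"
  by (auto simp: M_set_def M_plus_def M_level_def)

lemma uminus_M_level: "k \<in> M_level n \<Longrightarrow> - k \<in> M_level n"
  by (auto simp: M_level_def)

lemma uminus_in_M_set_iff [simp]: "- k \<in> M_set \<longleftrightarrow> k \<in> M_set"
  using uminus_M_level[of k] uminus_M_level[of "-k"] by (auto simp: M_set_eq_levels)

lemma rvec_add: "rvec (p + q) = rvec p + rvec q"
  by (simp add: rvec_def vec_eq_iff)

lemma rvec_minus: "rvec (- p) = - rvec p"
  by (simp add: rvec_def vec_eq_iff)

lemma rvec_diff: "rvec (p - q) = rvec p - rvec q"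
  by (simp add: rvec_def vec_eq_iff)

lemma rvec_zero [simp]: "rvec 0 = 0"
  by (simp add: rvec_def vec_eq_iff)

lemma inner_sigma: "rvec k \<bullet> rvec sigma_vec = real_of_int (\<Sum>i\<in>UNIV. k $ i)"
  by (simp add: inner_vec_def rvec_def sigma_vec_def sum_3)

lemma inner_sigma_sigma: "rvec sigma_vec \<bullet> rvec sigma_vec = 3"
  by (simp add: inner_vec_def rvec_def sigma_vec_def sum_3)

lemma freq_power2: "(freq k)\<^sup>2 = real_of_int (\<Sum>i\<in>UNIV. (k $ i)\<^sup>2)"
  unfolding freq_def power2_norm_eq_inner by (simp add: inner_vec_def rvec_def power2_eq_square)

lemma entry_perms_sum:
  assumes "k \<in> entry_perms v"
  shows "(\<Sum>i\<in>UNIV. f (k $ i)) = (\<Sum>i\<in>UNIV. f (v $ i))"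
proof -
  obtain p where p: "bij p" "k = (\<chi> i. v $ p i)"
    using assms by (auto simp: entry_perms_def)
  show ?thesis
    using sum.reindex_bij_betw[of p UNIV UNIV "\<lambda>i. f (v $ i)"] p by simp
qed

text \<open>The vectors (1,0,-1), (1,1,-2), (2,-1,-1) are orthogonal to \<sigma> with squared
  lengths 2, 6, 6. Since 6 * 9^m = 2 * 3^(2m+1), the three families obey a single formula in the
  level n, which is 2m for k^m and 2m + 1 for h^m and j^m.\<close>

lemma M_shell_sums:
  assumes "k \<in> M_shell n"
  shows "(\<Sum>i\<in>UNIV. k $ i) = 3 * 2 ^ n" "(\<Sum>i\<in>UNIV. (k $ i)\<^sup>2) = 3 * 4 ^ n + 2 * 3 ^ n"
proof -
  have even: "(2::int) ^ (2 * m) = 4 ^ m" "(4::int) ^ (2 * m) = (4 ^ m)\<^sup>2" "(3::int) ^ (2 * m) = (3 ^ m)\<^sup>2" for m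
    by (simp add: power_mult, metis power_mult mult.commute, metis power_mult mult.commute)
  have vec: "(\<Sum>i\<in>UNIV. (a *s sigma_vec + b *s vector [x, y, z]) $ i) = 3 * a + b * (x + y + z)"
    "(\<Sum>i\<in>UNIV. ((a *s sigma_vec + b *s vector [x, y, z]) $ i)\<^sup>2)
      = 3 * a\<^sup>2 + 2 * a * b * (x + y + z) + b\<^sup>2 * (x\<^sup>2 + y\<^sup>2 + z\<^sup>2)" for a b x y z :: int
    by (simp_all add: sum_3 sigma_vec_def power2_eq_square algebra_simps)
  define m where "m = n div 2"
  consider "n = 2 * m" "k \<in> entry_perms (k_freq m)" | "n = Suc (2 * m)" "k \<in> entry_perms (h_freq m)"
    | "n = Suc (2 * m)" "k \<in> entry_perms (j_freq m)"
    using assms unfolding M_shell_def m_def by (cases "even n") (auto elim: oddE)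
  then have "(\<Sum>i\<in>UNIV. k $ i) = 3 * 2 ^ n \<and> (\<Sum>i\<in>UNIV. (k $ i)\<^sup>2) = 3 * 4 ^ n + 2 * 3 ^ n"
  proof cases
    case 1
    show ?thesis
      unfolding entry_perms_sum[OF 1(2), of "\<lambda>x. x"] entry_perms_sum[OF 1(2), of "\<lambda>x. x\<^sup>2"]
        k_freq_def vec 1(1) even by simp
  next
    case 2
    show ?thesis
      unfolding entry_perms_sum[OF 2(2), of "\<lambda>x. x"] entry_perms_sum[OF 2(2), of "\<lambda>x. x\<^sup>2"]
        h_freq_def vec 2(1) Suc_eq_plus1[symmetric] power_Suc even by (simp add: power_mult_distrib)
  next
    case 3
    show ?thesis
      unfolding entry_perms_sum[OF 3(2), of "\<lambda>x. x"] entry_perms_sum[OF 3(2), of "\<lambda>x. x\<^sup>2"]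
        j_freq_def vec 3(1) Suc_eq_plus1[symmetric] power_Suc even by (simp add: power_mult_distrib)
  qed
  then show "(\<Sum>i\<in>UNIV. k $ i) = 3 * 2 ^ n" "(\<Sum>i\<in>UNIV. (k $ i)\<^sup>2) = 3 * 4 ^ n + 2 * 3 ^ n"
    by auto
qed

lemma four_power: "(4::real) ^ n = (2 ^ n)\<^sup>2"
  by (induction n) (simp_all add: power_mult_distrib)

lemma M_level_sums:
  assumes "k \<in> M_level n"
  shows "\<bar>rvec k \<bullet> rvec sigma_vec\<bar> = 3 * 2 ^ n" "(freq k)\<^sup>2 = 3 * 4 ^ n + 2 * 3 ^ n"
proof -
  have *: "\<bar>rvec k \<bullet> rvec sigma_vec\<bar> = 3 * 2 ^ n \<and> (freq k)\<^sup>2 = 3 * 4 ^ n + 2 * 3 ^ n"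
    if "k \<in> M_shell n" for k
    unfolding inner_sigma freq_power2 M_shell_sums[OF that] by simp
  have "freq (- j) = freq j" for j by (simp add: freq_def rvec_minus)
  then show "\<bar>rvec k \<bullet> rvec sigma_vec\<bar> = 3 * 2 ^ n" "(freq k)\<^sup>2 = 3 * 4 ^ n + 2 * 3 ^ n"
    using assms *[of k] *[of "- k"] by (auto simp: M_level_def rvec_minus)
qed

text \<open>For i < j the sum 2^i + 2^j lies strictly between 2^j and 2^(j+1), so it is no power of
  two.\<close>

lemma power_two_triad:
  assumes "(2::real) ^ a + 2 ^ b = 2 ^ c"
  shows "a = b \<and> c = Suc a"
proof -
  have *: False if "i < j" "(2::real) ^ i + 2 ^ j = 2 ^ c" for i j
  proof -
    have ij: "(2::real) ^ i < 2 ^ j" using that(1) by simp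
    have "(2::real) ^ j < 2 ^ c" unfolding that(2)[symmetric] by simp
    then have "j < c" by simp
    have "(2::real) ^ c < 2 ^ Suc j" unfolding that(2)[symmetric] using ij by simp
    then have "c < Suc j" by (rule power_less_imp_less_exp[rotated]) simp
    with \<open>j < c\<close>
    show False by simp
  qed
  have ab: "a = b"
    using *[of a b] *[of b a] assms by (metis add.commute linorder_neqE_nat)
  then have "(2::real) ^ Suc a = 2 ^ c" using assms by simp
  then have "Suc a = c" by (subst (asm) power_inject_exp) auto
  then show ?thesis using ab by simp
qed

text \<open>The scalar product with \<sigma> is additive on the triad and equals, up to sign, 3
  times a power of two on each leg. Whatever the signs, one of the three powers is the sum of the
  other two, so two levels agree and the third is one higher. Only the closeness is recorded, in a
  form symmetric in the legs.\<close>

lemma levels_of_triad: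
  assumes "p \<in> M_level a" "q \<in> M_level b" "p + q \<in> M_level c"
  shows "a \<le> Suc b \<and> b \<le> Suc a \<and> a \<le> Suc c \<and> c \<le> Suc a \<and> b \<le> Suc c \<and> c \<le> Suc b"
proof -
  define x y where "x = rvec p \<bullet> rvec sigma_vec" and "y = rvec q \<bullet> rvec sigma_vec"
  have "\<bar>x\<bar> = 3 * 2 ^ a" "\<bar>y\<bar> = 3 * 2 ^ b" "\<bar>x + y\<bar> = 3 * 2 ^ c"
    using M_level_sums(1)[OF assms(1)] M_level_sums(1)[OF assms(2)] M_level_sums(1)[OF assms(3)]
    by (simp_all add: x_def y_def rvec_add inner_add_left)
  then have "(2::real) ^ a + 2 ^ b = 2 ^ c \<or> (2::real) ^ c + 2 ^ b = 2 ^ a \<or> (2::real) ^ a + 2 ^ c = 2 ^ b"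
    by linarith
  then show ?thesis using power_two_triad by (metis le_refl le_SucI)
qed

text \<open>108 = 2 * 2 * 27: two signs, at most two orbits per shell, and the 27 = 3^3 self-maps of
  the index set as a crude count in place of the six permutations.\<close>

lemma finite_M_level: "finite (M_level n)" and card_M_level: "card (M_level n) \<le> 108"
proof -
  have e: "finite (entry_perms v) \<and> card (entry_perms v) \<le> 27" for v
  proof -
    have sub: "entry_perms v \<subseteq> (\<lambda>p. \<chi> i. v $ p i) ` (UNIV :: (3 \<Rightarrow> 3) set)"
      by (auto simp: entry_perms_def)
    have "card (UNIV :: (3 \<Rightarrow> 3) set) = 27" by (simp add: card_fun)
    then have le: "card ((\<lambda>p. \<chi> i. v $ p i) ` (UNIV :: (3 \<Rightarrow> 3) set)) \<le> 27"
      using card_image_le[of "UNIV :: (3 \<Rightarrow> 3) set" "\<lambda>p. \<chi> i. v $ p i"] by simp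
    have fin: "finite ((\<lambda>p. \<chi> i. v $ p i) ` (UNIV :: (3 \<Rightarrow> 3) set))" by simp
    show ?thesis
      using le card_mono[OF fin sub] finite_subset[OF sub fin] by linarith
  qed
  have "card (A \<union> B) \<le> 54" if "card A \<le> 27" "card B \<le> 27" for A B :: "(int^3) set"
    using card_Un_le[of A B] that by linarith
  then have s: "finite (M_shell n)" "card (M_shell n) \<le> 54"
    using e order_trans[OF conjunct2[OF e], of 54] by (auto simp: M_shell_def)
  from s(1) show "finite (M_level n)" by (simp add: M_level_def)
  show "card (M_level n) \<le> 108"
    using s(2) card_Un_le[of "M_shell n" "uminus ` M_shell n"] card_image_le[OF s(1), of uminus]
    unfolding M_level_def by linarith
qed

lemma freq_minus [simp]: "freq (- k) = freq k"
  by (simp add: freq_def rvec_minus)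

lemma freq_M_level_bounds:
  assumes "k \<in> M_level n"
  shows "2 ^ n \<le> freq k" "freq k \<le> 3 * 2 ^ n"
proof -
  have f: "(freq k)\<^sup>2 = 3 * 4 ^ n + 2 * 3 ^ n" by (rule M_level_sums(2)[OF assms])
  note four = four_power[of n, symmetric]
  have le: "(3::real) ^ n \<le> 4 ^ n" by (rule power_mono) auto
  show "2 ^ n \<le> freq k"
  proof (rule power2_le_imp_le)
    show "((2::real) ^ n)\<^sup>2 \<le> (freq k)\<^sup>2" unfolding f four using zero_le_power[of "3::real" n]
        zero_le_power[of "4::real" n] by linarith
  qed (simp add: freq_def)
  show "freq k \<le> 3 * 2 ^ n"
  proof (rule power2_le_imp_le)
    have "3 * 4 ^ n + 2 * 3 ^ n \<le> (9 * 4 ^ n :: real)"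
      using le zero_le_power[of "4::real" n] by linarith
    then show "(freq k)\<^sup>2 \<le> (3 * 2 ^ n)\<^sup>2" unfolding f power_mult_distrib four by simp
  qed simp
qed

lemma freq_ge_1: "k \<in> M_set \<Longrightarrow> 1 \<le> freq k"
  using order_trans[OF one_le_power[of "2::real"] freq_M_level_bounds(1)]
  by (auto simp: M_set_eq_levels)

lemma M_set_nonzero: "k \<in> M_set \<Longrightarrow> k \<noteq> 0"
  using freq_ge_1[of k] by (auto simp: freq_def)

definition pairs :: "int^3 \<Rightarrow> (int^3) set" where
  "pairs k = {p. p \<in> M_set \<and> k - p \<in> M_set}"

lemma pairs_M_set: "p \<in> pairs k \<Longrightarrow> p \<in> M_set" "p \<in> pairs k \<Longrightarrow> k - p \<in> M_set"
  by (simp_all add: pairs_def)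

lemma pairs_level:
  assumes "k \<in> M_level c" "p \<in> pairs k"
  obtains a b where "p \<in> M_level a" "k - p \<in> M_level b"
     "a \<le> Suc b" "b \<le> Suc a" "a \<le> Suc c" "c \<le> Suc a" "b \<le> Suc c" "c \<le> Suc b"
proof -
  obtain a b where ab: "p \<in> M_level a" "k - p \<in> M_level b"
    using assms(2) by (auto simp: pairs_def M_set_eq_levels)
  show ?thesis using levels_of_triad[OF ab, of c] assms(1) ab that by simp
qed

text \<open>A pair is determined by p, and p lies on one of the three levels next to that of k, so
  324 = 3 * 108. For level 0 the truncated subtraction \<open>c - 1\<close> only shortens the
  range.\<close>

lemma pairs_card:
  assumes "k \<in> M_set"
  shows "finite (pairs k)" "card (pairs k) \<le> 324"
proof -
  obtain c where c: "k \<in> M_level c" using assms by (auto simp: M_set_eq_levels)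
  have sub: "pairs k \<subseteq> (\<Union>a\<in>{c - 1..Suc c}. M_level a)"
  proof
    fix p assume "p \<in> pairs k"
    then obtain a where "p \<in> M_level a" "a \<le> Suc c" "c \<le> Suc a"
      using pairs_level[OF c] by metis
    moreover from this have "a \<in> {c - 1..Suc c}" by auto
    ultimately show "p \<in> (\<Union>a\<in>{c - 1..Suc c}. M_level a)" by blast
  qed
  show "finite (pairs k)" by (rule finite_subset[OF sub]) (simp add: finite_M_level)
  have "card (pairs k) \<le> card (\<Union>a\<in>{c - 1..Suc c}. M_level a)"
    by (rule card_mono[OF _ sub]) (simp add: finite_M_level)
  also have "\<dots> \<le> (\<Sum>a\<in>{c - 1..Suc c}. card (M_level a))" by (rule card_UN_le) simp
  also have "\<dots> \<le> (\<Sum>a\<in>{c - 1..Suc c}. 108)" by (rule sum_mono) (rule card_M_level)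
  also have "\<dots> = card {c - 1..Suc c} * 108" by (simp only: sum_constant of_nat_id)
  finally have "card (pairs k) \<le> card {c - 1..Suc c} * 108" .
  moreover have "card {c - 1..Suc c} \<le> 3" by simp
  ultimately show "card (pairs k) \<le> 324" by linarith
qed

text \<open>6 = 3 * 2: frequencies of one level agree up to the factor 3, and one step between
  levels costs 2.\<close>

lemma freq_level_le:
  assumes "p \<in> M_level a" "q \<in> M_level b" "a \<le> Suc b"
  shows "freq p \<le> 6 * freq q"
proof -
  have "freq p \<le> 3 * 2 ^ a" by (rule freq_M_level_bounds[OF assms(1)])
  also have "\<dots> \<le> 3 * 2 ^ Suc b" using assms(3) by (intro mult_left_mono power_increasing) auto
  also have "\<dots> \<le> 6 * freq q" using freq_M_level_bounds(1)[OF assms(2)] by simp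
  finally show ?thesis .
qed

lemma freq_triad:
  assumes "k \<in> M_set" "p \<in> pairs k" "x \<in> {k, p, k - p}" "y \<in> {k, p, k - p}"
  shows "freq x \<le> 6 * freq y"
proof -
  obtain c where c: "k \<in> M_level c" using assms by (auto simp: M_set_eq_levels)
  from pairs_level[OF c assms(2)] obtain a b where ab: "p \<in> M_level a" "k - p \<in> M_level b"
     "a \<le> Suc b" "b \<le> Suc a" "a \<le> Suc c" "c \<le> Suc a" "b \<le> Suc c" "c \<le> Suc b" .
  have 1: "freq z \<le> 6 * freq w" if "z \<in> M_level i" "w \<in> M_level j" "i \<le> Suc j" for z w i j
    by (rule freq_level_le[OF that])
  show ?thesis
    using assms(3,4) 1[OF c c] 1[OF c ab(1)] 1[OF c ab(2)] 1[OF ab(1) c] 1[OF ab(1,1)]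
      1[OF ab(1,2)] 1[OF ab(2) c] 1[OF ab(2,1)] 1[OF ab(2,2)] ab(3-)
    by (elim insertE emptyE) simp_all
qed

text \<open>
  The number of derivatives in the nonlinearity: on the level \<open>n\<close>, where \<open>\<bar>k\<bar>\<close> is of size \<open>2\<^sup>n\<close>,
  the interaction coefficients are of size \<open>3\<^sup>n\<^sup>/\<^sup>2 = (2\<^sup>n) powr lam\<close>.
\<close>

abbreviation (input) lam :: real where
  "lam \<equiv> ln 3 / (2 * ln 2)"

lemma lam_pos: "0 < lam"
  by simp

lemma sqrt_three_power: "sqrt (3 ^ n) = (2 ^ n) powr lam"
proof -
  have "(2 ^ n) powr lam = exp (lam * (real n * ln 2))"
    by (simp add: powr_def ln_realpow)
  also have "lam * (real n * ln 2) = real n * ln 3 / 2" by simp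
  also have "exp (real n * ln 3 / 2) = sqrt (exp (real n * ln 3))"
    by (rule real_sqrt_unique[symmetric]) (simp_all flip: exp_add exp_double add: power2_eq_square)
  also have "exp (real n * ln 3) = 3 ^ n" by (metis exp_of_nat_mult exp_ln zero_less_numeral)
  finally show ?thesis by simp
qed

section \<open>Polarisation directions and interaction coefficients\<close>

lemma norm_v_dir_le_1: "norm (v_dir k) \<le> 1"
  by (simp add: v_dir_def)

lemma v_dir_minus: "v_dir (- k) = v_dir k"
  by (simp add: v_dir_def perp_sigma_def rvec_minus)

text \<open>Divergence-freeness in Fourier variables; it is the source of the cancellation in
  \<open>coef_flip\<close>.\<close>

lemma inner_v_dir_self:
  assumes "k \<noteq> 0" shows "rvec k \<bullet> v_dir k = 0"
proof -
  have "rvec k \<noteq> 0" using assms by (auto simp: rvec_def vec_eq_iff)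
  then show ?thesis
    by (simp add: v_dir_def perp_sigma_def inner_diff_right power2_norm_eq_inner)
qed

text \<open>By Pythagoras the squared length is 3 - x^2 / |k|^2 with x = k . \<sigma>, and 3 |k|^2 -
  x^2 = 6 * 3^n by the level formulas. The quotient is of size (3/4)^n: k turns parallel to \<sigma>
  as n grows, which is the smallness behind the coefficient bounds.\<close>

lemma perp_sigma_norm:
  assumes "k \<in> M_level n"
  shows "(norm (perp_sigma k))\<^sup>2 = 6 * 3 ^ n / (3 * 4 ^ n + 2 * 3 ^ n)"
    "rvec sigma_vec \<bullet> perp_sigma k = (norm (perp_sigma k))\<^sup>2"
proof -
  define f where "f = (3 * 4 ^ n + 2 * 3 ^ n :: real)"
  have f: "(norm (rvec k))\<^sup>2 = f" using M_level_sums(2)[OF assms] by (simp add: freq_def f_def)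
  have fpos: "f > 0" by (simp add: f_def add_pos_pos)
  define x where "x = rvec k \<bullet> rvec sigma_vec"
  have x2: "x\<^sup>2 = 9 * 4 ^ n"
    using M_level_sums(1)[OF assms] power2_abs[of x]
    by (simp add: x_def power_mult_distrib four_power)
  have P: "perp_sigma k = rvec sigma_vec - (x / f) *\<^sub>R rvec k"
    by (simp add: perp_sigma_def f x_def)
  have xs: "rvec sigma_vec \<bullet> rvec k = x" "rvec k \<bullet> rvec sigma_vec = x" "rvec k \<bullet> rvec k = f"
    using f by (simp_all add: x_def inner_commute power2_norm_eq_inner)
  have "rvec sigma_vec \<bullet> perp_sigma k = 3 - x\<^sup>2 / f"
    by (simp add: P inner_diff_right inner_sigma_sigma xs power2_eq_square)
  moreover have "rvec k \<bullet> perp_sigma k = 0"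
    using fpos by (simp add: P inner_diff_right xs)
  then have e: "(norm (perp_sigma k))\<^sup>2 = rvec sigma_vec \<bullet> perp_sigma k"
    unfolding power2_norm_eq_inner
    by (subst P) (simp add: inner_diff_left)
  moreover have "3 - x\<^sup>2 / f = 6 * 3 ^ n / f"
    using fpos unfolding x2 by (simp add: field_simps) (simp add: f_def algebra_simps)
  ultimately show "(norm (perp_sigma k))\<^sup>2 = 6 * 3 ^ n / (3 * 4 ^ n + 2 * 3 ^ n)"
    "rvec sigma_vec \<bullet> perp_sigma k = (norm (perp_sigma k))\<^sup>2" by (simp_all add: f_def)
qed

lemma norm_v_dir:
  assumes "k \<in> M_set" shows "norm (v_dir k) = 1"
proof -
  obtain n where n: "k \<in> M_level n" using assms by (auto simp: M_set_eq_levels)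
  have "(norm (perp_sigma k))\<^sup>2 > 0" unfolding perp_sigma_norm(1)[OF n] by (simp add: add_pos_pos)
  then show ?thesis by (simp add: v_dir_def)
qed

text \<open>The projection is orthogonal, so \<sigma> . v^k is exactly the length of the projected
  \<sigma>.\<close>

lemma sigma_v_dir_bound:
  assumes "k \<in> M_level n"
  shows "\<bar>rvec sigma_vec \<bullet> v_dir k\<bar> \<le> 2 * sqrt (3 ^ n) / 2 ^ n"
proof -
  have "(norm (perp_sigma k))\<^sup>2 \<le> (2 * sqrt (3 ^ n) / 2 ^ n)\<^sup>2"
  proof -
    have "(2 * sqrt (3 ^ n) / 2 ^ n)\<^sup>2 = 4 * 3 ^ n / 4 ^ n"
      by (simp add: power_divide power_mult_distrib four_power)
    moreover have "6 * y / (3 * z + 2 * y) \<le> 4 * y / z" if "0 < y" "0 < z" for y z :: real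
    proof -
      have "6 * y / (3 * z + 2 * y) \<le> 6 * y / (3 * z)"
        using that by (intro divide_left_mono mult_pos_pos) simp_all
      also have "\<dots> \<le> 4 * y / z" using that by (simp add: field_simps)
      finally show ?thesis .
    qed
    ultimately show ?thesis unfolding perp_sigma_norm(1)[OF assms] by simp
  qed
  then have "norm (perp_sigma k) \<le> 2 * sqrt (3 ^ n) / 2 ^ n"
    by (rule power2_le_imp_le) simp
  moreover have "rvec sigma_vec \<bullet> v_dir k = norm (perp_sigma k)"
    using perp_sigma_norm(2)[OF assms] by (simp add: v_dir_def power2_eq_square)
  ultimately show ?thesis by simp
qed

text \<open>Split q along \<sigma>. The component along \<sigma> has size 2^b but meets
  \<open>v_dir p\<close> only with a factor of order (sqrt 3 / 2)^a; the orthogonal remainder z has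
  squared length 2 * 3^b. With b \<le> a + 1 both contributions are at most 4 * sqrt (3^a), while
  |q| alone may be of size 2^a.\<close>

lemma inner_v_dir_bound:
  assumes "p \<in> M_level a" "q \<in> M_level b" "b \<le> Suc a"
  shows "\<bar>rvec q \<bullet> v_dir p\<bar> \<le> 8 * sqrt (3 ^ a)"
proof -
  define x where "x = rvec q \<bullet> rvec sigma_vec"
  define z where "z = rvec q - (x / 3) *\<^sub>R rvec sigma_vec"
  have x: "\<bar>x\<bar> = 3 * 2 ^ b" unfolding x_def by (rule M_level_sums(1)[OF assms(2)])
  have x2: "x\<^sup>2 = 9 * 4 ^ b"
    using x power2_abs[of x]
    by (simp add: power_mult_distrib four_power)
  have "(norm z)\<^sup>2 = (norm (rvec q))\<^sup>2 - x\<^sup>2 / 3"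
  proof -
    have "rvec q \<bullet> rvec sigma_vec = x" "rvec sigma_vec \<bullet> rvec q = x"
      by (simp_all add: x_def inner_commute)
    then show ?thesis
      unfolding power2_norm_eq_inner z_def
      by (simp add: inner_diff_left inner_diff_right inner_sigma_sigma power2_eq_square)
  qed
  also have "\<dots> = 2 * 3 ^ b"
    using M_level_sums(2)[OF assms(2)] x2 by (simp add: freq_def)
  also have "\<dots> \<le> 2 * 3 ^ Suc a" using assms(3) by (intro mult_left_mono power_increasing) auto
  also have "\<dots> \<le> (4 * sqrt (3 ^ a))\<^sup>2" by (simp add: power_mult_distrib)
  finally have z: "norm z \<le> 4 * sqrt (3 ^ a)" by (rule power2_le_imp_le) simp
  have "rvec q \<bullet> v_dir p = z \<bullet> v_dir p + (x / 3) * (rvec sigma_vec \<bullet> v_dir p)"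
    by (simp add: z_def inner_diff_left)
  then have "\<bar>rvec q \<bullet> v_dir p\<bar> \<le> \<bar>z \<bullet> v_dir p\<bar> + \<bar>x / 3\<bar> * \<bar>rvec sigma_vec \<bullet> v_dir p\<bar>"
    by (simp add: abs_triangle_ineq flip: abs_mult)
  also have "\<bar>z \<bullet> v_dir p\<bar> \<le> norm z * 1"
    by (rule order_trans[OF Cauchy_Schwarz_ineq2]) (intro mult_left_mono norm_v_dir_le_1 norm_ge_zero)
  also have "\<bar>x / 3\<bar> * \<bar>rvec sigma_vec \<bullet> v_dir p\<bar> \<le> 2 ^ Suc a * (2 * sqrt (3 ^ a) / 2 ^ a)"
  proof (intro mult_mono sigma_v_dir_bound assms(1))
    have "(2::real) ^ b \<le> 2 ^ Suc a" by (rule power_increasing) (use assms in auto)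
    then show "\<bar>x / 3\<bar> \<le> 2 ^ Suc a" using x by simp
  qed auto
  also have "2 ^ Suc a * (2 * sqrt (3 ^ a) / 2 ^ a) = 4 * sqrt (3 ^ a)" by simp
  finally show ?thesis using z by simp
qed

text \<open>Up to the factor i, this is what multiplies c_p c_(k-p) in the component along v^k of
  the Fourier coefficient of div (u \<otimes> u). The factor i stays in \<open>bil\<close>, so that
  \<open>coef\<close> is real.\<close>

definition coef :: "int^3 \<Rightarrow> int^3 \<Rightarrow> real" where
  "coef k p = 2 * pi * (rvec k \<bullet> v_dir p) * (v_dir (k - p) \<bullet> v_dir k)"

text \<open>128 = 8 * 16: 2\<pi> \<le> 8, and 16 is the 8 of \<open>inner_v_dir_bound\<close> times
  sqrt 3 \<le> 2 for moving to a neighbouring level. The freedom to choose the leg x is used in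
  \<open>triad_weight\<close>, which takes the smaller of two frequencies.\<close>

lemma coef_bound:
  assumes "k \<in> M_set" "p \<in> pairs k" "x \<in> {k, p, k - p}"
  shows "\<bar>coef k p\<bar> \<le> 128 * freq x powr lam"
proof -
  obtain c where c: "k \<in> M_level c" using assms by (auto simp: M_set_eq_levels)
  from pairs_level[OF c assms(2)] obtain a b where ab: "p \<in> M_level a" "k - p \<in> M_level b"
     "a \<le> Suc b" "b \<le> Suc a" "a \<le> Suc c" "c \<le> Suc a" "b \<le> Suc c" "c \<le> Suc b" .
  obtain d where d: "x \<in> M_level d" "a \<le> Suc d"
    using assms(3) c ab by auto
  have s: "\<bar>rvec k \<bullet> v_dir p\<bar> \<le> 8 * sqrt (3 ^ a)"
  proof -
    have "rvec k \<bullet> v_dir p = rvec (k - p) \<bullet> v_dir p"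
      using inner_v_dir_self[OF M_set_nonzero[OF pairs_M_set(1)[OF assms(2)]]]
      by (simp add: rvec_diff inner_diff_left)
    then show ?thesis using inner_v_dir_bound[OF ab(1,2,4)] by simp
  qed
  also have "sqrt (3 ^ a) \<le> sqrt (3 ^ Suc d)"
    using d(2) by (intro real_sqrt_le_mono power_increasing) auto
  also have "\<dots> \<le> 2 * sqrt (3 ^ d)"
    using real_sqrt_le_mono[of 3 "2\<^sup>2"] by (simp add: real_sqrt_mult)
  also have "sqrt (3 ^ d) \<le> freq x powr lam"
    unfolding sqrt_three_power
    by (rule powr_mono2) (use lam_pos freq_M_level_bounds(1)[OF d(1)] in auto)
  finally have t: "\<bar>rvec k \<bullet> v_dir p\<bar> \<le> 16 * freq x powr lam" by simp
  have v: "\<bar>v_dir (k - p) \<bullet> v_dir k\<bar> \<le> 1"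
    using Cauchy_Schwarz_ineq2[of "v_dir (k - p)" "v_dir k"]
      mult_mono[OF norm_v_dir_le_1[of "k-p"] norm_v_dir_le_1[of k]] by simp
  have "\<bar>coef k p\<bar> = 2 * pi * \<bar>rvec k \<bullet> v_dir p\<bar> * \<bar>v_dir (k - p) \<bullet> v_dir k\<bar>"
    by (simp add: coef_def abs_mult)
  also have "\<dots> \<le> 8 * (16 * freq x powr lam) * 1"
    using pi_less_4 by (intro mult_mono t v) auto
  finally show ?thesis by simp
qed

lemma sum_UNION_le:
  fixes f :: "'b \<Rightarrow> real"
  assumes "finite I" "\<And>i. i \<in> I \<Longrightarrow> finite (A i)" "\<And>x. 0 \<le> f x"
  shows "sum f (\<Union>i\<in>I. A i) \<le> (\<Sum>i\<in>I. sum f (A i))"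
  using assms(1,2)
proof (induction I rule: finite_induct)
  case (insert i I)
  have "sum f (\<Union>i\<in>insert i I. A i) \<le> sum f (A i) + sum f (\<Union>i\<in>I. A i)"
    using sum.union_inter[of "A i" "\<Union>i\<in>I. A i" f] sum_nonneg[of "A i \<inter> (\<Union>i\<in>I. A i)" f] insert assms(3)
    by simp
  then show ?case using insert by force
qed simp

text \<open>A level holds boundedly many frequencies of size 2^n, so the sum is dominated by a
  geometric series and every positive exponent suffices. This lacunarity makes pointwise power
  bounds and square sums interchangeable at an arbitrarily small cost in the exponent.\<close>

lemma summable_freq_powr:
  assumes "0 < e"
  shows "(\<lambda>k. freq k powr (- e)) summable_on M_set"
proof (rule nonneg_bdd_above_summable_on)
  define r where "r = (2::real) powr (- e)"
  have r: "0 < r" "r < 1" using assms by (simp_all add: r_def powr_less_one)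
  show "bdd_above (sum (\<lambda>k. freq k powr - e) ` {F. F \<subseteq> M_set \<and> finite F})"
  proof (rule bdd_aboveI2)
    fix F assume F: "F \<in> {F. F \<subseteq> M_set \<and> finite F}"
    obtain l where l: "\<forall>k\<in>F. k \<in> M_level (l k)"
      using F unfolding M_set_eq_levels by (auto simp: subset_iff) metis
    define N where "N = Suc (Max (insert 0 (l ` F)))"
    have lN: "l k < N" if "k \<in> F" for k
      unfolding N_def less_Suc_eq_le using F that by (intro Max_ge) auto
    have "sum (\<lambda>k. freq k powr - e) F \<le> sum (\<lambda>k. freq k powr - e) (\<Union>n<N. M_level n)"
      using F l lN by (intro sum_mono2) (auto simp: finite_M_level)
    also have "\<dots> \<le> (\<Sum>n<N. \<Sum>k\<in>M_level n. freq k powr - e)"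
      by (rule sum_UNION_le) (auto simp: finite_M_level)
    also have "\<dots> \<le> (\<Sum>n<N. 108 * r ^ n)"
    proof (rule sum_mono)
      fix n
      have "freq k powr - e \<le> r ^ n" if "k \<in> M_level n" for k
      proof -
        have "freq k powr - e \<le> (2 ^ n) powr - e"
          by (rule powr_mono2') (use assms freq_M_level_bounds(1)[OF that] in auto)
        also have "\<dots> = r ^ n" by (simp add: r_def powr_powr mult.commute flip: powr_realpow)
        finally show ?thesis .
      qed
      then have "(\<Sum>k\<in>M_level n. freq k powr - e) \<le> real (card (M_level n)) * r ^ n"
        by (rule sum_bounded_above)
      also have "\<dots> \<le> 108 * r ^ n"
        using card_M_level[of n] r by (intro mult_right_mono) auto
      finally show "(\<Sum>k\<in>M_level n. freq k powr - e) \<le> 108 * r ^ n" .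
    qed
    also have "\<dots> = 108 * (\<Sum>n<N. r ^ n)" by (simp add: sum_distrib_left)
    also have "(\<Sum>n<N. r ^ n) = (1 - r ^ N) / (1 - r)" using r by (simp add: sum_gp_strict[of r N])
    also have "108 * ((1 - r ^ N) / (1 - r)) \<le> 108 * (1 / (1 - r))"
      using r by (intro mult_left_mono divide_right_mono) simp_all
    finally show "sum (\<lambda>k. freq k powr - e) F \<le> 108 * (1 / (1 - r))" .
  qed
qed simp


subsection \<open>Trigonometric polynomials on the torus\<close>

abbreviation cube :: "(real^3) measure" where
  "cube \<equiv> lebesgue_on unit_cube"

definition character :: "int^3 \<Rightarrow> real^3 \<Rightarrow> complex" where
  "character k x = exp (2 * pi * \<i> * (rvec k \<bullet> x))"

lemma unit_cube_sets [simp]: "unit_cube \<in> sets lebesgue"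
  by (simp add: unit_cube_def)

lemma integral_cube:
  fixes f :: "real^3 \<Rightarrow> 'a :: {banach, second_countable_topology}"
  shows "integral\<^sup>L cube f = (LINT x:unit_cube|lebesgue. f x)"
  by (simp add: integral_restrict_space set_lebesgue_integral_def)

lemma integrable_cube:
  fixes f :: "real^3 \<Rightarrow> 'a :: {banach, second_countable_topology}"
  shows "integrable cube f \<longleftrightarrow> set_integrable lebesgue unit_cube f"
  by (simp add: integrable_restrict_space set_integrable_def)

lemma measure_cube [simp]: "measure cube (space cube) = 1"
proof -
  have "measure cube (space cube) = measure lebesgue unit_cube"
    by (simp add: measure_restrict_space)
  also have "\<dots> = measure lborel unit_cube" by (simp add: unit_cube_def measure_completion)
  also have "\<dots> = 1"
    unfolding unit_cube_def by (subst content_cbox_cart) (auto simp: interval_ne_empty_cart)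
  finally show ?thesis .
qed

lemma finite_measure_cube: "finite_measure cube"
  by (rule finite_measure_lebesgue_on) (simp add: unit_cube_def)

interpretation cube: finite_measure cube
  by (rule finite_measure_cube)

lemma character_add: "character (k + l) x = character k x * character l x"
  by (simp add: character_def rvec_add inner_add_left distrib_left exp_add)

lemma character_zero [simp]: "character 0 x = 1"
  by (simp add: character_def)

lemma cnj_character: "cnj (character k x) = character (- k) x"
  by (simp add: character_def rvec_minus exp_cnj)

lemma norm_character [simp]: "norm (character k x) = 1"
  by (simp add: character_def norm_exp_eq_Re)

lemma continuous_character: "continuous_on S (character k)"
  unfolding character_def by (intro continuous_intros)

lemma measurable_character [measurable]: "character k \<in> borel_measurable cube"
  by (rule continuous_imp_measurable_on_sets_lebesgue[OF continuous_character unit_cube_sets])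

lemma integral_exp_interval:
  fixes n :: int
  shows "integral\<^sup>L lborel (\<lambda>t. indicator {0..1} t *\<^sub>R exp (2 * pi * \<i> * (of_int n * complex_of_real t)))
     = (if n = 0 then 1 else 0)" (is ?int)
    and "integrable lborel (\<lambda>t. indicator {0..1} t *\<^sub>R exp (2 * pi * \<i> * (of_int n * complex_of_real t)))"
      (is ?able)
proof -
  define a where "a = 2 * pi * \<i> * of_int n"
  have ae: "exp (2 * pi * \<i> * (of_int n * complex_of_real t)) = exp (a * t)" for t
    by (simp add: a_def mult.assoc)
  define F :: "real \<Rightarrow> complex" where
    "F = (\<lambda>t. if n = 0 then of_real t else exp (a * of_real t) / a)"
  have deriv: "(F has_vector_derivative exp (a * of_real t)) (at t within {0..1})" for t
  proof (cases "n = 0")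
    case True
    have "((\<lambda>t. of_real t :: complex) has_vector_derivative 1) (at t within {0..1})"
      by (rule has_vector_derivative_real_field[of "\<lambda>z. z"]) (rule DERIV_ident)
    then show ?thesis using True by (simp add: F_def a_def)
  next
    case False
    then have a: "a \<noteq> 0" by (simp add: a_def)
    have "((\<lambda>z. exp (a * z)) has_field_derivative exp (a * of_real t) * a) (at (of_real t))"
      using DERIV_chain'[OF DERIV_cmult_Id[of a "of_real t"] DERIV_exp] by (simp add: mult.commute)
    from DERIV_cdivide[OF this, of a]
    have "((\<lambda>z. exp (a * z) / a) has_field_derivative exp (a * of_real t)) (at (of_real t))"
      using a by simp
    then have "((\<lambda>t. exp (a * of_real t) / a) has_vector_derivative exp (a * of_real t)) (at t within {0..1})"
      by (rule has_vector_derivative_real_field)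
    then show ?thesis using False by (simp add: F_def)
  qed
  have "continuous_on {0..1} (\<lambda>t. exp (a * complex_of_real t))"
    by (intro continuous_intros)
  then have *: "has_bochner_integral lborel (\<lambda>t. indicator {0..1} t *\<^sub>R exp (a * complex_of_real t)) (F 1 - F 0)"
    using deriv by (intro has_bochner_integral_FTC_Icc) simp_all
  have "exp a = 1"
    using exp_integer_2pi[of "of_int n"] by (simp add: a_def mult_ac)
  then have "F 1 - F 0 = (if n = 0 then 1 else 0)"
    by (simp add: F_def)
  with * show ?int ?able
    unfolding ae by (simp_all add: has_bochner_integral_iff)
qed

text \<open>The integrand factors over the coordinates, so the integral is a product of
  one-dimensional ones, and a single non-zero entry of k makes it vanish.\<close>

lemma integral_character: "integral\<^sup>L cube (character k) = (if k = 0 then 1 else 0)"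
proof -
  \<comment> \<open>Lebesgue measure factors over \<open>Basis\<close>, not over the index type; the
    floor reads the integer entry of k back from a basis vector.\<close>
  define n where "n b = \<lfloor>rvec k \<bullet> b\<rfloor>" for b
  have n: "rvec k \<bullet> b = of_int (n b)" if "b \<in> Basis" for b
    using that by (auto simp: n_def Basis_vec_def inner_axis rvec_def)
  define h where "h = (\<lambda>b t. indicator {0..1} t *\<^sub>R exp (2 * pi * \<i> * (of_int (n b) * complex_of_real t)))"
  interpret product_sigma_finite "\<lambda>b::real^3. lborel :: real measure" ..
  have prod: "indicator unit_cube x *\<^sub>R character k x = (\<Prod>b\<in>Basis. h b (x \<bullet> b))" for x
  proof -
    have "character k x = (\<Prod>b\<in>Basis. exp (2 * pi * \<i> * (of_int (n b) * of_real (x \<bullet> b))))"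
      unfolding character_def
      by (subst euclidean_inner) (simp add: n sum_distrib_left flip: exp_sum)
    moreover have "(indicator unit_cube x :: real) = (\<Prod>b\<in>Basis. indicator {0..1} (x \<bullet> b))"
    proof -
      have "x \<in> unit_cube \<longleftrightarrow> (\<forall>b\<in>Basis. x \<bullet> b \<in> {0..1})"
        by (auto simp: unit_cube_def mem_box_cart Basis_vec_def inner_axis)
      then show ?thesis
        by (auto simp: indicator_def prod_zero_iff)
    qed
    ultimately show ?thesis
      by (simp add: h_def scaleR_conv_of_real prod.distrib)
  qed
  have "integral\<^sup>L cube (character k) = integral\<^sup>L lebesgue (\<lambda>x. indicator unit_cube x *\<^sub>R character k x)"
    by (simp add: integral_restrict_space)
  also have "\<dots> = integral\<^sup>L lborel (\<lambda>x. indicator unit_cube x *\<^sub>R character k x)"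
    by (rule integral_completion)
       (simp add: unit_cube_def borel_measurable_scaleR borel_measurable_continuous_onI continuous_character)
  also have "\<dots> = integral\<^sup>L lborel (\<lambda>x. \<Prod>b\<in>Basis. h b (x \<bullet> b))"
    by (simp only: prod)
  also have "\<dots> = (\<integral>f. (\<Prod>b\<in>Basis. h b ((\<Sum>b\<in>Basis. f b *\<^sub>R b) \<bullet> b)) \<partial>(\<Pi>\<^sub>M b\<in>Basis. lborel))"
    by (subst lborel_eq, rule integral_distr) (auto simp: h_def)
  also have "\<dots> = (\<integral>f. (\<Prod>b\<in>Basis. h b (f b)) \<partial>(\<Pi>\<^sub>M b\<in>Basis. lborel))"
    by (intro Bochner_Integration.integral_cong refl prod.cong) (simp add: inner_sum_left_Basis)
  also have "\<dots> = (\<Prod>b\<in>Basis. integral\<^sup>L lborel (h b))"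
    by (rule product_integral_prod) (simp_all only: finite_Basis h_def integral_exp_interval)
  also have "\<dots> = (\<Prod>b\<in>(Basis::(real^3) set). if n b = 0 then 1 else 0)"
    by (simp only: h_def integral_exp_interval)
  also have "\<dots> = (if k = 0 then 1 else 0)"
  proof -
    have "k = 0 \<longleftrightarrow> (\<forall>b\<in>Basis. n b = 0)"
    proof
      assume *: "\<forall>b\<in>Basis. n b = 0"
      have "k $ i = 0" for i
      proof -
        have "n (axis i 1) = 0" using * by (simp add: axis_in_Basis_iff)
        then show ?thesis by (simp add: n_def rvec_def inner_axis)
      qed
      then show "k = 0" by (simp add: vec_eq_iff)
    qed (auto simp: n_def)
    then show ?thesis by (auto simp: prod_zero_iff)
  qed
  finally show ?thesis .
qed

definition trig_poly :: "(real^3 \<Rightarrow> complex) \<Rightarrow> bool" where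
  "trig_poly f \<longleftrightarrow> (\<exists>F a. finite F \<and> f = (\<lambda>x. \<Sum>k\<in>F. a k * character k x))"

lemma trig_poly_const: "trig_poly (\<lambda>x. c)"
  unfolding trig_poly_def by (rule exI[of _ "{0}"], rule exI[of _ "\<lambda>_. c"]) simp

lemma trig_poly_character: "trig_poly (character k)"
  unfolding trig_poly_def by (rule exI[of _ "{k}"], rule exI[of _ "\<lambda>_. 1"]) auto

lemma trig_poly_add:
  assumes "trig_poly f" "trig_poly g"
  shows "trig_poly (\<lambda>x. f x + g x)"
proof -
  obtain F a G b where F: "finite F" "f = (\<lambda>x. \<Sum>k\<in>F. a k * character k x)"
     and G: "finite G" "g = (\<lambda>x. \<Sum>k\<in>G. b k * character k x)"
    using assms unfolding trig_poly_def by blast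
  have "f x + g x = (\<Sum>k\<in>F \<union> G. ((if k \<in> F then a k else 0) + (if k \<in> G then b k else 0)) * character k x)" for x
  proof -
    have "f x = (\<Sum>k\<in>F \<union> G. (if k \<in> F then a k else 0) * character k x)"
      unfolding F using F(1) G(1) by (intro sum.mono_neutral_cong_left) auto
    moreover have "g x = (\<Sum>k\<in>F \<union> G. (if k \<in> G then b k else 0) * character k x)"
      unfolding G using F(1) G(1) by (intro sum.mono_neutral_cong_left) auto
    ultimately show ?thesis by (simp add: sum.distrib distrib_right)
  qed
  then show ?thesis
    unfolding trig_poly_def using F(1) G(1) by (intro exI[of _ "F \<union> G"] exI conjI) auto
qed

lemma trig_poly_sum:
  assumes "finite I" "\<And>i. i \<in> I \<Longrightarrow> trig_poly (f i)"
  shows "trig_poly (\<lambda>x. \<Sum>i\<in>I. f i x)"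
  using assms by (induction I rule: finite_induct) (auto intro: trig_poly_const trig_poly_add)

lemma trig_poly_cmult_character:
  assumes "trig_poly f" shows "trig_poly (\<lambda>x. c * character l x * f x)"
proof -
  obtain F a where F: "finite F" "f = (\<lambda>x. \<Sum>k\<in>F. a k * character k x)"
    using assms unfolding trig_poly_def by blast
  have "c * character l x * f x = (\<Sum>k\<in>(+) l ` F. (c * a (k - l)) * character k x)" for x
    by (subst sum.reindex) (auto simp: F sum_distrib_left character_add mult_ac inj_on_def)
  then show ?thesis
    unfolding trig_poly_def using F(1) by (intro exI[of _ "(+) l ` F"] exI conjI) auto
qed

lemma trig_poly_mult:
  assumes "trig_poly f" "trig_poly g" shows "trig_poly (\<lambda>x. f x * g x)"
proof -
  obtain F a where F: "finite F" "f = (\<lambda>x. \<Sum>k\<in>F. a k * character k x)"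
    using assms unfolding trig_poly_def by blast
  have "trig_poly (\<lambda>x. \<Sum>k\<in>F. a k * character k x * g x)"
    by (intro trig_poly_sum F trig_poly_cmult_character assms)
  then show ?thesis by (simp add: F sum_distrib_right)
qed

lemma trig_poly_cmult: "trig_poly f \<Longrightarrow> trig_poly (\<lambda>x. c * f x)"
  by (intro trig_poly_mult trig_poly_const)

lemma trig_poly_measurable: "trig_poly f \<Longrightarrow> f \<in> borel_measurable cube"
  unfolding trig_poly_def
  by (elim exE conjE, hypsubst)
     (intro borel_measurable_sum borel_measurable_times measurable_character borel_measurable_const)

lemma trig_poly_bounded:
  assumes "trig_poly f" obtains B where "\<And>x. norm (f x) \<le> B"
proof -
  obtain F a where F: "finite F" "f = (\<lambda>x. \<Sum>k\<in>F. a k * character k x)"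
    using assms unfolding trig_poly_def by blast
  have "norm (f x) \<le> (\<Sum>k\<in>F. norm (a k))" for x
    unfolding F by (rule order_trans[OF norm_sum]) (simp add: norm_mult)
  then show ?thesis using that by blast
qed

text \<open>The embedding of the torus into \<open>complex^3\<close>. Polynomial approximation on
  its compact image becomes approximation by trigonometric polynomials, with the identification of
  opposite faces built in.\<close>

definition torus_map :: "real^3 \<Rightarrow> complex^3" where
  "torus_map x = (\<chi> i. exp (2 * pi * \<i> * (x $ i)))"

lemma torus_map_character: "torus_map x $ i = character (axis i 1) x"
proof -
  have "rvec (axis i 1) = axis i 1" by (simp add: rvec_def axis_def vec_eq_iff)
  then show ?thesis by (simp add: torus_map_def character_def inner_axis' )
qed

text \<open>A real linear functional on \<open>complex^3\<close> is a combination of real and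
  imaginary parts of the coordinates, and these are combinations of the characters for
  \<open>axis i 1\<close> and its negative; sums and products stay trigonometric.\<close>

lemma trig_poly_polynomial:
  assumes "real_polynomial_function f"
  shows "trig_poly (\<lambda>x. complex_of_real (f (torus_map x)))"
  using assms
proof (induction rule: real_polynomial_function.induct)
  case (linear f)
  interpret bounded_linear f by fact
  have re: "of_real (Re (character k x)) = (1/2) * character k x + (1/2) * character (- k) x" for k x
    by (simp add: complex_eq_iff flip: cnj_character)
  have im: "of_real (Im (character k x)) = (1/(2*\<i>)) * character k x + (-1/(2*\<i>)) * character (- k) x" for k x
    by (simp add: complex_eq_iff flip: cnj_character)
  have fz: "f z = (\<Sum>i\<in>UNIV. Re (z $ i) * f (axis i 1) + Im (z $ i) * f (axis i \<i>))" for z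
  proof -
    have "axis i w = Re w *\<^sub>R axis i 1 + Im w *\<^sub>R axis i \<i>" for i :: 3 and w
      by (simp add: vec_eq_iff axis_def complex_eq_iff)
    then have ax: "f (axis i w) = Re w * f (axis i 1) + Im w * f (axis i \<i>)" for i w
      by (metis add scaleR real_scaleR_def)
    have "z = (\<Sum>i\<in>UNIV. axis i (z $ i))"
      by (simp add: vec_eq_iff axis_def)
    then have "f z = f (\<Sum>i\<in>UNIV. axis i (z $ i))" by (rule arg_cong)
    also have "\<dots> = (\<Sum>i\<in>UNIV. f (axis i (z $ i)))" by (rule sum)
    also have "\<dots> = (\<Sum>i\<in>UNIV. Re (z $ i) * f (axis i 1) + Im (z $ i) * f (axis i \<i>))"
      by (intro sum.cong refl ax)
    finally show ?thesis .
  qed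
  have eq: "complex_of_real (f (torus_map x)) = (\<Sum>i\<in>UNIV.
      of_real (f (axis i 1)) * of_real (Re (character (axis i 1) x))
      + of_real (f (axis i \<i>)) * of_real (Im (character (axis i 1) x)))" for x
    unfolding fz[of "torus_map x"] torus_map_character of_real_sum of_real_add of_real_mult
    by (intro sum.cong refl) (simp only: mult.commute)
  show ?case
    unfolding eq re im
    by (intro trig_poly_sum trig_poly_add trig_poly_cmult trig_poly_character) auto
next
  case (const c)
  then show ?case by (simp add: trig_poly_const)
next
  case (add f g)
  then show ?case by (simp add: trig_poly_add)
next
  case (mult f g)
  then show ?case by (simp add: trig_poly_mult)
qed


subsection \<open>Density of trigonometric polynomials and the identity of Parseval\<close>

definition L2c :: "(real^3 \<Rightarrow> complex) set" where
  "L2c = {f. f \<in> borel_measurable cube \<and> integrable cube (\<lambda>x. (norm (f x))\<^sup>2)}"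

lemma L2cI: "f \<in> borel_measurable cube \<Longrightarrow> integrable cube (\<lambda>x. (norm (f x))\<^sup>2) \<Longrightarrow> f \<in> L2c"
  by (simp add: L2c_def)

lemma L2c_measurable [measurable_dest]: "f \<in> L2c \<Longrightarrow> f \<in> borel_measurable cube"
  by (simp add: L2c_def)

lemma L2c_integrable: "f \<in> L2c \<Longrightarrow> integrable cube (\<lambda>x. (norm (f x))\<^sup>2)"
  by (simp add: L2c_def)

lemma norm_add_power2_le:
  fixes a b :: "'a::real_normed_vector"
  shows "(norm (a + b))\<^sup>2 \<le> 2 * (norm a)\<^sup>2 + 2 * (norm b)\<^sup>2"
proof -
  have "(norm (a + b))\<^sup>2 \<le> (norm a + norm b)\<^sup>2"
    by (intro power_mono norm_triangle_ineq) simp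
  also have "\<dots> \<le> 2 * (norm a)\<^sup>2 + 2 * (norm b)\<^sup>2"
    using sum_squares_bound[of "norm a" "norm b"] by (simp add: power2_sum)
  finally show ?thesis .
qed

lemma L2c_add:
  assumes "f \<in> L2c" "g \<in> L2c" shows "(\<lambda>x. f x + g x) \<in> L2c"
proof (rule L2cI)
  note [measurable] = L2c_measurable[OF assms(1)] L2c_measurable[OF assms(2)]
  show "(\<lambda>x. f x + g x) \<in> borel_measurable cube" by measurable
  have "integrable cube (\<lambda>x. 2 * (norm (f x))\<^sup>2 + 2 * (norm (g x))\<^sup>2)"
    using L2c_integrable[OF assms(1)] L2c_integrable[OF assms(2)] by simp
  then show "integrable cube (\<lambda>x. (norm (f x + g x))\<^sup>2)"
    by (rule Bochner_Integration.integrable_bound) (measurable, simp add: norm_add_power2_le)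
qed

lemma L2c_mult_bounded:
  assumes "f \<in> L2c" "b \<in> borel_measurable cube" "\<And>x. norm (b x) \<le> B"
  shows "(\<lambda>x. f x * b x) \<in> L2c"
proof (rule L2cI)
  note [measurable] = L2c_measurable[OF assms(1)] assms(2)
  show "(\<lambda>x. f x * b x) \<in> borel_measurable cube" by measurable
  have "integrable cube (\<lambda>x. B\<^sup>2 * (norm (f x))\<^sup>2)"
    using L2c_integrable[OF assms(1)] by simp
  moreover
  have "(norm (f x * b x))\<^sup>2 \<le> B\<^sup>2 * (norm (f x))\<^sup>2" for x
    using power_mono[OF assms(3)[of x] norm_ge_zero, of 2]
    by (simp add: norm_mult power_mult_distrib mult.commute mult_right_mono)
  then have "AE x in cube. norm ((norm (f x * b x))\<^sup>2) \<le> norm (B\<^sup>2 * (norm (f x))\<^sup>2)"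
    by (intro AE_I2) (auto intro: order_trans[OF _ abs_ge_self])
  ultimately show "integrable cube (\<lambda>x. (norm (f x * b x))\<^sup>2)"
    by (rule_tac Bochner_Integration.integrable_bound[where f = "\<lambda>x. B\<^sup>2 * (norm (f x))\<^sup>2"])
       (simp_all only:, measurable)
qed

lemma L2c_cmult: "f \<in> L2c \<Longrightarrow> (\<lambda>x. c * f x) \<in> L2c"
  using L2c_mult_bounded[of f "\<lambda>_. c" "norm c"] by (simp add: mult.commute)

lemma L2c_diff: "f \<in> L2c \<Longrightarrow> g \<in> L2c \<Longrightarrow> (\<lambda>x. f x - g x) \<in> L2c"
  using L2c_add[OF _ L2c_cmult[of g "-1"], of f] by simp

lemma L2c_bounded:
  assumes "f \<in> borel_measurable cube" "AE x in cube. norm (f x) \<le> B"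
  shows "f \<in> L2c"
proof (rule L2cI[OF assms(1)])
  note [measurable] = assms(1)
  show "integrable cube (\<lambda>x. (norm (f x))\<^sup>2)"
    by (rule cube.integrable_const_bound[where B = "B\<^sup>2"])
       (use assms(2) in \<open>auto elim!: eventually_mono intro!: power_mono\<close>)
qed

lemma L2c_trig_poly: "trig_poly f \<Longrightarrow> f \<in> L2c"
  using trig_poly_bounded[of f] L2c_bounded[OF trig_poly_measurable, of f] by (metis AE_I2)

lemma L2c_mult_integrable:
  assumes "f \<in> L2c" "g \<in> L2c"
  shows "integrable cube (\<lambda>x. f x * g x)"
proof -
  note [measurable] = L2c_measurable[OF assms(1)] L2c_measurable[OF assms(2)]
  have "integrable cube (\<lambda>x. (norm (f x))\<^sup>2 + (norm (g x))\<^sup>2)"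
    using L2c_integrable[OF assms(1)] L2c_integrable[OF assms(2)] by simp
  moreover have "(\<lambda>x. f x * g x) \<in> borel_measurable cube" by measurable
  moreover have "norm (f x * g x) \<le> norm ((norm (f x))\<^sup>2 + (norm (g x))\<^sup>2)" for x
    using sum_squares_bound[of "norm (f x)" "norm (g x)"]
      mult_nonneg_nonneg[OF norm_ge_zero[of "f x"] norm_ge_zero[of "g x"]]
    unfolding norm_mult real_norm_def by linarith
  ultimately show ?thesis
    by (rule_tac Bochner_Integration.integrable_bound[where f = "\<lambda>x. (norm (f x))\<^sup>2 + (norm (g x))\<^sup>2"])
       (simp_all add: AE_I2)
qed

text \<open>The square of the distance. The triangle inequality then carries a factor 2, which is
  harmless for density and avoids square roots.\<close>

definition L2dist :: "(real^3 \<Rightarrow> complex) \<Rightarrow> (real^3 \<Rightarrow> complex) \<Rightarrow> real" where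
  "L2dist f g = integral\<^sup>L cube (\<lambda>x. (norm (f x - g x))\<^sup>2)"

lemma L2dist_triangle:
  assumes "f \<in> L2c" "g \<in> L2c" "h \<in> L2c"
  shows "L2dist f h \<le> 2 * L2dist f g + 2 * L2dist g h"
proof -
  have "L2dist f h \<le> integral\<^sup>L cube (\<lambda>x. 2 * (norm (f x - g x))\<^sup>2 + 2 * (norm (g x - h x))\<^sup>2)"
    unfolding L2dist_def
  proof (rule integral_mono)
    show "(norm (f x - h x))\<^sup>2 \<le> 2 * (norm (f x - g x))\<^sup>2 + 2 * (norm (g x - h x))\<^sup>2" for x
      using norm_add_power2_le[of "f x - g x" "g x - h x"] by simp
  qed (use L2c_integrable[OF L2c_diff] assms in auto)
  also have "\<dots> = 2 * L2dist f g + 2 * L2dist g h"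
    unfolding L2dist_def using L2c_integrable[OF L2c_diff] assms by simp
  finally show ?thesis .
qed

definition approximable :: "(real^3 \<Rightarrow> complex) \<Rightarrow> bool" where
  "approximable f \<longleftrightarrow> f \<in> L2c \<and> (\<forall>e>0. \<exists>P. trig_poly P \<and> L2dist f P < e)"

lemma approximable_close:
  assumes "f \<in> L2c" "\<And>e. 0 < e \<Longrightarrow> \<exists>g. approximable g \<and> L2dist f g < e"
  shows "approximable f"
  unfolding approximable_def
proof (intro conjI allI impI)
  fix e :: real assume e: "0 < e"
  \<comment> \<open>Two errors of e / 4, each doubled by \<open>L2dist_triangle\<close>.\<close>
  obtain g where g: "approximable g" "L2dist f g < e / 4" using assms(2)[of "e/4"] e by auto
  obtain P where P: "trig_poly P" "L2dist g P < e / 4"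
    using g(1) e unfolding approximable_def by (meson divide_pos_pos zero_less_numeral)
  have "L2dist f P \<le> 2 * L2dist f g + 2 * L2dist g P"
    by (rule L2dist_triangle) (use assms g P in \<open>auto simp: approximable_def L2c_trig_poly\<close>)
  then have "L2dist f P < e" using g(2) P(2) by linarith
  with P(1) show "\<exists>P. trig_poly P \<and> L2dist f P < e" by blast
qed fact

text \<open>Dominated convergence for the squared distance, with majorant 2 |f|^2 + 2 |w|^2. It
  carries approximability from continuous to bounded and then to square integrable
  functions.\<close>

lemma approximable_dominated:
  assumes f: "f \<in> L2c" and g: "\<And>n. approximable (g n)" and w: "w \<in> L2c"
    and lim: "AE x in cube. (\<lambda>n::nat. g n x) \<longlonglongrightarrow> f x"
    and bound: "\<And>n. AE x in cube. norm (g n x) \<le> norm (w x)"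
  shows "approximable f"
proof (rule approximable_close[OF f])
  fix e :: real assume e: "0 < e"
  have gL: "g n \<in> L2c" for n using g by (simp add: approximable_def)
  note [measurable] = L2c_measurable[OF f] L2c_measurable[OF gL] L2c_measurable[OF w]
  have "(\<lambda>n. integral\<^sup>L cube (\<lambda>x. (norm (f x - g n x))\<^sup>2)) \<longlonglongrightarrow> integral\<^sup>L cube (\<lambda>x. 0 :: real)"
  proof (rule integral_dominated_convergence)
    show "integrable cube (\<lambda>x. 2 * (norm (f x))\<^sup>2 + 2 * (norm (w x))\<^sup>2)"
      using L2c_integrable[OF f] L2c_integrable[OF w] by simp
    show "AE x in cube. (\<lambda>n. (norm (f x - g n x))\<^sup>2) \<longlonglongrightarrow> 0"
      using lim
    proof (rule AE_mp[OF _ AE_I2], intro impI)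
      fix x assume "(\<lambda>n. g n x) \<longlonglongrightarrow> f x"
      then have "(\<lambda>n. (norm (f x - g n x))\<^sup>2) \<longlonglongrightarrow> (norm (f x - f x))\<^sup>2"
        by (intro tendsto_intros)
      then show "(\<lambda>n. (norm (f x - g n x))\<^sup>2) \<longlonglongrightarrow> 0" by simp
    qed
    show "AE x in cube. norm ((norm (f x - g n x))\<^sup>2) \<le> 2 * (norm (f x))\<^sup>2 + 2 * (norm (w x))\<^sup>2" for n
      using bound[of n]
    proof (rule AE_mp[OF _ AE_I2], intro impI)
      fix x assume "norm (g n x) \<le> norm (w x)"
      then have "(norm (g n x))\<^sup>2 \<le> (norm (w x))\<^sup>2" by (intro power_mono) auto
      then show "norm ((norm (f x - g n x))\<^sup>2) \<le> 2 * (norm (f x))\<^sup>2 + 2 * (norm (w x))\<^sup>2"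
        using norm_add_power2_le[of "f x" "- g n x"] unfolding norm_minus_cancel real_norm_def abs_power2
          diff_conv_add_uminus[symmetric] by linarith
    qed
  qed measurable
  then have "(\<lambda>n. L2dist f (g n)) \<longlonglongrightarrow> 0" by (simp add: L2dist_def)
  then have "\<forall>\<^sub>F n in sequentially. L2dist f (g n) < e" using e by (rule order_tendstoD(2))
  then obtain n where "L2dist f (g n) < e" by (auto simp: eventually_sequentially)
  with g show "\<exists>h. approximable h \<and> L2dist f h < e" by blast
qed

lemma approximable_add:
  assumes "approximable f" "approximable g" shows "approximable (\<lambda>x. f x + c * g x)"
proof -
  have fg: "f \<in> L2c" "g \<in> L2c" using assms by (simp_all add: approximable_def)
  show ?thesis
    unfolding approximable_def
  proof (intro conjI allI impI)
    show "(\<lambda>x. f x + c * g x) \<in> L2c" by (intro L2c_add L2c_cmult fg)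
    fix e :: real assume e: "0 < e"
    \<comment> \<open>The error will be at most 2 d (1 + |c|^2) = e / 2.\<close>
    define d where "d = e / (4 * (1 + (norm c)\<^sup>2))"
    have pos: "0 < 1 + (norm c)\<^sup>2" by (simp add: add_pos_nonneg)
    have d: "0 < d" using e pos by (simp add: d_def)
    obtain P Q where P: "trig_poly P" "L2dist f P < d" and Q: "trig_poly Q" "L2dist g Q < d"
      using assms d unfolding approximable_def by blast
    note PQ = L2c_trig_poly[OF P(1)] L2c_trig_poly[OF Q(1)]
    have "L2dist (\<lambda>x. f x + c * g x) (\<lambda>x. P x + c * Q x)
       \<le> integral\<^sup>L cube (\<lambda>x. 2 * (norm (f x - P x))\<^sup>2 + (2 * (norm c)\<^sup>2) * (norm (g x - Q x))\<^sup>2)"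
      unfolding L2dist_def
    proof (rule integral_mono)
      show "integrable cube (\<lambda>x. (norm (f x + c * g x - (P x + c * Q x)))\<^sup>2)"
        by (intro L2c_integrable L2c_diff L2c_add L2c_cmult fg PQ)
      show "integrable cube (\<lambda>x. 2 * (norm (f x - P x))\<^sup>2 + (2 * (norm c)\<^sup>2) * (norm (g x - Q x))\<^sup>2)"
        using L2c_integrable[OF L2c_diff] fg PQ by simp
      show "(norm (f x + c * g x - (P x + c * Q x)))\<^sup>2 \<le> 2 * (norm (f x - P x))\<^sup>2 + (2 * (norm c)\<^sup>2) * (norm (g x - Q x))\<^sup>2" for x
      proof -
        have "f x + c * g x - (P x + c * Q x) = (f x - P x) + c * (g x - Q x)"
          by (simp add: algebra_simps)
        then show ?thesis
          using norm_add_power2_le[of "f x - P x" "c * (g x - Q x)"]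
          by (simp only: norm_mult power_mult_distrib mult.assoc)
      qed
    qed
    also have "\<dots> = 2 * L2dist f P + (2 * (norm c)\<^sup>2) * L2dist g Q"
      unfolding L2dist_def using L2c_integrable[OF L2c_diff] fg PQ by simp
    also have "\<dots> \<le> 2 * d + (2 * (norm c)\<^sup>2) * d"
      using P(2) Q(2) by (intro add_mono mult_left_mono) auto
    also have "\<dots> = 2 * (d * (1 + (norm c)\<^sup>2))" by (simp add: algebra_simps)
    also have "d * (1 + (norm c)\<^sup>2) = e / 4"
    proof -
      have "e / (4 * K) * K = e / 4" if "0 < K" for K :: real using that by simp
      from this[OF pos] show ?thesis by (simp only: d_def)
    qed
    also have "2 * (e / 4) = e / 2" by simp
    also have "\<dots> < e" using e by simp
    finally have "L2dist (\<lambda>x. f x + c * g x) (\<lambda>x. P x + c * Q x) < e" .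
    then show "\<exists>P. trig_poly P \<and> L2dist (\<lambda>x. f x + c * g x) P < e"
      using trig_poly_add[OF P(1) trig_poly_cmult[OF Q(1)]] by blast
  qed
qed

section \<open>Approximation of continuous, bounded and square integrable functions\<close>

definition torus :: "(complex^3) set" where
  "torus = {z. \<forall>i. norm (z $ i) = 1}"

lemma compact_torus: "compact torus"
proof -
  have "norm z \<le> 3" if "z \<in> torus" for z
    using norm_le_l1_cart[of "\<chi> i. norm (z $ i)"] that norm_le_componentwise_cart[of z "\<chi> i. norm (z $ i)"]
    by (simp add: torus_def sum_3)
  then have "bounded torus" by (auto simp: bounded_iff)
  moreover have "closed torus"
    unfolding torus_def by (intro closed_Collect_all closed_Collect_eq continuous_intros)
  ultimately show ?thesis by (simp add: compact_eq_bounded_closed)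
qed

lemma torus_map_in_torus: "torus_map x \<in> torus"
  by (simp add: torus_def torus_map_character)

lemma continuous_measurable_cube:
  assumes "continuous_on UNIV f" shows "f \<in> borel_measurable cube"
  by (rule continuous_imp_measurable_on_sets_lebesgue[OF continuous_on_subset[OF assms] unit_cube_sets]) simp

lemma approximable_torus:
  assumes H: "continuous_on torus H" and h: "h \<in> borel_measurable cube"
    and eq: "\<And>x. x \<in> unit_cube \<Longrightarrow> h x = complex_of_real (H (torus_map x))"
  shows "approximable h"
proof -
  obtain B where B: "\<And>z. z \<in> torus \<Longrightarrow> norm (H z) \<le> B"
    using compact_imp_bounded[OF compact_continuous_image[OF H compact_torus]]
    unfolding bounded_iff by blast
  have hL: "h \<in> L2c"
  proof (rule L2c_bounded[OF h AE_I2])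
    fix x assume "x \<in> space cube"
    then have "x \<in> unit_cube" by simp
    then show "norm (h x) \<le> B" using eq[of x] B[OF torus_map_in_torus] by simp
  qed
  show ?thesis
    unfolding approximable_def
  proof (intro conjI allI impI hL)
    fix e :: real assume e: "0 < e"
    \<comment> \<open>d \<le> 1 turns a uniform error d into a squared error of at most d.\<close>
    define d where "d = min 1 (e/2)"
    have d: "0 < d" "d \<le> 1" "d < e" using e by (auto simp: d_def)
    obtain g where g: "polynomial_function g" "\<And>z. z \<in> torus \<Longrightarrow> norm (H z - g z) < d"
      using Stone_Weierstrass_polynomial_function[OF compact_torus H d(1)] by blast
    have "real_polynomial_function g" using g(1) by (simp add: real_polynomial_function_eq)
    then have P: "trig_poly (\<lambda>x. complex_of_real (g (torus_map x)))"
      by (rule trig_poly_polynomial)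
    have "L2dist h (\<lambda>x. complex_of_real (g (torus_map x))) \<le> integral\<^sup>L cube (\<lambda>x. d)"
      unfolding L2dist_def
    proof (rule integral_mono)
      show "integrable cube (\<lambda>x. (norm (h x - complex_of_real (g (torus_map x))))\<^sup>2)"
        by (intro L2c_integrable L2c_diff hL L2c_trig_poly P)
      fix x assume "x \<in> space cube"
      then have x: "x \<in> unit_cube" by simp
      have n: "norm (h x - complex_of_real (g (torus_map x))) \<le> d"
        using g(2)[OF torus_map_in_torus[of x]] unfolding eq[OF x]
        by (simp flip: of_real_diff)
      have "(norm (h x - complex_of_real (g (torus_map x))))\<^sup>2 \<le> d * 1"
        unfolding power2_eq_square using n d by (intro mult_mono) auto
      then show "(norm (h x - complex_of_real (g (torus_map x))))\<^sup>2 \<le> d" by simp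
    qed simp
    also have "\<dots> = d" using measure_cube by (simp del: measure_cube)
    finally have "L2dist h (\<lambda>x. complex_of_real (g (torus_map x))) < e" using d(3) by linarith
    then show "\<exists>P. trig_poly P \<and> L2dist h P < e" using P by blast
  qed
qed

text \<open>
  A continuous function on the cube that is cut off near the faces, seen as a function on the torus;
  the cut-off makes up for the discontinuity of the angle at \<open>1\<close>.
\<close>

definition cutoff :: "nat \<Rightarrow> complex^3 \<Rightarrow> real" where
  "cutoff n z = min 1 (n * (\<Prod>i\<in>UNIV. norm (z $ i - 1)))"

lemma cutoff_bounds: "0 \<le> cutoff n z" "cutoff n z \<le> 1"
  by (simp_all add: cutoff_def prod_nonneg)

lemma continuous_cutoff: "continuous_on S (cutoff n)"
  unfolding cutoff_def by (intro continuous_intros)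

text \<open>\<open>Arg2pi\<close> inverts \<open>torus_map\<close> away from the set where a
  coordinate equals 1. On that set the cutoff vanishes, and |H| is at most B times the cutoff, which
  forces continuity there whatever value the discontinuous angle contributes.\<close>

lemma approximable_cutoff:
  fixes g :: "real^3 \<Rightarrow> real"
  assumes g: "continuous_on UNIV g" and B: "\<And>x. \<bar>g x\<bar> \<le> B"
  shows "approximable (\<lambda>x. complex_of_real (g x * cutoff n (torus_map x)))"
proof -
  define ang where "ang z = (\<chi> i. Arg2pi (z $ i) / (2 * pi))" for z :: "complex^3"
  define H where "H z = g (ang z) * cutoff n z" for z
  have cz: "cutoff n z = 0" if "z $ i = 1" for z i
  proof -
    have "(\<Prod>i\<in>UNIV. norm (z $ i - 1)) = 0" using that by (intro prod_zero) auto
    then show ?thesis unfolding cutoff_def by (simp only: mult_zero_right)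
  qed
  have "continuous (at z within torus) H" if z: "z \<in> torus" for z
  proof (cases "\<exists>i. z $ i = 1")
    case False
    have "z $ i \<notin> \<real>\<^sub>\<ge>\<^sub>0" for i
    proof
      assume "z $ i \<in> \<real>\<^sub>\<ge>\<^sub>0"
      then obtain r where r: "z $ i = of_real r" "0 \<le> r" by (auto elim: nonneg_Reals_cases)
      moreover have "norm (z $ i) = 1" using z by (simp add: torus_def)
      ultimately have "z $ i = 1" by simp
      then show False using False by blast
    qed
    then have "isCont (\<lambda>z. Arg2pi (z $ i)) z" for i
      by (intro continuous_within_compose3[OF continuous_at_Arg2pi] continuous_intros)
    then have "isCont ang z"
      unfolding ang_def continuous_within by (intro vec_tendstoI) (simp add: tendsto_divide)
    moreover have "isCont g (ang z)"
      using g by (simp add: continuous_on_eq_continuous_at)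
    ultimately have "isCont (\<lambda>z. g (ang z)) z" by (rule isCont_o2)
    moreover have "isCont (cutoff n) z"
      using continuous_cutoff[of UNIV] by (simp add: continuous_on_eq_continuous_at)
    ultimately have "isCont H z" unfolding H_def by (intro continuous_intros)
    then show ?thesis by (rule continuous_at_imp_continuous_at_within)
  next
    case True
    then have c0: "cutoff n z = 0" using cz by blast
    have lim: "(cutoff n \<longlongrightarrow> 0) (at z within torus)"
      using continuous_cutoff[of torus n] z unfolding continuous_on_def c0[symmetric] by blast
    have "(H \<longlongrightarrow> 0) (at z within torus)"
    proof (rule Lim_null_comparison)
      show "\<forall>\<^sub>F w in at z within torus. norm (H w) \<le> B * cutoff n w"
        using B cutoff_bounds by (intro always_eventually allI) (simp add: H_def abs_mult mult_right_mono)
      show "((\<lambda>w. B * cutoff n w) \<longlongrightarrow> 0) (at z within torus)"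
        using tendsto_mult_left[OF lim, of B] by simp
    qed
    then show ?thesis by (simp add: continuous_within H_def c0)
  qed
  then have H: "continuous_on torus H" by (simp add: continuous_on_eq_continuous_within)
  have tm: "continuous_on UNIV torus_map"
    unfolding torus_map_def by (intro continuous_intros)
  show ?thesis
  proof (rule approximable_torus[OF H])
    have "continuous_on UNIV (\<lambda>x. cutoff n (torus_map x))"
      by (rule continuous_on_compose2[OF continuous_cutoff tm]) auto
    then have "continuous_on UNIV (\<lambda>x. complex_of_real (g x * cutoff n (torus_map x)))"
      by (intro continuous_intros g)
    then show "(\<lambda>x. complex_of_real (g x * cutoff n (torus_map x))) \<in> borel_measurable cube"
      by (rule continuous_measurable_cube)
    fix x assume x: "x \<in> unit_cube"
    show "complex_of_real (g x * cutoff n (torus_map x)) = complex_of_real (H (torus_map x))"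
    proof (cases "\<exists>i. torus_map x $ i = 1")
      case True
      then show ?thesis using cz by (auto simp: H_def)
    next
      case False
      \<comment> \<open>Away from the cut the coordinates lie in [0,1), where the angle recovers x
        exactly.\<close>
      have xi: "0 \<le> x $ i" "x $ i < 1" for i
      proof -
        have *: "0 \<le> x $ i" "x $ i \<le> 1" using x by (simp_all add: unit_cube_def mem_box_cart)
        have "x $ i \<noteq> 1"
        proof
          assume "x $ i = 1"
          then have "torus_map x $ i = 1" by (simp add: torus_map_def mult.commute)
          then show False using False by blast
        qed
        with * show "0 \<le> x $ i" "x $ i < 1" by auto
      qed
      have "Arg2pi (torus_map x $ i) = 2 * pi * x $ i" for i
        unfolding torus_map_def using xi[of i] pi_gt_zero
        by (intro Arg2pi_unique[of 1]) (auto simp: mult.commute mult.left_commute)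
      then have "ang (torus_map x) = x" by (simp add: ang_def vec_eq_iff)
      then show ?thesis by (simp add: H_def)
    qed
  qed
qed

lemma AE_cube_interior: "AE x in cube. x \<in> box 0 1"
proof -
  have "negligible (unit_cube - box 0 1)"
    unfolding unit_cube_def using negligible_frontier_interval[of "0::real^3" 1] by simp
  then have "AE x in lebesgue. x \<notin> unit_cube - box 0 1"
    by (metis AE_not_in negligible_iff_null_sets)
  then show ?thesis
    by (subst AE_restrict_space_iff) (auto elim!: eventually_mono)
qed

text \<open>Measurability yields continuous g_n converging to f almost everywhere. Clamping to
  [-B, B] keeps them dominated, and the cutoffs tend to 1 in the open cube, whose complement in the
  closed cube is negligible.\<close>

lemma approximable_bounded:
  assumes f: "f \<in> borel_measurable cube" and B: "\<And>x. \<bar>f x\<bar> \<le> B"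
  shows "approximable (\<lambda>x. complex_of_real (f x))"
proof -
  have "f measurable_on unit_cube"
    using f by (simp add: measurable_on_iff_borel_measurable)
  then obtain N g where N: "negligible N" and g: "\<And>n. continuous_on UNIV (g n)"
    and lim: "\<And>x. x \<notin> N \<Longrightarrow> (\<lambda>n. g n x) \<longlonglongrightarrow> (if x \<in> unit_cube then f x else 0)"
    unfolding measurable_on_def by blast
  define h where "h n x = max (- B) (min B (g n x))" for n x
  have B0: "0 \<le> B" using B[of 0] by linarith
  have hB: "\<bar>h n x\<bar> \<le> B" for n x using B0 by (simp add: h_def)
  have hc: "continuous_on UNIV (h n)" for n
    unfolding h_def by (intro continuous_intros g)
  have N': "AE x in cube. x \<notin> N"
    using N by (intro AE_restrict_space_iff[THEN iffD2]) (auto simp: negligible_iff_null_sets elim!: eventually_mono dest!: AE_not_in)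
  show ?thesis
  proof (rule approximable_dominated)
    show "approximable (\<lambda>x. complex_of_real (h n x * cutoff n (torus_map x)))" for n
      by (rule approximable_cutoff[OF hc hB])
    show "(\<lambda>x. complex_of_real B) \<in> L2c" by (intro L2c_trig_poly trig_poly_const)
    show "(\<lambda>x. complex_of_real (f x)) \<in> L2c"
      by (rule L2c_bounded[where B = B]) (use f B in \<open>auto intro: borel_measurable_of_real\<close>)
    show "AE x in cube. norm (complex_of_real (h n x * cutoff n (torus_map x))) \<le> norm (complex_of_real B)" for n
    proof (rule AE_I2)
      fix x
      have "\<bar>h n x\<bar> * cutoff n (torus_map x) \<le> B * 1"
        by (intro mult_mono hB cutoff_bounds B0)
      then show "norm (complex_of_real (h n x * cutoff n (torus_map x))) \<le> norm (complex_of_real B)"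
        using cutoff_bounds(1)[of n] B0 unfolding norm_of_real by (simp add: abs_mult)
    qed
    show "AE x in cube. (\<lambda>n. complex_of_real (h n x * cutoff n (torus_map x))) \<longlonglongrightarrow> complex_of_real (f x)"
      using AE_cube_interior N'
    proof eventually_elim
      case (elim x)
      have x: "x \<in> unit_cube" using elim(1) box_subset_cbox by (auto simp: unit_cube_def)
      have "(\<lambda>n. g n x) \<longlonglongrightarrow> f x" using lim[OF elim(2)] x by simp
      then have "(\<lambda>n. h n x) \<longlonglongrightarrow> max (- B) (min B (f x))"
        unfolding h_def by (intro tendsto_intros)
      moreover have "max (- B) (min B (f x)) = f x" using B[of x] by (auto simp: max_def min_def abs_le_iff)
      ultimately have h: "(\<lambda>n. h n x) \<longlonglongrightarrow> f x" by simp
      define p where "p = (\<Prod>i\<in>UNIV. norm (torus_map x $ i - 1))"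
      have "torus_map x $ i \<noteq> 1" for i
      proof
        assume "torus_map x $ i = 1"
        then have "exp (2 * pi * \<i> * (x $ i)) = 1" by (simp add: torus_map_def)
        then obtain m :: int where "2 * pi * x $ i = of_int (2 * m) * pi"
          by (auto simp: exp_eq_1)
        then have "x $ i = of_int m" by simp
        moreover have "0 < x $ i" "x $ i < 1" using elim(1) by (simp_all add: mem_box_cart)
        ultimately show False by simp
      qed
      then have p: "0 < p" unfolding p_def by (intro prod_pos) simp
      obtain m :: nat where m: "1 / p < m" using reals_Archimedean2 by blast
      have "\<forall>\<^sub>F n in sequentially. cutoff n (torus_map x) = 1"
        using eventually_ge_at_top[of m]
      proof eventually_elim
        case (elim n)
        have "1 < m * p" using m p by (simp add: field_simps)
        also have "m * p \<le> n * p" using elim p by simp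
        finally show ?case by (simp add: cutoff_def p_def)
      qed
      then have "(\<lambda>n. cutoff n (torus_map x)) \<longlonglongrightarrow> 1" by (rule tendsto_eventually)
      from tendsto_mult[OF h this] show ?case by (simp add: tendsto_of_real_iff flip: of_real_mult)
    qed
  qed
qed

text \<open>Real and imaginary part are clamped to [-n, n], with f itself as the majorant.\<close>

lemma approximable_L2c:
  assumes f: "f \<in> L2c" shows "approximable f"
proof -
  have real: "approximable (\<lambda>x. complex_of_real (g x))" if g: "g \<in> borel_measurable cube"
    "\<And>x. \<bar>g x\<bar> \<le> norm (f x)" for g
  proof (rule approximable_dominated[OF _ _ f])
    have "integrable cube (\<lambda>x. (norm (complex_of_real (g x)))\<^sup>2)"
    proof (rule Bochner_Integration.integrable_bound[OF L2c_integrable[OF f]])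
      show "(\<lambda>x. (norm (complex_of_real (g x)))\<^sup>2) \<in> borel_measurable cube" using g(1) by measurable
      show "AE x in cube. norm ((norm (complex_of_real (g x)))\<^sup>2) \<le> norm ((norm (f x))\<^sup>2)"
      proof (rule AE_I2)
        fix x
        show "norm ((norm (complex_of_real (g x)))\<^sup>2) \<le> norm ((norm (f x))\<^sup>2)"
          using power_mono[OF g(2)[of x] abs_ge_zero, of 2] by simp
      qed
    qed
    then show "(\<lambda>x. complex_of_real (g x)) \<in> L2c"
      using g(1) by (intro L2cI) simp_all
    show "approximable (\<lambda>x. complex_of_real (max (- real n) (min (real n) (g x))))" for n :: nat
      by (rule approximable_bounded[where B = n]) (use g(1) in auto)
    show "AE x in cube. norm (complex_of_real (max (- real n) (min (real n) (g x)))) \<le> norm (f x)" for n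
    proof (rule AE_I2)
      fix x
      have "\<bar>max (- real n) (min (real n) (g x))\<bar> \<le> \<bar>g x\<bar>" by (auto simp: max_def min_def)
      then show "norm (complex_of_real (max (- real n) (min (real n) (g x)))) \<le> norm (f x)"
        using g(2)[of x] by simp
    qed
    show "AE x in cube. (\<lambda>n. complex_of_real (max (- real n) (min (real n) (g x)))) \<longlonglongrightarrow> complex_of_real (g x)"
    proof (rule AE_I2)
      fix x
      obtain m :: nat where m: "\<bar>g x\<bar> < m" using reals_Archimedean2 by blast
      have "\<forall>\<^sub>F n in sequentially. complex_of_real (max (- real n) (min (real n) (g x))) = complex_of_real (g x)"
        using eventually_ge_at_top[of m] by eventually_elim (use m in \<open>auto simp: max_def min_def\<close>)
      then show "(\<lambda>n. complex_of_real (max (- real n) (min (real n) (g x)))) \<longlonglongrightarrow> complex_of_real (g x)"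
        by (rule tendsto_eventually)
    qed
  qed
  note [measurable] = L2c_measurable[OF f]
  have "approximable (\<lambda>x. complex_of_real (Re (f x)) + \<i> * complex_of_real (Im (f x)))"
    by (intro approximable_add real abs_Re_le_cmod abs_Im_le_cmod) measurable
  then show ?thesis by (simp flip: complex_eq)
qed

section \<open>Fourier coefficients and Parseval's identity\<close>

definition cfourier :: "(real^3 \<Rightarrow> complex) \<Rightarrow> int^3 \<Rightarrow> complex" where
  "cfourier f k = integral\<^sup>L cube (\<lambda>x. f x * character (- k) x)"

lemma L2c_character: "character k \<in> L2c"
  by (intro L2c_trig_poly trig_poly_character)

lemma integrable_mult_character: "f \<in> L2c \<Longrightarrow> integrable cube (\<lambda>x. f x * character k x)"
  by (intro L2c_mult_integrable L2c_character)

lemma cfourier_add: "f \<in> L2c \<Longrightarrow> g \<in> L2c \<Longrightarrow> cfourier (\<lambda>x. f x + c * g x) k = cfourier f k + c * cfourier g k"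
  unfolding cfourier_def using integrable_mult_character[of f "-k"] integrable_mult_character[of g "-k"]
  by (simp add: distrib_right mult.assoc)

lemma cfourier_character: "cfourier (character l) k = (if k = l then 1 else 0)"
  unfolding cfourier_def by (simp add: integral_character flip: character_add)

text \<open>Induction on F: each further character completes one square, because the residual r has
  the same coefficient at l as f. With the Fourier coefficients as a_k this is Bessel's inequality;
  for general a_k it says that the Fourier coefficients are the best choice.\<close>

lemma L2c_norm_polynomial:
  assumes f: "f \<in> L2c" and F: "finite F"
  shows "L2dist f (\<lambda>x. \<Sum>k\<in>F. a k * character k x)
    = integral\<^sup>L cube (\<lambda>x. (norm (f x))\<^sup>2) - (\<Sum>k\<in>F. (norm (cfourier f k))\<^sup>2)
      + (\<Sum>k\<in>F. (norm (cfourier f k - a k))\<^sup>2)"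
  using F
proof (induction F rule: finite_induct)
  case empty
  then show ?case by (simp add: L2dist_def)
next
  case (insert l F)
  define P where "P x = (\<Sum>k\<in>F. a k * character k x)" for x
  define r where "r x = f x - P x" for x
  have P: "P \<in> L2c" unfolding P_def
    by (intro L2c_trig_poly) (auto simp: trig_poly_def intro!: exI[of _ F] exI[of _ a] insert)
  have r: "r \<in> L2c" unfolding r_def by (intro L2c_diff f P)
  have rl: "cfourier r l = cfourier f l"
  proof -
    have "cfourier P l = (\<Sum>k\<in>F. a k * cfourier (character k) l)"
      unfolding P_def cfourier_def sum_distrib_right
      by (subst Bochner_Integration.integral_sum)
         (auto simp: mult.assoc intro!: integrable_mult_right integrable_mult_character L2c_character)
    also have "\<dots> = 0" using insert(2) by (intro sum.neutral) (auto simp: cfourier_character)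
    finally show ?thesis using cfourier_add[OF f P, of "-1" l] by (simp add: r_def [abs_def])
  qed
  have pt: "(norm (r x - a l * character l x))\<^sup>2
     = (norm (r x))\<^sup>2 + (norm (a l))\<^sup>2 - 2 * Re (cnj (a l) * (r x * character (- l) x))" for x
  proof -
    have "(norm (r x - a l * character l x))\<^sup>2
      = (norm (r x))\<^sup>2 + (norm (a l * character l x))\<^sup>2 - 2 * Re (r x * cnj (a l * character l x))"
      unfolding cmod_power2 by (simp add: power2_eq_square algebra_simps)
    then show ?thesis
      by (simp add: norm_mult cnj_character mult_ac)
  qed
  have ir: "integrable cube (\<lambda>x. r x * character (- l) x)" by (rule integrable_mult_character[OF r])
  have "L2dist f (\<lambda>x. \<Sum>k\<in>insert l F. a k * character k x)
     = integral\<^sup>L cube (\<lambda>x. (norm (r x - a l * character l x))\<^sup>2)"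
    unfolding L2dist_def using insert(1,2) by (simp add: r_def P_def algebra_simps)
  also have "\<dots> = integral\<^sup>L cube (\<lambda>x. (norm (r x))\<^sup>2 + (norm (a l))\<^sup>2 - 2 * Re (cnj (a l) * (r x * character (- l) x)))"
    by (simp only: pt)
  also have "\<dots> = integral\<^sup>L cube (\<lambda>x. (norm (r x))\<^sup>2) + (norm (a l))\<^sup>2 - 2 * Re (cnj (a l) * cfourier r l)"
  proof -
    have i: "integrable cube (\<lambda>x. 2 * Re (cnj (a l) * (r x * character (- l) x)))"
      by (intro integrable_mult_right integrable_Re ir)
    have ai: "integrable cube (\<lambda>x. cnj (a l) * (r x * character (- l) x))"
      by (intro integrable_mult_right ir)
    have "integral\<^sup>L cube (\<lambda>x. 2 * Re (cnj (a l) * (r x * character (- l) x)))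
       = 2 * integral\<^sup>L cube (\<lambda>x. Re (cnj (a l) * (r x * character (- l) x)))"
      by (rule Bochner_Integration.integral_mult_right) (rule integrable_Re[OF ai])
    also have "\<dots> = 2 * Re (integral\<^sup>L cube (\<lambda>x. cnj (a l) * (r x * character (- l) x)))"
      by (simp only: integral_Re[OF ai])
    also have "\<dots> = 2 * Re (cnj (a l) * cfourier r l)" using ir by (simp add: cfourier_def)
    finally show ?thesis
      using i L2c_integrable[OF r] measure_cube by (simp del: measure_cube)
  qed
  also have "integral\<^sup>L cube (\<lambda>x. (norm (r x))\<^sup>2) = L2dist f (\<lambda>x. \<Sum>k\<in>F. a k * character k x)"
    by (simp add: L2dist_def r_def P_def)
  also have "\<dots> + (norm (a l))\<^sup>2 - 2 * Re (cnj (a l) * cfourier r l)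
     = L2dist f (\<lambda>x. \<Sum>k\<in>F. a k * character k x) - (norm (cfourier f l))\<^sup>2 + (norm (cfourier f l - a l))\<^sup>2"
    unfolding rl cmod_power2 by (simp add: power2_eq_square algebra_simps)
  finally show ?case unfolding insert.IH using insert(1,2) by simp
qed

text \<open>Finite sums stay below the integral by Bessel's inequality. Conversely, a polynomial
  within e of f forces the sum over its frequencies above the integral minus e, because the last
  term of \<open>L2c_norm_polynomial\<close> is nonnegative.\<close>

theorem parseval:
  assumes f: "f \<in> L2c"
  shows "((\<lambda>k. (norm (cfourier f k))\<^sup>2) has_sum integral\<^sup>L cube (\<lambda>x. (norm (f x))\<^sup>2)) UNIV"
proof -
  define S where "S F = (\<Sum>k\<in>F. (norm (cfourier f k))\<^sup>2)" for F
  define I where "I = integral\<^sup>L cube (\<lambda>x. (norm (f x))\<^sup>2)"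
  have le: "S F \<le> I" if "finite F" for F
  proof -
    have "0 \<le> L2dist f (\<lambda>x. \<Sum>k\<in>F. cfourier f k * character k x)"
      unfolding L2dist_def by (intro integral_nonneg_AE AE_I2) simp
    then show ?thesis using L2c_norm_polynomial[OF f that, of "cfourier f"] by (simp add: S_def I_def)
  qed
  have "(S \<longlongrightarrow> I) (finite_subsets_at_top UNIV)"
  proof (rule tendstoI)
    fix e :: real assume "0 < e"
    then obtain P where P: "trig_poly P" "L2dist f P < e"
      using approximable_L2c[OF f] by (auto simp: approximable_def)
    obtain F a where F: "finite F" "P = (\<lambda>x. \<Sum>k\<in>F. a k * character k x)"
      using P(1) unfolding trig_poly_def by blast
    have "0 \<le> (\<Sum>k\<in>F. (norm (cfourier f k - a k))\<^sup>2)" by (intro sum_nonneg) simp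
    then have F1: "I - S F < e"
      using L2c_norm_polynomial[OF f F(1), of a] P(2) unfolding F(2) S_def I_def by linarith
    have "\<forall>\<^sub>F G in finite_subsets_at_top UNIV. finite G \<and> F \<subseteq> G"
      using F(1) unfolding eventually_finite_subsets_at_top by blast
    then show "\<forall>\<^sub>F G in finite_subsets_at_top UNIV. dist (S G) I < e"
    proof eventually_elim
      case (elim G)
      have "S F \<le> S G" unfolding S_def using elim by (intro sum_mono2) auto
      then show ?case using le[of G] elim F1 by (simp add: dist_real_def)
    qed
  qed
  then show ?thesis unfolding has_sum_def S_def I_def .
qed

text \<open>Complex polarisation: a times the conjugate of b is a combination of |a + c b|^2 over c
  in {1, -1, i, -i}, and both the sum and the integral are linear.\<close>

theorem parseval_inner:
  assumes f: "f \<in> L2c" and g: "g \<in> L2c"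
  shows "((\<lambda>k. cfourier f k * cnj (cfourier g k)) has_sum integral\<^sup>L cube (\<lambda>x. f x * cnj (g x))) UNIV"
proof -
  define N where "N c = complex_of_real (integral\<^sup>L cube (\<lambda>x. (norm (f x + c * g x))\<^sup>2))" for c
  define n where "n c k = complex_of_real ((norm (cfourier f k + c * cfourier g k))\<^sup>2)" for c k
  have "(n c has_sum N c) UNIV" for c
    using has_sum_of_real[OF parseval[OF L2c_add[OF f L2c_cmult[OF g, of c]]]]
    unfolding n_def N_def cfourier_add[OF f g] .
  then have "((\<lambda>k. (1/4) * (n 1 k + (- 1) * n (-1) k + \<i> * n \<i> k + (- \<i>) * n (- \<i>) k)) has_sum
      (1/4) * (N 1 + (- 1) * N (- 1) + \<i> * N \<i> + (- \<i>) * N (- \<i>))) UNIV"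
    by (intro has_sum_cmult_right has_sum_add)
  moreover have pol: "(1/4) * (complex_of_real ((norm (a + 1 * b))\<^sup>2) + (- 1) * complex_of_real ((norm (a + (- 1) * b))\<^sup>2)
      + \<i> * complex_of_real ((norm (a + \<i> * b))\<^sup>2) + (- \<i>) * complex_of_real ((norm (a + (- \<i>) * b))\<^sup>2)) = a * cnj b" for a b
    unfolding cmod_power2 by (simp add: complex_eq_iff power2_eq_square algebra_simps)
  moreover have "(1/4) * (N 1 + (- 1) * N (- 1) + \<i> * N \<i> + (- \<i>) * N (- \<i>)) = integral\<^sup>L cube (\<lambda>x. f x * cnj (g x))"
  proof -
    have i0: "integrable cube (\<lambda>x. (norm (f x + c * g x))\<^sup>2)" for c
      by (rule L2c_integrable[OF L2c_add[OF f L2c_cmult[OF g]]])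
    have i: "integrable cube (\<lambda>x. complex_of_real ((norm (f x + c * g x))\<^sup>2))" for c
      by (rule integrable_of_real[OF i0])
    have N: "N c = integral\<^sup>L cube (\<lambda>x. complex_of_real ((norm (f x + c * g x))\<^sup>2))" for c
      unfolding N_def by (rule integral_of_real[OF i0, symmetric])
    show ?thesis
      unfolding pol[symmetric] N
      by (simp only: integral_mult_right_zero Bochner_Integration.integral_add integrable_mult_right
          Bochner_Integration.integrable_add i)
  qed
  ultimately show ?thesis by (simp only: n_def pol)
qed


subsection \<open>Fourier coefficients of vector fields\<close>

lemma scalar_fourier_cfourier: "scalar_fourier f k = cfourier (\<lambda>x. complex_of_real (f x)) k"
  unfolding scalar_fourier_def cfourier_def integral_cube
  by (simp add: character_def rvec_minus)

lemma fourier_nth: "fourier u k $ i = cfourier (\<lambda>x. complex_of_real (u x $ i)) k"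
  by (simp add: fourier_def scalar_fourier_cfourier)

lemma L2_torus_component:
  assumes "u \<in> L2_torus" shows "(\<lambda>x. complex_of_real (u x $ i)) \<in> L2c"
proof (rule L2cI)
  have m: "u \<in> borel_measurable cube" and I: "integrable cube (\<lambda>x. (norm (u x))\<^sup>2)"
    using assms by (simp_all add: L2_torus_def integrable_cube measurable_restrict_space1)
  have "(\<lambda>x. u x $ i) \<in> borel_measurable cube"
    by (rule measurable_compose[OF m]) (intro borel_measurable_continuous_onI continuous_intros)
  then show cm: "(\<lambda>x. complex_of_real (u x $ i)) \<in> borel_measurable cube" by simp
  show "integrable cube (\<lambda>x. (norm (complex_of_real (u x $ i)))\<^sup>2)"
  proof (rule Bochner_Integration.integrable_bound[OF I])
    show "(\<lambda>x. (norm (complex_of_real (u x $ i)))\<^sup>2) \<in> borel_measurable cube"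
      using cm by measurable
    show "AE x in cube. norm ((norm (complex_of_real (u x $ i)))\<^sup>2) \<le> norm ((norm (u x))\<^sup>2)"
      by (rule AE_I2) (simp add: component_le_norm_cart flip: abs_le_square_iff)
  qed
qed

lemma norm_vec_power2: "(norm v)\<^sup>2 = (\<Sum>i\<in>UNIV. (norm (v $ i))\<^sup>2)"
  by (simp add: norm_vec_def L2_set_def sum_nonneg)

lemma L2_torus_integral:
  assumes "u \<in> L2_torus"
  shows "(L2_norm_torus u)\<^sup>2 = integral\<^sup>L cube (\<lambda>x. (norm (u x))\<^sup>2)"
    and "integrable cube (\<lambda>x. (norm (u x))\<^sup>2)"
proof -
  have "0 \<le> integral\<^sup>L cube (\<lambda>x. (norm (u x))\<^sup>2)" by (intro integral_nonneg_AE AE_I2) simp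
  then show "(L2_norm_torus u)\<^sup>2 = integral\<^sup>L cube (\<lambda>x. (norm (u x))\<^sup>2)"
    by (simp add: L2_norm_torus_def integral_cube)
  show "integrable cube (\<lambda>x. (norm (u x))\<^sup>2)"
    using assms by (simp add: L2_torus_def integrable_cube)
qed

lemma parseval_vector:
  assumes u: "u \<in> L2_torus"
  shows "((\<lambda>k. (norm (fourier u k))\<^sup>2) has_sum (L2_norm_torus u)\<^sup>2) UNIV"
proof -
  note L = L2_torus_component[OF u]
  have "((\<lambda>k. \<Sum>i\<in>UNIV. (norm (fourier u k $ i))\<^sup>2) has_sum
      (\<Sum>i\<in>UNIV. integral\<^sup>L cube (\<lambda>x. (norm (complex_of_real (u x $ i)))\<^sup>2))) UNIV"
    unfolding fourier_nth sum_3 by (intro has_sum_add parseval L)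
  moreover have "(\<Sum>i\<in>UNIV. integral\<^sup>L cube (\<lambda>x. (norm (complex_of_real (u x $ i)))\<^sup>2))
     = integral\<^sup>L cube (\<lambda>x. \<Sum>i\<in>UNIV. (norm (complex_of_real (u x $ i)))\<^sup>2)"
    by (rule Bochner_Integration.integral_sum[symmetric]) (intro L2c_integrable L)
  ultimately show ?thesis
    by (simp add: L2_torus_integral[OF u] norm_vec_power2)
qed

lemma L2_torus_diff:
  assumes u: "u \<in> L2_torus" and w: "w \<in> L2_torus"
  shows "(\<lambda>x. u x - w x) \<in> L2_torus"
proof -
  have m: "u \<in> borel_measurable lebesgue" "w \<in> borel_measurable lebesgue"
    using u w by (simp_all add: L2_torus_def)
  have mc: "u \<in> borel_measurable cube" "w \<in> borel_measurable cube"
    using m by (simp_all add: measurable_restrict_space1)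
  have "integrable cube (\<lambda>x. 2 * (norm (u x))\<^sup>2 + 2 * (norm (w x))\<^sup>2)"
    using L2_torus_integral(2)[OF u] L2_torus_integral(2)[OF w] by simp
  moreover have "(\<lambda>x. (norm (u x - w x))\<^sup>2) \<in> borel_measurable cube"
    using mc by measurable
  moreover have "AE x in cube. norm ((norm (u x - w x))\<^sup>2) \<le> norm (2 * (norm (u x))\<^sup>2 + 2 * (norm (w x))\<^sup>2)"
  proof (rule AE_I2)
    fix x
    show "norm ((norm (u x - w x))\<^sup>2) \<le> norm (2 * (norm (u x))\<^sup>2 + 2 * (norm (w x))\<^sup>2)"
      using norm_add_power2_le[of "u x" "- w x"] by (simp add: abs_of_nonneg)
  qed
  ultimately have "integrable cube (\<lambda>x. (norm (u x - w x))\<^sup>2)"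
    by (rule Bochner_Integration.integrable_bound)
  then show ?thesis
    using u w m by (simp add: L2_torus_def integrable_cube torus_periodic_def borel_measurable_diff)
qed

lemma fourier_diff:
  assumes "u \<in> L2_torus" "w \<in> L2_torus"
  shows "fourier (\<lambda>x. u x - w x) k = fourier u k - fourier w k"
proof -
  have "fourier (\<lambda>x. u x - w x) k $ i = fourier u k $ i - fourier w k $ i" for i
    using cfourier_add[OF L2_torus_component[OF assms(1), of i] L2_torus_component[OF assms(2), of i], of "-1" k]
    by (simp add: fourier_nth)
  then show ?thesis by (simp add: vec_eq_iff)
qed

lemma fourier_minus: "fourier u (- k) $ i = cnj (fourier u k $ i)"
  unfolding fourier_nth cfourier_def
  by (subst Bochner_Integration.integral_cnj[symmetric]) (simp add: cnj_character)

text \<open>The exceptional set is covered by the integer translates of one negligible set, and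
  there are countably many of them.\<close>

lemma periodic_AE_cube:
  assumes P: "\<And>x k. P (x + rvec k) \<longleftrightarrow> P x" and ae: "AE x in cube. P x"
  shows "AE x in lebesgue. P x"
proof -
  have "AE x in lebesgue. x \<in> unit_cube \<longrightarrow> P x"
    using ae by (subst (asm) AE_restrict_space_iff) auto
  then obtain N where N: "negligible N" "{x. \<not> (x \<in> unit_cube \<longrightarrow> P x)} \<subseteq> N"
    unfolding eventually_ae_filter negligible_iff_null_sets by auto
  have "{x. \<not> P x} \<subseteq> (\<Union>k. (\<lambda>x. rvec k + x) ` N)"
  proof
    fix x assume x: "x \<in> {x. \<not> P x}"
    define k :: "int^3" where "k = (\<chi> i. \<lfloor>x $ i\<rfloor>)"
    have "0 \<le> x $ i - of_int \<lfloor>x $ i\<rfloor> \<and> x $ i - of_int \<lfloor>x $ i\<rfloor> \<le> 1" for i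
      by linarith
    then have "x - rvec k \<in> unit_cube"
      by (simp add: unit_cube_def mem_box_cart k_def rvec_def)
    moreover have "\<not> P (x - rvec k)" using P[of "x - rvec k" k] x by simp
    ultimately have "x - rvec k \<in> N" using N(2) by blast
    then show "x \<in> (\<Union>k. (\<lambda>x. rvec k + x) ` N)" by force
  qed
  moreover have "negligible (\<Union>k::int^3. (\<lambda>x. rvec k + x) ` N)"
    by (intro negligible_countable_Union countable_image) (auto intro: negligible_translation[OF N(1)])
  ultimately have "negligible {x. \<not> P x}" by (rule negligible_subset[rotated])
  then show ?thesis
    by (metis (mono_tags, lifting) AE_not_in eventually_mono mem_Collect_eq negligible_iff_null_sets)
qed

text \<open>By Parseval the difference has norm zero on the cube, and periodicity carries the
  equality to the whole space.\<close>

lemma fourier_unique: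
  assumes u: "u \<in> L2_torus" and w: "w \<in> L2_torus" and eq: "\<And>k. fourier u k = fourier w k"
  shows "ae_eq u w"
proof -
  define d where "d x = u x - w x" for x
  have d: "d \<in> L2_torus" unfolding d_def by (rule L2_torus_diff[OF u w])
  have "fourier d k = 0" for k unfolding d_def using fourier_diff[OF u w] eq by simp
  then have "((\<lambda>k. 0) has_sum (L2_norm_torus d)\<^sup>2) (UNIV :: (int^3) set)"
    using parseval_vector[OF d] by simp
  from has_sum_unique[OF this has_sum_0] have "(L2_norm_torus d)\<^sup>2 = 0" by simp
  then have "integral\<^sup>L cube (\<lambda>x. (norm (d x))\<^sup>2) = 0" using L2_torus_integral(1)[OF d] by simp
  then have "AE x in cube. (norm (d x))\<^sup>2 = 0"
    by (subst (asm) integral_nonneg_eq_0_iff_AE[OF L2_torus_integral(2)[OF d]]) auto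
  then have "AE x in cube. u x = w x" by (simp add: d_def)
  then show ?thesis unfolding ae_eq_def
    by (rule periodic_AE_cube[rotated]) (use u w in \<open>auto simp: L2_torus_def torus_periodic_def\<close>)
qed

lemma fourier_cong_ae:
  assumes u: "u \<in> L2_torus" and w: "w \<in> L2_torus" and ae: "ae_eq u w"
  shows "fourier u k = fourier w k" "L2_norm_torus u = L2_norm_torus w"
proof -
  have ae': "AE x in cube. u x = w x"
    using ae unfolding ae_eq_def by (subst AE_restrict_space_iff) (auto elim: eventually_mono)
  have "fourier u k $ i = fourier w k $ i" for k i
    unfolding fourier_nth cfourier_def
  proof (rule integral_cong_AE)
    show "AE x in cube. complex_of_real (u x $ i) * character (- k) x = complex_of_real (w x $ i) * character (- k) x"
      using ae' by eventually_elim simp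
  qed (use L2c_measurable[OF L2_torus_component[OF u]] L2c_measurable[OF L2_torus_component[OF w]]
        in \<open>auto intro!: borel_measurable_times\<close>)
  then have *: "fourier u k = fourier w k" for k by (simp add: vec_eq_iff)
  then show "fourier u k = fourier w k" .
  have "(L2_norm_torus u)\<^sup>2 = (L2_norm_torus w)\<^sup>2"
    using has_sum_unique[OF parseval_vector[OF u]] parseval_vector[OF w] * by simp
  then show "L2_norm_torus u = L2_norm_torus w"
    by (rule power2_eq_imp_eq) (simp_all add: L2_norm_torus_def set_lebesgue_integral_def)
qed

text \<open>Parseval for u_j and g = u_i times the character of k: since u is real, the conjugate of
  the coefficient of g at p is the coefficient of u_i at k - p. The sum converges unconditionally
  for every square integrable u.\<close>

lemma scalar_fourier_mult:
  assumes u: "u \<in> L2_torus"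
  shows "((\<lambda>p. fourier u p $ j * fourier u (k - p) $ i) has_sum
     scalar_fourier (\<lambda>x. u x $ j * u x $ i) k) UNIV"
proof -
  define g where "g x = complex_of_real (u x $ i) * character k x" for x
  have g: "g \<in> L2c" unfolding g_def
    by (rule L2c_mult_bounded[where B = 1]) (simp_all add: L2_torus_component[OF u])
  have gf: "cnj (cfourier g p) = fourier u (k - p) $ i" for p
  proof -
    have "cfourier g p = fourier u (- (k - p)) $ i"
      unfolding fourier_nth cfourier_def g_def by (simp add: mult.assoc flip: character_add)
    then show ?thesis by (simp only: fourier_minus complex_cnj_cnj)
  qed
  have "integral\<^sup>L cube (\<lambda>x. complex_of_real (u x $ j) * cnj (g x))
      = scalar_fourier (\<lambda>x. u x $ j * u x $ i) k"
    by (simp add: scalar_fourier_cfourier cfourier_def g_def cnj_character mult.assoc)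
  then show ?thesis
    using parseval_inner[OF L2_torus_component[OF u] g, of j] by (simp add: gf fourier_nth)
qed

section \<open>Amplitudes of fields in the constraint space\<close>

definition bil :: "(int^3 \<Rightarrow> complex) \<Rightarrow> (int^3 \<Rightarrow> complex) \<Rightarrow> int^3 \<Rightarrow> complex" where
  "bil c d k = (\<Sum>p\<in>pairs k. \<i> * coef k p * c p * d (k - p))"

text \<open>The scalar product with v^k gives an amplitude to every field; on the constraint space
  it returns the coefficient of v^k.\<close>

definition amp :: "(real^3 \<Rightarrow> real^3) \<Rightarrow> int^3 \<Rightarrow> complex" where
  "amp u k = (if k \<in> M_set then \<Sum>i\<in>UNIV. complex_of_real (v_dir k $ i) * fourier u k $ i else 0)"

lemma cvec_nth [simp]: "cvec v $ i = complex_of_real (v $ i)"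
  by (simp add: cvec_def)

lemma cvec_smult: "(c *s cvec v) $ i = c * complex_of_real (v $ i)"
  by simp

lemma v_dir_squares:
  assumes "k \<in> M_set" shows "(\<Sum>i\<in>UNIV. complex_of_real (v_dir k $ i) * complex_of_real (v_dir k $ i)) = 1"
proof -
  have "(\<Sum>i\<in>UNIV. v_dir k $ i * v_dir k $ i) = 1"
    using norm_v_dir[OF assms] by (simp add: norm_eq_1 inner_vec_def)
  then show ?thesis by (simp flip: of_real_mult of_real_sum)
qed

lemma amp_fourierI:
  assumes "k \<in> M_set" "fourier u k = c *s cvec (v_dir k)" shows "amp u k = c"
proof -
  have "amp u k = c * (\<Sum>i\<in>UNIV. complex_of_real (v_dir k $ i) * complex_of_real (v_dir k $ i))"
    using assms by (simp add: amp_def cvec_smult sum_distrib_left mult_ac)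
  then show ?thesis by (simp add: v_dir_squares[OF assms(1)])
qed

lemma fourier_amp: "u \<in> HdotM s \<Longrightarrow> fourier u k = amp u k *s cvec (v_dir k)"
  using amp_fourierI[of k u] by (cases "k \<in> M_set") (auto simp: HdotM_def amp_def)

lemma norm_smult_v_dir:
  assumes "k \<in> M_set" shows "norm (c *s cvec (v_dir k)) = norm c"
proof -
  have "(norm (c *s cvec (v_dir k)))\<^sup>2 = (norm c)\<^sup>2 * (\<Sum>i\<in>UNIV. (v_dir k $ i)\<^sup>2)"
    unfolding norm_vec_power2 cvec_smult by (simp add: norm_mult power_mult_distrib sum_distrib_left)
  also have "(\<Sum>i\<in>UNIV. (v_dir k $ i)\<^sup>2) = (norm (v_dir k))\<^sup>2" by (simp add: norm_vec_power2)
  finally show ?thesis by (simp add: norm_v_dir[OF assms])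
qed

lemma norm_fourier_amp: "u \<in> HdotM s \<Longrightarrow> norm (fourier u k) = norm (amp u k)"
proof (cases "k \<in> M_set")
  case True
  then show "norm (fourier u k) = norm (amp u k)" if "u \<in> HdotM s"
    unfolding fourier_amp[OF that, of k] by (rule norm_smult_v_dir)
qed (simp add: amp_def HdotM_def)

lemma amp_outside: "k \<notin> M_set \<Longrightarrow> amp u k = 0"
  by (simp add: amp_def)

lemma amp_minus: "amp u (- k) = cnj (amp u k)"
  by (simp add: amp_def v_dir_minus fourier_minus cnj_sum)

lemma HdotM_L2: "u \<in> HdotM s \<Longrightarrow> u \<in> L2_torus"
  by (simp add: HdotM_def Hdot_def)

text \<open>The convolution over all p collapses to the finite sum over \<open>pairs k\<close>,
  since a product with a leg outside \<open>M_set\<close> vanishes.\<close>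

lemma proj_div_tensor:
  assumes u: "u \<in> HdotM s"
  shows "proj_M (div_tensor u) k = (if k \<in> M_set then bil (amp u) (amp u) k else 0) *s cvec (v_dir k)"
proof (cases "k \<in> M_set")
  case k: True
  have sf: "scalar_fourier (\<lambda>x. u x $ j * u x $ i) k
     = (\<Sum>p\<in>pairs k. amp u p * v_dir p $ j * (amp u (k - p) * v_dir (k - p) $ i))" for i j
  proof -
    have "((\<lambda>p. fourier u p $ j * fourier u (k - p) $ i) has_sum
        (\<Sum>p\<in>pairs k. fourier u p $ j * fourier u (k - p) $ i)) UNIV"
      by (rule has_sum_finite_neutralI[OF pairs_card(1)[OF k]])
         (auto simp: fourier_amp[OF u] pairs_def amp_outside cvec_smult)
    from has_sum_unique[OF scalar_fourier_mult[OF HdotM_L2[OF u], of j k i] this]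
    show ?thesis by (simp add: fourier_amp[OF u] cvec_smult)
  qed
  have "(\<Sum>i\<in>UNIV. complex_of_real (v_dir k $ i) * div_tensor u k $ i) = bil (amp u) (amp u) k"
    unfolding div_tensor_def sf bil_def coef_def
    by (simp add: sum_3 sum_distrib_left inner_vec_def rvec_def flip: sum.distrib)
       (intro sum.cong refl, simp add: algebra_simps)
  then show ?thesis using k by (simp add: proj_M_def)
qed (simp add: proj_M_def)

lemma laplace_symbol_freq:
  assumes "k \<in> M_set" shows "laplace_symbol a k = (2 * pi * freq k) powr (2 * a)"
proof -
  have "4 * pi\<^sup>2 * (norm (rvec k))\<^sup>2 = (2 * pi * freq k) powr 2"
    using freq_ge_1[OF assms] by (simp add: freq_def power_mult_distrib)
  then show ?thesis by (simp add: laplace_symbol_def powr_powr)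
qed

lemma Hdot_sum_amp:
  assumes "\<And>k. fourier u k = amp u k *s cvec (v_dir k)"
  shows "(\<Sum>\<^sub>\<infinity>k\<in>UNIV - {0}. laplace_symbol a k * (norm (fourier u k))\<^sup>2)
      = (\<Sum>\<^sub>\<infinity>k\<in>M_set. laplace_symbol a k * (norm (amp u k))\<^sup>2)"
    and "(\<lambda>k. laplace_symbol a k * (norm (fourier u k))\<^sup>2) summable_on UNIV - {0}
      \<longleftrightarrow> (\<lambda>k. laplace_symbol a k * (norm (amp u k))\<^sup>2) summable_on M_set"
proof -
  have *: "norm (fourier u k) = norm (amp u k)" for k
  proof (cases "k \<in> M_set")
    case True
    then show ?thesis by (subst assms) (rule norm_smult_v_dir)
  next
    case False
    then show ?thesis by (subst assms) (simp add: amp_def)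
  qed
  show "(\<Sum>\<^sub>\<infinity>k\<in>UNIV - {0}. laplace_symbol a k * (norm (fourier u k))\<^sup>2)
      = (\<Sum>\<^sub>\<infinity>k\<in>M_set. laplace_symbol a k * (norm (amp u k))\<^sup>2)"
    by (rule infsum_cong_neutral) (auto simp: * amp_outside M_set_nonzero)
  show "(\<lambda>k. laplace_symbol a k * (norm (fourier u k))\<^sup>2) summable_on UNIV - {0}
      \<longleftrightarrow> (\<lambda>k. laplace_symbol a k * (norm (amp u k))\<^sup>2) summable_on M_set"
    by (rule summable_on_cong_neutral) (auto simp: * amp_outside M_set_nonzero)
qed

lemma Hdot_norm_amp:
  assumes "\<And>k. fourier u k = amp u k *s cvec (v_dir k)"
  shows "(Hdot_norm a u)\<^sup>2 = (\<Sum>\<^sub>\<infinity>k\<in>M_set. laplace_symbol a k * (norm (amp u k))\<^sup>2)"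
proof -
  have "0 \<le> (\<Sum>\<^sub>\<infinity>k\<in>M_set. laplace_symbol a k * (norm (amp u k))\<^sup>2)"
    by (rule infsum_nonneg) (simp add: laplace_symbol_def)
  then show ?thesis by (simp add: Hdot_norm_def Hdot_sum_amp(1)[OF assms])
qed

lemma L2_norm_amp:
  assumes "u \<in> HdotM s"
  shows "((\<lambda>k. (norm (amp u k))\<^sup>2) has_sum (L2_norm_torus u)\<^sup>2) M_set"
proof -
  have "((\<lambda>k. (norm (amp u k))\<^sup>2) has_sum (L2_norm_torus u)\<^sup>2) UNIV"
    using parseval_vector[OF HdotM_L2[OF assms]] by (simp add: norm_fourier_amp[OF assms])
  then show ?thesis
    by (subst has_sum_cong_neutral[where T = UNIV]) (auto simp: amp_outside)
qed


subsection \<open>Duhamel integrals and the quadratic term\<close>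

text \<open>This is ln y \<le> y for y = x / b. It trades the exponential damping for b powers of
  the rate.\<close>

lemma exp_decay_powr:
  fixes x b :: real
  assumes "0 < x" "0 < b" shows "exp (- x) \<le> (x / b) powr (- b)"
proof -
  have "ln (x / b) \<le> x / b" using ln_le_minus_one[of "x / b"] assms by simp
  then have "b * ln (x / b) \<le> x" using assms(2) by (simp add: field_simps)
  then have "exp (- x) \<le> exp (- b * ln (x / b))" by simp
  also have "\<dots> = (x / b) powr (- b)" using assms by (simp add: powr_def)
  finally show ?thesis .
qed

text \<open>Both a and L are at most a + L, hence so is their weighted geometric mean. The power of
  a will become decay in k, the power of L smallness.\<close>

lemma interpolation_bound:
  fixes a L :: real
  assumes "0 < a" "0 < L" "0 \<le> th" "th \<le> 1"
  shows "1 / (a + L) \<le> a powr (th - 1) * L powr (- th)"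
proof -
  have "a powr (1 - th) * L powr th \<le> (a + L) powr (1 - th) * (a + L) powr th"
    using assms by (intro mult_mono powr_mono2) auto
  also have "\<dots> = a + L" using assms by (simp flip: powr_add)
  finally have "1 / (a + L) \<le> 1 / (a powr (1 - th) * L powr th)"
    using assms by (intro divide_left_mono mult_pos_pos) auto
  also have "\<dots> = a powr (th - 1) * L powr (- th)"
    using powr_minus[of a "1 - th"] by (simp add: powr_minus field_simps)
  finally show ?thesis .
qed

definition duhamel_int :: "real \<Rightarrow> (real \<Rightarrow> complex) \<Rightarrow> real \<Rightarrow> complex" where
  "duhamel_int a g t = integral {0..t} (\<lambda>\<tau>. exp (- a * (t - \<tau>)) *\<^sub>R g \<tau>)"

lemma duhamel_integrand_continuous:
  fixes g :: "real \<Rightarrow> complex"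
  assumes "continuous_on S g" shows "continuous_on S (\<lambda>\<tau>. exp (- a * (t - \<tau>)) *\<^sub>R g \<tau>)"
  by (intro continuous_intros assms)

lemma duhamel_integrable:
  fixes g :: "real \<Rightarrow> complex"
  assumes "continuous_on {u..v} g" shows "(\<lambda>\<tau>. exp (- a * (t - \<tau>)) *\<^sub>R g \<tau>) integrable_on {u..v}"
  by (intro integrable_continuous_real duhamel_integrand_continuous assms)

text \<open>Against the weight exp (L \<tau>) the kernel integrates to at most exp (L t) / (a + L):
  a large L acts like additional dissipation, uniformly in t.\<close>

lemma duhamel_int_bound:
  assumes g: "continuous_on {0..t} g" and a: "0 < a" and L: "0 < L" and t: "0 \<le> t"
    and bound: "\<And>\<tau>. 0 \<le> \<tau> \<Longrightarrow> \<tau> \<le> t \<Longrightarrow> norm (g \<tau>) \<le> G * exp (L * \<tau>)" and G: "0 \<le> G"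
  shows "norm (duhamel_int a g t) \<le> G * exp (L * t) / (a + L)"
proof -
  have e: "exp (- a * (t - \<tau>)) * exp (L * \<tau>) = exp (- a * t) * exp ((a + L) * \<tau>)" for \<tau>
    by (simp add: algebra_simps flip: exp_add)
  have I: "((\<lambda>\<tau>. G * exp (- a * t) * exp ((a + L) * \<tau>)) has_integral
      G * exp (- a * t) * (exp ((a + L) * t) / (a + L)) - G * exp (- a * t) * (exp ((a + L) * 0) / (a + L))) {0..t}"
  proof (rule fundamental_theorem_of_calculus[OF t])
    fix x
    show "((\<lambda>\<tau>. G * exp (- a * t) * (exp ((a + L) * \<tau>) / (a + L))) has_vector_derivative
       G * exp (- a * t) * exp ((a + L) * x)) (at x within {0..t})"
      unfolding has_real_derivative_iff_has_vector_derivative[symmetric]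
      using a L by (auto intro!: derivative_eq_intros)
  qed
  have "norm (duhamel_int a g t) \<le> integral {0..t} (\<lambda>\<tau>. G * exp (- a * t) * exp ((a + L) * \<tau>))"
    unfolding duhamel_int_def
  proof (rule integral_norm_bound_integral[OF duhamel_integrable[OF g]])
    show "(\<lambda>\<tau>. G * exp (- a * t) * exp ((a + L) * \<tau>)) integrable_on {0..t}"
      using I by blast
    fix \<tau> assume "\<tau> \<in> {0..t}"
    then have "exp (- a * (t - \<tau>)) * norm (g \<tau>) \<le> exp (- a * (t - \<tau>)) * (G * exp (L * \<tau>))"
      using bound by (intro mult_left_mono) auto
    also have "\<dots> = G * (exp (- a * (t - \<tau>)) * exp (L * \<tau>))" by (simp only: mult_ac)
    also have "\<dots> = G * exp (- a * t) * exp ((a + L) * \<tau>)" by (simp only: e mult.assoc)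
    finally show "norm (exp (- a * (t - \<tau>)) *\<^sub>R g \<tau>) \<le> G * exp (- a * t) * exp ((a + L) * \<tau>)"
      by simp
  qed
  also have "\<dots> = G * exp (- a * t) * (exp ((a + L) * t) / (a + L)) - G * exp (- a * t) * (exp ((a + L) * 0) / (a + L))"
    using I by (rule integral_unique)
  also have "\<dots> \<le> G * exp (- a * t) * (exp ((a + L) * t) / (a + L))"
    using a L G by simp
  also have "\<dots> = G * (exp (- a * t) * exp ((a + L) * t)) / (a + L)" by simp
  also have "exp (- a * t) * exp ((a + L) * t) = exp (L * t)"
    by (simp add: algebra_simps flip: exp_add)
  finally show ?thesis .
qed

text \<open>With exp (- a t) taken out, t occurs only as the upper limit, so the fundamental theorem
  and the product rule apply in \<open>duhamel_has_derivative\<close>.\<close>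

lemma duhamel_int_factor:
  assumes "continuous_on {0..t} g"
  shows "duhamel_int a g t = exp (- a * t) *\<^sub>R integral {0..t} (\<lambda>\<tau>. exp (a * \<tau>) *\<^sub>R g \<tau>)"
proof -
  have "exp (- a * (t - \<tau>)) *\<^sub>R g \<tau> = exp (- a * t) *\<^sub>R (exp (a * \<tau>) *\<^sub>R g \<tau>)" for \<tau>
    by (simp add: algebra_simps flip: exp_add)
  then show ?thesis
    unfolding duhamel_int_def by (simp only: integral_cmul)
qed

lemma duhamel_int_cong: "(\<And>\<tau>. 0 \<le> \<tau> \<Longrightarrow> \<tau> \<le> t \<Longrightarrow> g \<tau> = h \<tau>) \<Longrightarrow> duhamel_int a g t = duhamel_int a h t"
  unfolding duhamel_int_def by (rule integral_cong) simp

lemma duhamel_int_diff: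
  assumes "continuous_on {0..t} g" "continuous_on {0..t} h"
  shows "duhamel_int a g t - duhamel_int a h t = duhamel_int a (\<lambda>\<tau>. g \<tau> - h \<tau>) t"
  unfolding duhamel_int_def
  by (subst integral_diff[symmetric, OF duhamel_integrable duhamel_integrable])
     (simp_all add: assms scaleR_diff_right)

text \<open>The semigroup law: the history up to r enters only through its value at r, which allows
  a solution to be restarted.\<close>

lemma duhamel_int_split:
  assumes g: "continuous_on {0..r + t} g" and r: "0 \<le> r" and t: "0 \<le> t"
  shows "duhamel_int a g (r + t) = exp (- a * t) *\<^sub>R duhamel_int a g r + duhamel_int a (\<lambda>\<tau>. g (r + \<tau>)) t"
proof -
  define f where "f \<tau> = exp (- a * (r + t - \<tau>)) *\<^sub>R g \<tau>" for \<tau>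
  have fc: "continuous_on {0..r + t} f" unfolding f_def by (intro continuous_intros g)
  have "duhamel_int a g (r + t) = integral {0..r + t} f" unfolding duhamel_int_def f_def ..
  also have "\<dots> = integral {0..r} f + integral {r..r + t} f"
    using Henstock_Kurzweil_Integration.integral_combine[of 0 r "r + t" f] r t
      integrable_continuous_real[OF fc] by simp
  also have "integral {0..r} f = integral {0..r} (\<lambda>\<tau>. exp (- a * t) *\<^sub>R (exp (- a * (r - \<tau>)) *\<^sub>R g \<tau>))"
    unfolding f_def by (simp add: algebra_simps flip: exp_add)
  also have "\<dots> = exp (- a * t) *\<^sub>R duhamel_int a g r" by (simp only: integral_cmul duhamel_int_def)
  also have "integral {r..r + t} f = integral {0..t} (\<lambda>\<tau>. f (\<tau> + r))"
    using integral_shift[of 0 r t f] continuous_on_subset[OF fc, of "{0 + r..t + r}"] r by (simp add: add.commute o_def)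
  also have "\<dots> = duhamel_int a (\<lambda>\<tau>. g (r + \<tau>)) t"
    unfolding duhamel_int_def f_def by (simp add: algebra_simps)
  finally show ?thesis .
qed

lemma duhamel_has_derivative:
  assumes g: "continuous_on {0..T} g" and t: "t \<in> {0..T}"
  shows "((\<lambda>t. exp (- a * t) *\<^sub>R c0 - duhamel_int a g t) has_vector_derivative
     - a *\<^sub>R (exp (- a * t) *\<^sub>R c0 - duhamel_int a g t) - g t) (at t within {0..T})"
proof -
  define J where "J t = integral {0..t} (\<lambda>\<tau>. exp (a * \<tau>) *\<^sub>R g \<tau>)" for t
  have J: "(J has_vector_derivative exp (a * t) *\<^sub>R g t) (at t within {0..T})"
    unfolding J_def
    by (rule integral_has_vector_derivative[OF _ t]) (intro continuous_intros g)
  have E: "((\<lambda>t. exp (- a * t)) has_real_derivative exp (- a * t) * (- a)) (at t within {0..T})"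
    by (auto intro!: derivative_eq_intros)
  have D: "duhamel_int a g u = exp (- a * u) *\<^sub>R J u" if "u \<in> {0..T}" for u
    unfolding J_def by (rule duhamel_int_factor) (use g that in \<open>auto intro: continuous_on_subset\<close>)
  have "((\<lambda>t. exp (- a * t) *\<^sub>R (c0 - J t)) has_vector_derivative
     exp (- a * t) *\<^sub>R (0 - exp (a * t) *\<^sub>R g t) + (exp (- a * t) * (- a)) *\<^sub>R (c0 - J t)) (at t within {0..T})"
    by (intro has_vector_derivative_scaleR E has_vector_derivative_diff has_vector_derivative_const J)
  also have "exp (- a * t) *\<^sub>R (0 - exp (a * t) *\<^sub>R g t) + (exp (- a * t) * (- a)) *\<^sub>R (c0 - J t)
     = - a *\<^sub>R (exp (- a * t) *\<^sub>R c0 - duhamel_int a g t) - g t"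
    by (simp add: D[OF t] algebra_simps scaleR_diff_right mult.commute flip: exp_add)
  finally show ?thesis
    by (rule has_vector_derivative_transform[OF t, rotated])
       (simp add: D scaleR_diff_right)
qed

lemma duhamel_int_continuous:
  assumes g: "continuous_on {0..T} g" shows "continuous_on {0..T} (duhamel_int a g)"
proof -
  have "continuous_on {0..T} (\<lambda>t. exp (- a * t) *\<^sub>R 0 - duhamel_int a g t)"
    unfolding continuous_on_eq_continuous_within
    using duhamel_has_derivative[OF g] by (blast intro: has_vector_derivative_continuous)
  from continuous_on_minus[OF this] show ?thesis by simp
qed

lemma geometric_limit:
  fixes x :: "nat \<Rightarrow> 'a::banach"
  assumes "\<And>n. norm (x (Suc n) - x n) \<le> B / 2 ^ n"
  shows "convergent x" "norm (x n - lim x) \<le> 2 * B / 2 ^ n"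
proof -
  \<comment> \<open>Keeping the subtracted tail makes the induction close; the plain bound 2 B / 2^n
    would not reproduce itself.\<close>
  have step: "norm (x (n + m) - x n) \<le> 2 * B / 2 ^ n - 2 * B / 2 ^ (n + m)" for n m
  proof (induction m)
    case (Suc m)
    have "norm (x (n + Suc m) - x n) \<le> norm (x (Suc (n + m)) - x (n + m)) + norm (x (n + m) - x n)"
      using norm_triangle_ineq[of "x (Suc (n + m)) - x (n + m)" "x (n + m) - x n"] by simp
    also have "\<dots> \<le> B / 2 ^ (n + m) + (2 * B / 2 ^ n - 2 * B / 2 ^ (n + m))"
      by (intro add_mono assms Suc.IH)
    also have "\<dots> = 2 * B / 2 ^ n - 2 * B / 2 ^ (n + Suc m)" by (simp add: field_simps)
    finally show ?case .
  qed simp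
  have B: "0 \<le> B" using order_trans[OF norm_ge_zero assms[of 0]] by simp
  have le: "norm (x m - x n) \<le> 2 * B / 2 ^ n" if "n \<le> m" for m n
  proof -
    obtain d where d: "m = n + d" using \<open>n \<le> m\<close> le_Suc_ex by blast
    have "0 \<le> 2 * B / 2 ^ (n + d)" using B by simp
    then show ?thesis using step[of n d] unfolding d by linarith
  qed
  have "Cauchy x"
  proof (rule metric_CauchyI)
    fix e :: real assume e: "0 < e"
    have "(\<lambda>n. (1/2 :: real) ^ n) \<longlonglongrightarrow> 0" by (intro LIMSEQ_power_zero) simp
    then have "(\<lambda>n. 2 * B * (1/2) ^ n) \<longlonglongrightarrow> 2 * B * 0" by (intro tendsto_mult_left)
    then have "\<forall>\<^sub>F n in sequentially. 2 * B * (1/2) ^ n < e / 2" using e by (intro order_tendstoD(2)) auto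
    then obtain N where "2 * B * (1/2) ^ N < e / 2" by (auto simp: eventually_sequentially)
    then have N: "2 * B / 2 ^ N < e / 2" by (simp add: power_divide)
    have "dist (x m) (x n) < e" if "N \<le> m" "N \<le> n" for m n
      using le[OF that(1)] le[OF that(2)] N norm_triangle_ineq4[of "x m - x N" "x n - x N"]
      by (simp add: dist_norm)
    then show "\<exists>M. \<forall>m\<ge>M. \<forall>n\<ge>M. dist (x m) (x n) < e" by blast
  qed
  then show conv: "convergent x" by (rule Cauchy_convergent)
  then have "(\<lambda>m. norm (x n - x m)) \<longlonglongrightarrow> norm (x n - lim x)"
    by (intro tendsto_intros) (simp add: convergent_LIMSEQ_iff)
  then show "norm (x n - lim x) \<le> 2 * B / 2 ^ n"
    by (rule tendsto_upperbound)
       (use le[of n] in \<open>auto simp: eventually_sequentially norm_minus_commute\<close>)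
qed

lemma bil_diff: "bil c d k - bil c' d' k = bil (\<lambda>p. c p - c' p) d k + bil c' (\<lambda>p. d p - d' p) k"
  by (simp add: bil_def algebra_simps flip: sum_subtractf sum.distrib)

lemma freq_pos: "k \<in> M_set \<Longrightarrow> 0 < freq k"
  using freq_ge_1[of k] by linarith

text \<open>The factor \<open>41472 = 324 * 128\<close> comes from the bounds on the number of pairs and on their coefficients.\<close>

definition bil_const :: "real \<Rightarrow> real" where
  "bil_const r = 41472 * 36 powr r"

lemma bil_const_nonneg: "0 \<le> bil_const r"
  by (simp add: bil_const_def)

lemma freq_powr_triad:
  assumes "k \<in> M_set" "p \<in> pairs k" "0 \<le> r" "x \<in> {k, p, k - p}" "y \<in> {k, p, k - p}"
  shows "freq x powr r \<le> 6 powr r * freq y powr r"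
proof -
  have "y \<in> M_set" "x \<in> M_set" using assms by (auto simp: pairs_def)
  then have "freq x powr r \<le> (6 * freq y) powr r"
    using freq_triad[OF assms(1,2,4,5)] assms(3) freq_pos[of x] by (intro powr_mono2) auto
  also have "\<dots> = 6 powr r * freq y powr r" by (simp add: powr_mult freq_def)
  finally show ?thesis .
qed

lemma freq_powr_neg_triad:
  assumes "k \<in> M_set" "p \<in> pairs k" "0 \<le> r" "x \<in> {k, p, k - p}" "y \<in> {k, p, k - p}"
  shows "freq x powr (- r) \<le> 6 powr r * freq y powr (- r)"
proof -
  have "y \<in> M_set" "x \<in> M_set" using assms by (auto simp: pairs_def)
  then have "0 < freq x powr r" "0 < freq y powr r" using freq_pos by fastforce+
  then show ?thesis
    using freq_powr_triad[OF assms(1-3,5,4)] by (simp add: powr_minus field_simps)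
qed

text \<open>The frequencies of a triad agree up to the factor 6, so the weights of p and of k - p
  are replaced by that of k at the cost 6^r each; this is the 36^r in \<open>bil_const\<close>. The
  coefficient and the two weights leave the exponent lam - 2 r.\<close>

lemma bil_bound:
  assumes k: "k \<in> M_set" and r: "0 \<le> r" and A: "0 \<le> A" and B: "0 \<le> B"
    and c: "\<And>p. p \<in> M_set \<Longrightarrow> norm (c p) \<le> A * freq p powr (- r)"
    and d: "\<And>p. p \<in> M_set \<Longrightarrow> norm (d p) \<le> B * freq p powr (- r)"
  shows "norm (bil c d k) \<le> bil_const r * A * B * freq k powr (lam - 2 * r)"
proof -
  define X where "X = 128 * freq k powr lam * (A * (6 powr r * freq k powr (- r))) * (B * (6 powr r * freq k powr (- r)))"
  have X0: "0 \<le> X" using A B by (simp add: X_def)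
  have summand: "norm (\<i> * coef k p * c p * d (k - p)) \<le> X" if p: "p \<in> pairs k" for p
  proof -
    have 1: "norm (c p) \<le> A * (6 powr r * freq k powr (- r))"
      using c[OF pairs_M_set(1)[OF p]] mult_left_mono[OF freq_powr_neg_triad[OF k p r, of p k] A]
      by simp
    have 2: "norm (d (k - p)) \<le> B * (6 powr r * freq k powr (- r))"
      using d[OF pairs_M_set(2)[OF p]] mult_left_mono[OF freq_powr_neg_triad[OF k p r, of "k - p" k] B]
      by simp
    have "norm (\<i> * coef k p * c p * d (k - p)) = \<bar>coef k p\<bar> * norm (c p) * norm (d (k - p))"
      by (simp add: norm_mult)
    also have "\<dots> \<le> X"
      unfolding X_def using coef_bound[OF k p, of k] A B by (intro mult_mono 1 2) auto
    finally show ?thesis .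
  qed
  have "norm (bil c d k) \<le> (\<Sum>p\<in>pairs k. X)"
    unfolding bil_def by (rule order_trans[OF norm_sum]) (intro sum_mono summand)
  also have "\<dots> = real (card (pairs k)) * X" by simp
  also have "\<dots> \<le> 324 * X" using pairs_card(2)[OF k] X0 by (intro mult_right_mono) auto
  also have "\<dots> = 41472 * (6 powr r * 6 powr r) * A * B * (freq k powr lam * freq k powr (- r) * freq k powr (- r))"
    by (simp add: X_def)
  also have "(6::real) powr r * 6 powr r = 36 powr r" by (simp flip: powr_mult)
  also have "freq k powr lam * freq k powr (- r) * freq k powr (- r) = freq k powr (lam - 2 * r)"
    by (simp flip: powr_add)
  finally show ?thesis by (simp only: bil_const_def)
qed

lemma coef_minus: "coef (- k) (- p) = - coef k p"
proof -
  have "- k - - p = - (k - p)" by simp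
  then show ?thesis unfolding coef_def by (simp only: v_dir_minus rvec_minus) simp
qed

lemma pairs_minus: "pairs (- k) = uminus ` pairs k"
proof -
  have *: "x \<in> pairs (- k) \<longleftrightarrow> - x \<in> pairs k" for x
    using uminus_in_M_set_iff[of "k + x"] by (simp add: pairs_def add.commute)
  show ?thesis
  proof (rule set_eqI)
    fix x
    have "- x \<in> pairs k \<longleftrightarrow> x \<in> uminus ` pairs k"
      by (metis (no_types, lifting) image_iff minus_minus)
    with * show "x \<in> pairs (- k) \<longleftrightarrow> x \<in> uminus ` pairs k" by simp
  qed
qed

text \<open>\<open>coef\<close> carries one derivative and is therefore odd when both frequencies
  change sign; together with the conjugate of i this preserves the reality condition.\<close>

lemma bil_cnj:
  assumes "\<And>p. p \<in> M_set \<Longrightarrow> c (- p) = cnj (c p)" "\<And>p. p \<in> M_set \<Longrightarrow> d (- p) = cnj (d p)"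
  shows "bil c d (- k) = cnj (bil c d k)"
proof -
  have "bil c d (- k) = (\<Sum>p\<in>pairs k. \<i> * coef (- k) (- p) * c (- p) * d (- k - - p))"
    unfolding bil_def pairs_minus by (subst sum.reindex) auto
  also have "\<dots> = (\<Sum>p\<in>pairs k. cnj (\<i> * coef k p * c p * d (k - p)))"
  proof (rule sum.cong[OF refl])
    fix p assume p: "p \<in> pairs k"
    have "- k - - p = - (k - p)" by simp
    then show "\<i> * coef (- k) (- p) * c (- p) * d (- k - - p) = cnj (\<i> * coef k p * c p * d (k - p))"
      using assms pairs_M_set[OF p] by (simp only: coef_minus) simp
  qed
  finally show ?thesis by (simp only: bil_def cnj_sum)
qed

lemma bil_continuous:
  assumes "k \<in> M_set" "\<And>p. p \<in> M_set \<Longrightarrow> continuous_on S (\<lambda>t. c t p)" "\<And>p. p \<in> M_set \<Longrightarrow> continuous_on S (\<lambda>t. d t p)"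
  shows "continuous_on S (\<lambda>t. bil (c t) (d t) k)"
  unfolding bil_def by (intro continuous_intros assms pairs_M_set) (auto simp: pairs_def)


subsection \<open>The truncated system\<close>

text \<open>\<open>alpha\<close> is the condition \<alpha> \<ge> ln 3 / (4 ln 2) of the theorem,
  doubled: dissipation of order 2\<alpha> at least matches the lam derivatives of the
  nonlinearity.\<close>

locale hypodissipative =
  fixes \<alpha> \<nu> s :: real
  assumes s_nonneg: "0 \<le> s" and alpha: "lam \<le> 2 * \<alpha>" and subcritical: "lam - 2 * \<alpha> < s" and nu: "0 < \<nu>"
begin

lemma alpha_pos: "0 < \<alpha>"
  using alpha lam_pos by linarith

definition rate :: "int^3 \<Rightarrow> real" where
  "rate k = \<nu> * laplace_symbol \<alpha> k"

lemma rate_ge: "k \<in> M_set \<Longrightarrow> \<nu> * freq k powr (2 * \<alpha>) \<le> rate k"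
  unfolding rate_def
proof (intro mult_left_mono)
  assume k: "k \<in> M_set"
  have "freq k \<le> 2 * pi * freq k"
    using mult_right_mono[of 1 "2 * pi" "freq k"] pi_gt3 freq_pos[OF k] by simp
  then show "freq k powr (2 * \<alpha>) \<le> laplace_symbol \<alpha> k"
    unfolding laplace_symbol_freq[OF k] using freq_pos[OF k] alpha_pos by (intro powr_mono2) auto
qed (use nu in auto)

lemma rate_pos: "k \<in> M_set \<Longrightarrow> 0 < rate k"
  using rate_ge[of k] nu freq_pos[of k] by (smt (verit) mult_pos_pos powr_gt_zero)

text \<open>Amplitudes of size |k|^(-s) give a quadratic term of size |k|^(lam - 2 s), and division
  by the rate |k|^(2\<alpha>) leaves |k|^(-s - gap): the gain of one Duhamel integral.\<close>

definition gap :: real where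
  "gap = s + 2 * \<alpha> - lam"

lemma gap_pos: "0 < gap"
  using subcritical by (simp add: gap_def)

text \<open>The exponent for \<open>interpolation_bound\<close>. The choice gives 2\<alpha> * theta
  \<le> gap / 2, so half of the gain remains as decay in k and the rest pays for the factor
  L^(-theta).\<close>

definition theta :: real where
  "theta = gap / (4 * \<alpha> + gap)"

lemma theta_bounds: "0 < theta" "theta < 1" "2 * \<alpha> * theta \<le> gap / 2"
proof -
  have p: "0 < 4 * \<alpha> + gap" using gap_pos alpha_pos by simp
  show "0 < theta" "theta < 1" using gap_pos alpha_pos p by (simp_all add: theta_def)
  have "2 * \<alpha> * gap \<le> gap / 2 * (4 * \<alpha> + gap)" using gap_pos by (simp add: algebra_simps)
  then show "2 * \<alpha> * theta \<le> gap / 2" using p by (simp add: theta_def divide_le_eq mult.commute)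
qed

text \<open>Subcriticality is the gain of \<open>gap / 2\<close> in the decay exponent together with the smallness for large \<open>L\<close>.\<close>

lemma duhamel_gain:
  assumes k: "k \<in> M_set" and g: "continuous_on {0..t} g" and L: "0 < L" and t: "0 \<le> t" and G: "0 \<le> G"
    and bound: "\<And>\<tau>. 0 \<le> \<tau> \<Longrightarrow> \<tau> \<le> t \<Longrightarrow> norm (g \<tau>) \<le> G * freq k powr (lam - 2 * s) * exp (L * \<tau>)"
  shows "norm (duhamel_int (rate k) g t)
    \<le> G * \<nu> powr (theta - 1) * L powr (- theta) * exp (L * t) * freq k powr (- s - gap / 2)"
proof -
  have f: "1 \<le> freq k" "0 < freq k" using freq_ge_1[OF k] by auto
  define H where "H = G * freq k powr (lam - 2 * s) * exp (L * t)"
  have H: "0 \<le> H" using G by (simp add: H_def)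
  have "norm (duhamel_int (rate k) g t) \<le> G * freq k powr (lam - 2 * s) * exp (L * t) / (rate k + L)"
    by (rule duhamel_int_bound[OF g rate_pos[OF k] L t bound]) (use G in auto)
  also have "\<dots> = H * (1 / (rate k + L))" by (simp add: H_def)
  also have "\<dots> \<le> H * (rate k powr (theta - 1) * L powr (- theta))"
    by (intro mult_left_mono H interpolation_bound rate_pos k L) (use theta_bounds in auto)
  also have "\<dots> \<le> H * ((\<nu> powr (theta - 1) * freq k powr (2 * \<alpha> * (theta - 1))) * L powr (- theta))"
  proof (intro mult_left_mono mult_right_mono H)
    have "rate k powr (theta - 1) \<le> (\<nu> * freq k powr (2 * \<alpha>)) powr (theta - 1)"
      by (rule powr_mono2') (use rate_ge[OF k] nu f theta_bounds in auto)
    also have "\<dots> = \<nu> powr (theta - 1) * freq k powr (2 * \<alpha> * (theta - 1))"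
      using nu f by (simp add: powr_mult powr_powr)
    finally show "rate k powr (theta - 1) \<le> \<nu> powr (theta - 1) * freq k powr (2 * \<alpha> * (theta - 1))" .
  qed auto
  also have "\<dots> = G * \<nu> powr (theta - 1) * L powr (- theta) * exp (L * t) *
      (freq k powr (lam - 2 * s) * freq k powr (2 * \<alpha> * (theta - 1)))"
    by (simp only: H_def mult_ac)
  also have "freq k powr (lam - 2 * s) * freq k powr (2 * \<alpha> * (theta - 1)) = freq k powr (lam - 2 * s + 2 * \<alpha> * (theta - 1))"
    by (simp flip: powr_add)
  also have "G * \<nu> powr (theta - 1) * L powr (- theta) * exp (L * t) * \<dots>
    \<le> G * \<nu> powr (theta - 1) * L powr (- theta) * exp (L * t) * freq k powr (- s - gap / 2)"
  proof (intro mult_left_mono powr_mono mult_nonneg_nonneg)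
    have "2 * \<alpha> * (theta - 1) = 2 * \<alpha> * theta - 2 * \<alpha>" by (simp add: right_diff_distrib)
    then show "lam - 2 * s + 2 * \<alpha> * (theta - 1) \<le> - s - gap / 2"
      using theta_bounds(3) gap_def by linarith
  qed (use f G in auto)
  finally show ?thesis .
qed

lemma cball_powr_nonempty: "0 \<le> R \<Longrightarrow> cball (0::complex) (R * x powr y) \<noteq> {}"
  using mult_nonneg_nonneg[of R "x powr y"] by (simp add: not_less)

text \<open>
  Projecting every mode to a ball makes the nonlinearity globally Lipschitz in the norm
  \<open>sup\<^sub>k \<bar>k\<bar>\<^sup>s \<bar>c\<^sub>k\<bar>\<close>, so that Picard iteration converges on the whole half line.
\<close>

definition trunc :: "real \<Rightarrow> int^3 \<Rightarrow> complex \<Rightarrow> complex" where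
  "trunc R k z = closest_point (cball 0 (R * freq k powr (- s))) z"

lemma trunc_ball:
  assumes "0 \<le> R" shows "norm (trunc R k z) \<le> R * freq k powr (- s)"
proof -
  have "trunc R k z \<in> cball 0 (R * freq k powr (- s))"
    unfolding trunc_def by (rule closest_point_in_set[OF closed_cball cball_powr_nonempty[OF assms]])
  then show ?thesis by simp
qed

lemma trunc_lipschitz:
  assumes "0 \<le> R" shows "norm (trunc R k z - trunc R k w) \<le> norm (z - w)"
  unfolding trunc_def dist_norm[symmetric]
  by (rule closest_point_lipschitz[OF convex_cball closed_cball cball_powr_nonempty[OF assms]])

lemma trunc_id: "norm z \<le> R * freq k powr (- s) \<Longrightarrow> trunc R k z = z"
  unfolding trunc_def by (rule closest_point_self) simp

text \<open>The ball is invariant under conjugation and nearest points are unique.\<close>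

lemma trunc_cnj:
  assumes "0 \<le> R" shows "trunc R (- k) (cnj z) = cnj (trunc R k z)"
proof -
  define S where "S = cball (0::complex) (R * freq k powr (- s))"
  have S: "closed S" "S \<noteq> {}" "convex S" using cball_powr_nonempty[OF assms] by (simp_all add: S_def)
  have cS: "cnj w \<in> S \<longleftrightarrow> w \<in> S" for w by (simp add: S_def)
  have "cnj (closest_point S z) = closest_point S (cnj z)"
  proof (rule closest_point_unique[OF S(3,1)])
    show "cnj (closest_point S z) \<in> S" using closest_point_in_set[OF S(1,2)] by (simp add: cS)
    show "\<forall>w\<in>S. dist (cnj z) (cnj (closest_point S z)) \<le> dist (cnj z) w"
    proof
      fix w assume "w \<in> S"
      then have "dist z (closest_point S z) \<le> dist z (cnj w)"
        by (intro closest_point_le S) (simp add: cS)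
      then show "dist (cnj z) (cnj (closest_point S z)) \<le> dist (cnj z) w"
        unfolding dist_norm by (metis complex_cnj_cnj complex_cnj_diff complex_mod_cnj)
    qed
  qed
  then show ?thesis by (simp add: trunc_def S_def)
qed

lemma trunc_continuous:
  assumes "0 \<le> R" "continuous_on S f" shows "continuous_on S (\<lambda>t. trunc R k (f t))"
proof -
  have "continuous_on UNIV (trunc R k)"
    unfolding trunc_def by (rule continuous_on_closest_point[OF convex_cball closed_cball cball_powr_nonempty[OF assms(1)]])
  from continuous_on_compose2[OF this assms(2)] show ?thesis by simp
qed

definition trunc_bil :: "real \<Rightarrow> (int^3 \<Rightarrow> complex) \<Rightarrow> int^3 \<Rightarrow> complex" where
  "trunc_bil R c k = bil (\<lambda>p. trunc R p (c p)) (\<lambda>p. trunc R p (c p)) k"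

lemma trunc_bil_bound:
  assumes "k \<in> M_set" "0 \<le> R"
  shows "norm (trunc_bil R c k) \<le> bil_const s * R * R * freq k powr (lam - 2 * s)"
  unfolding trunc_bil_def by (intro bil_bound assms s_nonneg trunc_ball)

text \<open>Bilinearity leaves one difference and one truncated argument in each term; truncation
  bounds the latter by R, so the Lipschitz constant is global and linear in R.\<close>

lemma trunc_bil_lipschitz:
  assumes k: "k \<in> M_set" and R: "0 \<le> R" and X: "0 \<le> X"
    and d: "\<And>p. p \<in> M_set \<Longrightarrow> norm (c p - d p) \<le> X * freq p powr (- s)"
  shows "norm (trunc_bil R c k - trunc_bil R d k) \<le> 2 * bil_const s * R * X * freq k powr (lam - 2 * s)"
proof -
  define u v where "u p = trunc R p (c p)" and "v p = trunc R p (d p)" for p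
  have uv: "norm (u p - v p) \<le> X * freq p powr (- s)" if "p \<in> M_set" for p
    unfolding u_def v_def using order_trans[OF trunc_lipschitz[OF R] d[OF that]] .
  have "norm (bil u u k - bil v v k) \<le> norm (bil (\<lambda>p. u p - v p) u k) + norm (bil v (\<lambda>p. u p - v p) k)"
    unfolding bil_diff[of u u k v v] by (rule norm_triangle_ineq)
  also have "\<dots> \<le> bil_const s * X * R * freq k powr (lam - 2 * s) + bil_const s * R * X * freq k powr (lam - 2 * s)"
    by (intro add_mono bil_bound k s_nonneg X R uv) (simp_all add: u_def v_def trunc_ball R)
  also have "\<dots> = 2 * bil_const s * R * X * freq k powr (lam - 2 * s)" by simp
  finally show ?thesis by (simp add: trunc_bil_def u_def [abs_def] v_def [abs_def])
qed

lemma trunc_bil_continuous: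
  assumes "k \<in> M_set" "0 \<le> R" "\<And>p. p \<in> M_set \<Longrightarrow> continuous_on S (\<lambda>t. c t p)"
  shows "continuous_on S (\<lambda>t. trunc_bil R (c t) k)"
  unfolding trunc_bil_def by (intro bil_continuous trunc_continuous assms)

lemma trunc_bil_eq:
  assumes "\<And>p. p \<in> M_set \<Longrightarrow> norm (c p) \<le> R * freq p powr (- s)"
  shows "trunc_bil R c k = bil c c k"
  unfolding trunc_bil_def bil_def
  by (intro sum.cong refl) (simp add: trunc_id[OF assms] pairs_M_set)

lemma trunc_bil_cnj:
  assumes "0 \<le> R" "\<And>p. p \<in> M_set \<Longrightarrow> c (- p) = cnj (c p)"
  shows "trunc_bil R c (- k) = cnj (trunc_bil R c k)"
  unfolding trunc_bil_def by (intro bil_cnj) (simp_all add: assms trunc_cnj)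

text \<open>The forcing g is kept apart from c, so that the truncated and the true equation, and the
  time shifts of both, are instances of one notion.\<close>

definition solves :: "(int^3 \<Rightarrow> complex) \<Rightarrow> (real \<Rightarrow> int^3 \<Rightarrow> complex) \<Rightarrow> (real \<Rightarrow> int^3 \<Rightarrow> complex) \<Rightarrow> real \<Rightarrow> bool" where
  "solves c0 g c T \<longleftrightarrow> (\<forall>k\<in>M_set. continuous_on {0..T} (\<lambda>t. c t k) \<and> continuous_on {0..T} (\<lambda>t. g t k) \<and>
     (\<forall>t\<in>{0..T}. c t k = exp (- rate k * t) *\<^sub>R c0 k - duhamel_int (rate k) (\<lambda>\<tau>. g \<tau> k) t))"

lemma solvesD:
  assumes "solves c0 g c T" "k \<in> M_set"
  shows "continuous_on {0..T} (\<lambda>t. c t k)" "continuous_on {0..T} (\<lambda>t. g t k)"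
    "\<And>t. 0 \<le> t \<Longrightarrow> t \<le> T \<Longrightarrow> c t k = exp (- rate k * t) *\<^sub>R c0 k - duhamel_int (rate k) (\<lambda>\<tau>. g \<tau> k) t"
  using assms by (auto simp: solves_def)

lemma solves_cong:
  assumes "solves c0 g c T" "\<And>t k. 0 \<le> t \<Longrightarrow> t \<le> T \<Longrightarrow> k \<in> M_set \<Longrightarrow> g t k = g' t k"
  shows "solves c0 g' c T"
  unfolding solves_def
proof (intro ballI conjI)
  fix k assume k: "k \<in> M_set"
  note D = solvesD[OF assms(1) k]
  show "continuous_on {0..T} (\<lambda>t. c t k)" by (rule D)
  show "continuous_on {0..T} (\<lambda>t. g' t k)"
    using D(2) by (rule continuous_on_eq) (use assms(2) k in auto)
  fix t assume t: "t \<in> {0..T}"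
  have "duhamel_int (rate k) (\<lambda>\<tau>. g \<tau> k) t = duhamel_int (rate k) (\<lambda>\<tau>. g' \<tau> k) t"
    by (rule duhamel_int_cong) (use assms(2) k t in auto)
  then show "c t k = exp (- rate k * t) *\<^sub>R c0 k - duhamel_int (rate k) (\<lambda>\<tau>. g' \<tau> k) t"
    using D(3) t by simp
qed

lemma solves_shift:
  assumes S: "solves c0 g c T" and r: "0 \<le> r" "r \<le> T"
  shows "solves (c r) (\<lambda>t. g (r + t)) (\<lambda>t. c (r + t)) (T - r)"
  unfolding solves_def
proof (intro ballI conjI)
  fix k assume k: "k \<in> M_set"
  note D = solvesD[OF S k]
  show "continuous_on {0..T - r} (\<lambda>t. c (r + t) k)" "continuous_on {0..T - r} (\<lambda>t. g (r + t) k)"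
    by (rule continuous_on_compose2[OF D(1)], (auto intro!: continuous_intros simp: r)[2],
        rule continuous_on_compose2[OF D(2)], (auto intro!: continuous_intros simp: r)[2])
  fix t assume t: "t \<in> {0..T - r}"
  have gc: "continuous_on {0..r + t} (\<lambda>\<tau>. g \<tau> k)"
    by (rule continuous_on_subset[OF D(2)]) (use t in auto)
  have "c (r + t) k = exp (- rate k * (r + t)) *\<^sub>R c0 k - duhamel_int (rate k) (\<lambda>\<tau>. g \<tau> k) (r + t)"
    by (rule D(3)) (use r t in auto)
  also have "\<dots> = exp (- rate k * t) *\<^sub>R (exp (- rate k * r) *\<^sub>R c0 k - duhamel_int (rate k) (\<lambda>\<tau>. g \<tau> k) r)
      - duhamel_int (rate k) (\<lambda>\<tau>. g (r + \<tau>) k) t"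
    using duhamel_int_split[OF gc r(1), of "rate k"] t
    by (simp add: scaleR_diff_right algebra_simps flip: exp_add)
  also have "exp (- rate k * r) *\<^sub>R c0 k - duhamel_int (rate k) (\<lambda>\<tau>. g \<tau> k) r = c r k"
    by (rule D(3)[symmetric]) (use r in auto)
  finally show "c (r + t) k = exp (- rate k * t) *\<^sub>R c r k - duhamel_int (rate k) (\<lambda>\<tau>. g (r + \<tau>) k) t" .
qed

section \<open>Contraction and Picard iteration\<close>

lemma contraction_constant:
  assumes "0 \<le> R"
  obtains L where "0 < L" "2 * bil_const s * R * \<nu> powr (theta - 1) * L powr (- theta) \<le> 1 / 2"
proof -
  \<comment> \<open>With L = K^(1/theta) the factor L^(-theta) becomes 1 / K; the summand 1 keeps K
    positive even for R = 0.\<close>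
  define K where "K = 4 * bil_const s * R * \<nu> powr (theta - 1) + 1"
  have K: "1 \<le> K" using assms bil_const_nonneg[of s] by (simp add: K_def)
  define L where "L = K powr (1 / theta)"
  have "L powr (- theta) = K powr (- 1)" using theta_bounds(1) by (simp add: L_def powr_powr)
  then have "L powr (- theta) = 1 / K" using K by (simp add: powr_minus_divide)
  then have "2 * bil_const s * R * \<nu> powr (theta - 1) * L powr (- theta) = ((K - 1) / 2) / K"
    by (simp add: K_def)
  also have "\<dots> \<le> 1 / 2" using K by (simp add: divide_le_eq)
  finally show ?thesis using that[of L] K by (simp add: L_def)
qed

lemma freq_powr_gap_le: "k \<in> M_set \<Longrightarrow> freq k powr (- s - gap / 2) \<le> freq k powr (- s)"
  using freq_ge_1[of k] gap_pos by (intro powr_mono) auto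

lemma duhamel_contraction:
  assumes k: "k \<in> M_set" and R: "0 \<le> R" and t: "0 \<le> t" and X: "0 \<le> X"
    and L: "0 < L" "2 * bil_const s * R * \<nu> powr (theta - 1) * L powr (- theta) \<le> 1 / 2"
    and cont: "\<And>p. p \<in> M_set \<Longrightarrow> continuous_on {0..t} (\<lambda>\<tau>. c \<tau> p)"
      "\<And>p. p \<in> M_set \<Longrightarrow> continuous_on {0..t} (\<lambda>\<tau>. d \<tau> p)"
    and diff: "\<And>\<tau> p. 0 \<le> \<tau> \<Longrightarrow> \<tau> \<le> t \<Longrightarrow> p \<in> M_set \<Longrightarrow> norm (c \<tau> p - d \<tau> p) \<le> X * freq p powr (- s) * exp (L * \<tau>)"
  shows "norm (duhamel_int (rate k) (\<lambda>\<tau>. trunc_bil R (c \<tau>) k) t - duhamel_int (rate k) (\<lambda>\<tau>. trunc_bil R (d \<tau>) k) t)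
    \<le> X / 2 * freq k powr (- s) * exp (L * t)"
proof -
  have cc: "continuous_on {0..t} (\<lambda>\<tau>. trunc_bil R (c \<tau>) k)" "continuous_on {0..t} (\<lambda>\<tau>. trunc_bil R (d \<tau>) k)"
    by (intro trunc_bil_continuous k R cont; assumption)+
  have "norm (duhamel_int (rate k) (\<lambda>\<tau>. trunc_bil R (c \<tau>) k - trunc_bil R (d \<tau>) k) t)
    \<le> (2 * bil_const s * R * X) * \<nu> powr (theta - 1) * L powr (- theta) * exp (L * t) * freq k powr (- s - gap / 2)"
  proof (rule duhamel_gain[OF k _ L(1) t])
    show "continuous_on {0..t} (\<lambda>\<tau>. trunc_bil R (c \<tau>) k - trunc_bil R (d \<tau>) k)"
      by (intro continuous_intros cc)
    show "0 \<le> 2 * bil_const s * R * X" using R X bil_const_nonneg by simp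
    fix \<tau> assume \<tau>: "0 \<le> \<tau>" "\<tau> \<le> t"
    have "norm (trunc_bil R (c \<tau>) k - trunc_bil R (d \<tau>) k) \<le> 2 * bil_const s * R * (X * exp (L * \<tau>)) * freq k powr (lam - 2 * s)"
      by (rule trunc_bil_lipschitz[OF k R]) (use X diff[OF \<tau>] in \<open>auto simp: mult_ac\<close>)
    then show "norm (trunc_bil R (c \<tau>) k - trunc_bil R (d \<tau>) k) \<le> 2 * bil_const s * R * X * freq k powr (lam - 2 * s) * exp (L * \<tau>)"
      by (simp only: mult_ac)
  qed
  also have "\<dots> = X * (2 * bil_const s * R * \<nu> powr (theta - 1) * L powr (- theta)) * exp (L * t) * freq k powr (- s - gap / 2)"
    by (simp only: mult_ac)
  also have "\<dots> \<le> X * (1 / 2) * exp (L * t) * freq k powr (- s)"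
    using R X L freq_powr_gap_le[OF k] bil_const_nonneg[of s] by (intro mult_mono) auto
  also have "\<dots> = X / 2 * freq k powr (- s) * exp (L * t)" by simp
  finally show ?thesis by (simp only: duhamel_int_diff[OF cc])
qed

text \<open>Truncation bounds the nonlinearity by a multiple of R^2 whatever c is. So the distance
  of a solution or an iterate from the free evolution is controlled, and this starts both iterations
  below.\<close>

lemma trunc_duhamel_bound:
  assumes k: "k \<in> M_set" and R: "0 \<le> R" and t: "0 \<le> t" and L: "0 < L"
    and cont: "\<And>p. p \<in> M_set \<Longrightarrow> continuous_on {0..t} (\<lambda>\<tau>. c \<tau> p)"
  shows "norm (duhamel_int (rate k) (\<lambda>\<tau>. trunc_bil R (c \<tau>) k) t)
    \<le> bil_const s * R * R * \<nu> powr (theta - 1) * L powr (- theta) * exp (L * t) * freq k powr (- s - gap / 2)"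
proof (rule duhamel_gain[OF k trunc_bil_continuous[OF k R cont] L t])
  show "0 \<le> bil_const s * R * R" using R bil_const_nonneg by simp
  fix \<tau> assume "0 \<le> \<tau>" "\<tau> \<le> t"
  have "norm (trunc_bil R (c \<tau>) k) \<le> bil_const s * R * R * freq k powr (lam - 2 * s)"
    by (rule trunc_bil_bound[OF k R])
  also have "\<dots> \<le> bil_const s * R * R * freq k powr (lam - 2 * s) * exp (L * \<tau>)"
    using L \<open>0 \<le> \<tau>\<close> R bil_const_nonneg mult_left_mono[of 1 "exp (L * \<tau>)" "bil_const s * R * R * freq k powr (lam - 2 * s)"] by simp
  finally show "norm (trunc_bil R (c \<tau>) k) \<le> bil_const s * R * R * freq k powr (lam - 2 * s) * exp (L * \<tau>)" .
qed

text \<open>The difference is below X0 in the weighted norm by \<open>trunc_duhamel_bound\<close>,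
  and each pass through the Duhamel formula halves the bound.\<close>

lemma trunc_unique:
  assumes c: "solves c0 (\<lambda>t. trunc_bil R (c t)) c T" and d: "solves c0 (\<lambda>t. trunc_bil R (d t)) d T"
    and R: "0 \<le> R" and t: "0 \<le> t" "t \<le> T" and k: "k \<in> M_set"
  shows "c t k = d t k"
proof -
  obtain L where L: "0 < L" "2 * bil_const s * R * \<nu> powr (theta - 1) * L powr (- theta) \<le> 1 / 2"
    using contraction_constant[OF R] .
  define X0 where "X0 = 2 * (bil_const s * R * R * \<nu> powr (theta - 1) * L powr (- theta))"
  have X0: "0 \<le> X0" using R bil_const_nonneg by (simp add: X0_def)
  have cont: "continuous_on {0..t} (\<lambda>\<tau>. c \<tau> p)" "continuous_on {0..t} (\<lambda>\<tau>. d \<tau> p)" if "p \<in> M_set" "t \<le> T" for p t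
    using solvesD(1)[OF c that(1)] solvesD(1)[OF d that(1)] that(2) by (auto intro: continuous_on_subset)
  have step: "\<forall>t p. 0 \<le> t \<longrightarrow> t \<le> T \<longrightarrow> p \<in> M_set \<longrightarrow> norm (c t p - d t p) \<le> X0 / 2 ^ n * freq p powr (- s) * exp (L * t)" for n
  proof (induction n)
    case 0
    show ?case
    proof (intro allI impI)
      fix t p assume t: "0 \<le> t" "t \<le> T" and p: "p \<in> M_set"
      have "c t p - d t p = duhamel_int (rate p) (\<lambda>\<tau>. trunc_bil R (d \<tau>) p) t - duhamel_int (rate p) (\<lambda>\<tau>. trunc_bil R (c \<tau>) p) t"
        using solvesD(3)[OF c p t] solvesD(3)[OF d p t] by simp
      also have "norm \<dots> \<le> X0 / 2 * exp (L * t) * freq p powr (- s - gap / 2) + X0 / 2 * exp (L * t) * freq p powr (- s - gap / 2)"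
        using trunc_duhamel_bound[OF p R t(1) L(1) cont(1)[OF _ t(2)]]
          trunc_duhamel_bound[OF p R t(1) L(1) cont(2)[OF _ t(2)]]
        unfolding X0_def by (intro order_trans[OF norm_triangle_ineq4] add_mono) auto
      also have "\<dots> = X0 * exp (L * t) * freq p powr (- s - gap / 2)" by simp
      also have "\<dots> \<le> X0 * exp (L * t) * freq p powr (- s)"
        by (intro mult_left_mono freq_powr_gap_le p) (use X0 in auto)
      finally show "norm (c t p - d t p) \<le> X0 / 2 ^ 0 * freq p powr (- s) * exp (L * t)"
        by (simp add: mult_ac)
    qed
  next
    case (Suc n)
    show ?case
    proof (intro allI impI)
      fix t p assume t: "0 \<le> t" "t \<le> T" and p: "p \<in> M_set"
      have "norm (c t p - d t p) = norm (duhamel_int (rate p) (\<lambda>\<tau>. trunc_bil R (c \<tau>) p) t - duhamel_int (rate p) (\<lambda>\<tau>. trunc_bil R (d \<tau>) p) t)"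
        using solvesD(3)[OF c p t] solvesD(3)[OF d p t] by (simp add: norm_minus_commute)
      also have "\<dots> \<le> X0 / 2 ^ n / 2 * freq p powr (- s) * exp (L * t)"
        by (rule duhamel_contraction[OF p R t(1) _ L])
           (use X0 Suc t in \<open>auto intro!: cont\<close>)
      finally show "norm (c t p - d t p) \<le> X0 / 2 ^ Suc n * freq p powr (- s) * exp (L * t)"
        by (simp add: mult.commute)
    qed
  qed
  have lim: "(\<lambda>n. X0 / 2 ^ n * freq k powr (- s) * exp (L * t)) \<longlonglongrightarrow> 0 * freq k powr (- s) * exp (L * t)"
  proof (intro tendsto_mult tendsto_const)
    have "(\<lambda>n. X0 * (1 / 2) ^ n) \<longlonglongrightarrow> X0 * 0" by (intro tendsto_mult_left LIMSEQ_power_zero) simp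
    then show "(\<lambda>n. X0 / 2 ^ n) \<longlonglongrightarrow> 0" by (simp add: power_divide)
  qed
  have "norm (c t k - d t k) \<le> 0"
    using tendsto_lowerbound[OF lim, of "norm (c t k - d t k)"] step t k by simp
  then show ?thesis by simp
qed

fun picard :: "real \<Rightarrow> (int^3 \<Rightarrow> complex) \<Rightarrow> nat \<Rightarrow> real \<Rightarrow> int^3 \<Rightarrow> complex" where
  "picard R c0 0 t k = exp (- rate k * t) *\<^sub>R c0 k"
| "picard R c0 (Suc n) t k = exp (- rate k * t) *\<^sub>R c0 k - duhamel_int (rate k) (\<lambda>\<tau>. trunc_bil R (picard R c0 n \<tau>) k) t"

lemma picard_continuous:
  assumes R: "0 \<le> R" shows "k \<in> M_set \<Longrightarrow> continuous_on {0..T} (\<lambda>t. picard R c0 n t k)"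
proof (induction n arbitrary: k)
  case 0
  show ?case by (simp, intro continuous_intros)
next
  case (Suc n)
  show ?case
    unfolding picard.simps
    by (intro continuous_intros duhamel_int_continuous trunc_bil_continuous R Suc)
qed

lemma picard_cnj:
  assumes R: "0 \<le> R" and c0: "\<And>k. k \<in> M_set \<Longrightarrow> c0 (- k) = cnj (c0 k)"
  shows "k \<in> M_set \<Longrightarrow> picard R c0 n t (- k) = cnj (picard R c0 n t k)"
proof (induction n arbitrary: k t)
  case 0
  have "rate (- k) = rate k" by (simp add: rate_def laplace_symbol_def rvec_minus)
  then show ?case using c0[OF 0] by simp
next
  case (Suc n)
  have r: "rate (- k) = rate k" by (simp add: rate_def laplace_symbol_def rvec_minus)
  have "trunc_bil R (picard R c0 n \<tau>) (- k) = cnj (trunc_bil R (picard R c0 n \<tau>) k)" for \<tau>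
    by (intro trunc_bil_cnj R Suc.IH)
  then have "duhamel_int (rate k) (\<lambda>\<tau>. trunc_bil R (picard R c0 n \<tau>) (- k)) t
     = integral {0..t} (\<lambda>\<tau>. cnj (exp (- rate k * (t - \<tau>)) *\<^sub>R trunc_bil R (picard R c0 n \<tau>) k))"
    unfolding duhamel_int_def by simp
  also have "\<dots> = cnj (duhamel_int (rate k) (\<lambda>\<tau>. trunc_bil R (picard R c0 n \<tau>) k) t)"
    unfolding duhamel_int_def by (rule integral_cnj[symmetric])
  finally show ?case unfolding picard.simps r using c0[OF Suc.prems] by simp
qed

text \<open>The weight exp (L t) lets one L serve all times, so the iterates converge on the whole
  half line, locally uniformly in t, and reality passes to the limit.\<close>

theorem trunc_exists:
  assumes R: "0 \<le> R" and c0: "\<And>k. k \<in> M_set \<Longrightarrow> c0 (- k) = cnj (c0 k)"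
  obtains c where "\<And>T. solves c0 (\<lambda>t. trunc_bil R (c t)) c T" "\<And>t k. 0 \<le> t \<Longrightarrow> k \<in> M_set \<Longrightarrow> c t (- k) = cnj (c t k)"
proof -
  obtain L where L: "0 < L" "2 * bil_const s * R * \<nu> powr (theta - 1) * L powr (- theta) \<le> 1 / 2"
    using contraction_constant[OF R] .
  let ?P = "picard R c0"
  define X0 where "X0 = bil_const s * R * R * \<nu> powr (theta - 1) * L powr (- theta)"
  have X0: "0 \<le> X0" using R bil_const_nonneg by (simp add: X0_def)
  have step: "0 \<le> t \<Longrightarrow> p \<in> M_set \<Longrightarrow> norm (?P (Suc n) t p - ?P n t p) \<le> X0 / 2 ^ n * freq p powr (- s) * exp (L * t)" for n t p
  proof (induction n arbitrary: t p)
    case 0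
    have "norm (?P (Suc 0) t p - ?P 0 t p) = norm (duhamel_int (rate p) (\<lambda>\<tau>. trunc_bil R (?P 0 \<tau>) p) t)" by simp
    also have "\<dots> \<le> X0 * exp (L * t) * freq p powr (- s - gap / 2)"
      unfolding X0_def by (intro trunc_duhamel_bound 0 R L picard_continuous)
    also have "\<dots> \<le> X0 * exp (L * t) * freq p powr (- s)"
      by (intro mult_left_mono freq_powr_gap_le 0) (use X0 in auto)
    finally show ?case by (simp add: mult_ac)
  next
    case (Suc n)
    have "norm (?P (Suc (Suc n)) t p - ?P (Suc n) t p)
      = norm (duhamel_int (rate p) (\<lambda>\<tau>. trunc_bil R (?P (Suc n) \<tau>) p) t - duhamel_int (rate p) (\<lambda>\<tau>. trunc_bil R (?P n \<tau>) p) t)"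
      unfolding picard.simps(2)[of R c0 "Suc n"] picard.simps(2)[of R c0 n t] by (simp only: norm_minus_commute) (simp add: norm_minus_commute)
    also have "\<dots> \<le> X0 / 2 ^ n / 2 * freq p powr (- s) * exp (L * t)"
      by (intro duhamel_contraction Suc R L picard_continuous divide_nonneg_nonneg X0) auto
    finally show ?case by (simp add: mult.commute)
  qed
  define c where "c t k = lim (\<lambda>n. ?P n t k)" for t k
  have step': "norm (?P (Suc n) t p - ?P n t p) \<le> X0 * freq p powr (- s) * exp (L * t) / 2 ^ n" if "0 \<le> t" "p \<in> M_set" for t p n
    using step[OF that, of n] by simp
  have conv: "(\<lambda>n. ?P n t p) \<longlonglongrightarrow> c t p" if "0 \<le> t" "p \<in> M_set" for t p
    using geometric_limit(1)[OF step'[OF that]] by (simp add: c_def convergent_LIMSEQ_iff)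
  have close: "norm (?P n t p - c t p) \<le> 2 * X0 / 2 ^ n * freq p powr (- s) * exp (L * t)" if "0 \<le> t" "p \<in> M_set" for t p n
    using geometric_limit(2)[OF step'[OF that], of n] by (simp add: c_def mult_ac)
  have zero: "(\<lambda>n. 2 * X0 / 2 ^ n * F) \<longlonglongrightarrow> 0" for F :: real
  proof -
    have "(\<lambda>n. (2 * X0 * F) * (1 / 2) ^ n) \<longlonglongrightarrow> (2 * X0 * F) * 0"
      by (intro tendsto_mult_left LIMSEQ_power_zero) simp
    then show ?thesis by (simp add: power_divide mult_ac)
  qed
  have cont: "continuous_on {0..T} (\<lambda>t. c t p)" if p: "p \<in> M_set" for T p
  proof (rule uniform_limit_theorem[OF _ _ trivial_limit_sequentially])
    show "\<forall>\<^sub>F n in sequentially. continuous_on {0..T} (\<lambda>t. ?P n t p)"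
      by (intro always_eventually allI picard_continuous R p)
    show "uniform_limit {0..T} (\<lambda>n t. ?P n t p) (\<lambda>t. c t p) sequentially"
    proof (rule uniform_limitI)
      fix e :: real assume "0 < e"
      from order_tendstoD(2)[OF zero this, of "freq p powr (- s) * exp (L * T)"]
      show "\<forall>\<^sub>F n in sequentially. \<forall>t\<in>{0..T}. dist (?P n t p) (c t p) < e"
      proof eventually_elim
        case (elim n)
        show ?case
        proof
          fix t assume t: "t \<in> {0..T}"
          have "norm (?P n t p - c t p) \<le> 2 * X0 / 2 ^ n * freq p powr (- s) * exp (L * t)"
            by (rule close) (use t p in auto)
          also have "\<dots> \<le> 2 * X0 / 2 ^ n * freq p powr (- s) * exp (L * T)"
            using t L X0 by (intro mult_left_mono) auto
          finally show "dist (?P n t p) (c t p) < e" using elim by (simp add: dist_norm mult.assoc)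
        qed
      qed
    qed
  qed
  have eq: "c t k = exp (- rate k * t) *\<^sub>R c0 k - duhamel_int (rate k) (\<lambda>\<tau>. trunc_bil R (c \<tau>) k) t"
    if t: "0 \<le> t" and k: "k \<in> M_set" for t k
  proof -
    \<comment> \<open>The Duhamel terms converge by \<open>duhamel_contraction\<close>, applied to
      an iterate and the limit.\<close>
    have "(\<lambda>n. duhamel_int (rate k) (\<lambda>\<tau>. trunc_bil R (?P n \<tau>) k) t) \<longlonglongrightarrow> duhamel_int (rate k) (\<lambda>\<tau>. trunc_bil R (c \<tau>) k) t"
    proof (rule Lim_transform2[OF tendsto_const])
      show "(\<lambda>n. duhamel_int (rate k) (\<lambda>\<tau>. trunc_bil R (c \<tau>) k) t - duhamel_int (rate k) (\<lambda>\<tau>. trunc_bil R (?P n \<tau>) k) t) \<longlonglongrightarrow> 0"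
      proof (rule Lim_null_comparison[OF always_eventually zero[of "1/2 * freq k powr (- s) * exp (L * t)"]], rule allI)
        fix n
        have "norm (duhamel_int (rate k) (\<lambda>\<tau>. trunc_bil R (?P n \<tau>) k) t - duhamel_int (rate k) (\<lambda>\<tau>. trunc_bil R (c \<tau>) k) t)
          \<le> 2 * X0 / 2 ^ n / 2 * freq k powr (- s) * exp (L * t)"
          by (rule duhamel_contraction[OF k R t _ L])
             (use X0 close in \<open>auto intro!: cont picard_continuous R\<close>)
        then show "norm (duhamel_int (rate k) (\<lambda>\<tau>. trunc_bil R (c \<tau>) k) t - duhamel_int (rate k) (\<lambda>\<tau>. trunc_bil R (?P n \<tau>) k) t)
          \<le> 2 * X0 / 2 ^ n * (1/2 * freq k powr (- s) * exp (L * t))"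
          by (simp add: norm_minus_commute)
      qed
    qed
    then have "(\<lambda>n. ?P (Suc n) t k) \<longlonglongrightarrow> exp (- rate k * t) *\<^sub>R c0 k - duhamel_int (rate k) (\<lambda>\<tau>. trunc_bil R (c \<tau>) k) t"
      unfolding picard.simps by (intro tendsto_intros)
    then show ?thesis
      using LIMSEQ_unique LIMSEQ_Suc[OF conv[OF t k]] by blast
  qed
  have "solves c0 (\<lambda>t. trunc_bil R (c t)) c T" for T
    unfolding solves_def by (intro ballI conjI cont trunc_bil_continuous R eq) auto
  moreover have "c t (- k) = cnj (c t k)" if "0 \<le> t" "k \<in> M_set" for t k
  proof -
    have "?P n t (- k) = cnj (?P n t k)" for n
      by (rule picard_cnj) (use R c0 that in auto)
    then have "(\<lambda>n. ?P n t (- k)) \<longlonglongrightarrow> cnj (c t k)"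
      by (simp only:) (intro tendsto_cnj conv that)
    then show ?thesis using LIMSEQ_unique conv[of t "- k"] that by simp
  qed
  ultimately show ?thesis using that by blast
qed

end


subsection \<open>Sums over triads\<close>

text \<open>Enumerating an infinite countable index set turns the unordered sum into a series, where
  the tails of the majorant B bound the remainders of the derivatives uniformly on S.\<close>

lemma has_derivative_infsum:
  fixes f :: "'i \<Rightarrow> 'a::real_normed_vector \<Rightarrow> 'b::banach"
  assumes I: "countable I" and S: "convex S" "open S"
    and d: "\<And>k x. k \<in> I \<Longrightarrow> x \<in> S \<Longrightarrow> (f k has_derivative f' k x) (at x)"
    and b: "\<And>k x h. k \<in> I \<Longrightarrow> x \<in> S \<Longrightarrow> norm (f' k x h) \<le> B k * norm h"
    and B: "B summable_on I"
    and s: "\<And>x. x \<in> S \<Longrightarrow> (\<lambda>k. f k x) summable_on I"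
    and x: "x \<in> S"
  shows "((\<lambda>x. \<Sum>\<^sub>\<infinity>k\<in>I. f k x) has_derivative (\<lambda>h. \<Sum>\<^sub>\<infinity>k\<in>I. f' k x h)) (at x)"
proof (cases "finite I")
  case True
  then show ?thesis using d x by (simp add: has_derivative_sum)
next
  case False
  define e where "e = from_nat_into I"
  have e: "bij_betw e UNIV I" unfolding e_def by (rule bij_betw_from_nat_into[OF I False])
  have eI: "e i \<in> I" for i using e by (auto simp: bij_betw_def)
  have sums: "(\<lambda>i. g (e i)) sums infsum g I" if "g summable_on I" for g :: "'i \<Rightarrow> 'c::banach"
    using has_sum_infsum[OF that] by (intro has_sum_imp_sums) (simp only: has_sum_reindex_bij_betw[OF e])
  have f's: "(\<lambda>k. f' k y h) summable_on I" if "y \<in> S" for y h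
  proof (rule Infinite_Sum.abs_summable_summable, rule Infinite_Sum.abs_summable_on_comparison_test')
    show "(\<lambda>k. B k * norm h) summable_on I" by (rule summable_on_cmult_left[OF B])
  qed (use b that in auto)
  have "\<exists>g. \<forall>x\<in>S. (\<lambda>i. f (e i) x) sums (g x) \<and> (g has_derivative (\<lambda>h. \<Sum>\<^sub>\<infinity>k\<in>I. f' k x h)) (at x within S)"
  proof (rule has_derivative_series[where f = "\<lambda>i. f (e i)" and f' = "\<lambda>i. f' (e i)"
        and g' = "\<lambda>y h. \<Sum>\<^sub>\<infinity>k\<in>I. f' k y h", OF S(1) _ _ x sums[OF s[OF x]]])
    show "(f (e i) has_derivative f' (e i) y) (at y within S)" if "y \<in> S" for i y
      using d[OF eI that] by (rule has_derivative_at_withinI)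
    fix r :: real assume r: "0 < r"
    have Bs: "(\<lambda>i. B (e i)) sums infsum B I" by (rule sums[OF B])
    then have "(\<lambda>n. infsum B I - (\<Sum>i<n. B (e i))) \<longlonglongrightarrow> infsum B I - infsum B I"
      unfolding sums_def by (intro tendsto_intros)
    then have "\<forall>\<^sub>F n in sequentially. infsum B I - (\<Sum>i<n. B (e i)) < r"
      using r by (intro order_tendstoD(2)) auto
    then show "\<forall>\<^sub>F n in sequentially. \<forall>x\<in>S. \<forall>h. norm ((\<Sum>i<n. f' (e i) x h) - (\<Sum>\<^sub>\<infinity>k\<in>I. f' k x h)) \<le> r * norm h"
    proof eventually_elim
      case (elim n)
      show ?case
      proof (intro ballI allI)
        fix y h assume y: "y \<in> S"
        have F: "(\<lambda>i. f' (e (i + n)) y h) sums ((\<Sum>\<^sub>\<infinity>k\<in>I. f' k y h) - (\<Sum>i<n. f' (e i) y h))"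
          by (rule sums_split_initial_segment[OF sums[OF f's[OF y]]])
        have G: "(\<lambda>i. B (e (i + n)) * norm h) sums ((infsum B I - (\<Sum>i<n. B (e i))) * norm h)"
          by (intro sums_mult2 sums_split_initial_segment Bs)
        have "norm (suminf (\<lambda>i. f' (e (i + n)) y h)) \<le> suminf (\<lambda>i. B (e (i + n)) * norm h)"
          by (rule norm_suminf_le[OF b[OF eI y] sums_summable[OF G]])
        also have "\<dots> \<le> r * norm h"
          unfolding sums_unique[OF G, symmetric] using elim by (intro mult_right_mono) auto
        finally show "norm ((\<Sum>i<n. f' (e i) y h) - (\<Sum>\<^sub>\<infinity>k\<in>I. f' k y h)) \<le> r * norm h"
          unfolding sums_unique[OF F, symmetric] by (simp only: norm_minus_commute)
      qed
    qed
  qed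
  then obtain g where g: "\<And>x. x \<in> S \<Longrightarrow> (\<lambda>i. f (e i) x) sums g x"
    "\<And>x. x \<in> S \<Longrightarrow> (g has_derivative (\<lambda>h. \<Sum>\<^sub>\<infinity>k\<in>I. f' k x h)) (at x within S)" by blast
  have eq: "g y = (\<Sum>\<^sub>\<infinity>k\<in>I. f k y)" if "y \<in> S" for y
    using g(1)[OF that] sums[OF s[OF that]] by (rule sums_unique2)
  have "(g has_derivative (\<lambda>h. \<Sum>\<^sub>\<infinity>k\<in>I. f' k x h)) (at x)"
    using g(2)[OF x] by (simp only: at_within_open[OF x S(2)])
  then show ?thesis
    by (rule has_derivative_transform_within_open[OF _ S(2) x]) (rule eq)
qed

lemma has_real_derivative_infsum:
  fixes f :: "'i \<Rightarrow> real \<Rightarrow> real"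
  assumes I: "countable I"
    and d: "\<And>k x. k \<in> I \<Longrightarrow> x \<in> {a<..<b} \<Longrightarrow> (f k has_real_derivative f' k x) (at x)"
    and bd: "\<And>k x. k \<in> I \<Longrightarrow> x \<in> {a<..<b} \<Longrightarrow> \<bar>f' k x\<bar> \<le> B k"
    and B: "B summable_on I"
    and s: "\<And>x. x \<in> {a<..<b} \<Longrightarrow> (\<lambda>k. f k x) summable_on I"
    and x: "x \<in> {a<..<b}"
  shows "((\<lambda>x. \<Sum>\<^sub>\<infinity>k\<in>I. f k x) has_real_derivative (\<Sum>\<^sub>\<infinity>k\<in>I. f' k x)) (at x)"
proof -
  have "((\<lambda>x. \<Sum>\<^sub>\<infinity>k\<in>I. f k x) has_derivative (\<lambda>h. \<Sum>\<^sub>\<infinity>k\<in>I. f' k x * h)) (at x)"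
  proof (rule has_derivative_infsum[OF I _ _ _ _ B s x])
    show "(f k has_derivative (*) (f' k y)) (at y)" if "k \<in> I" "y \<in> {a<..<b}" for k y
      using d[OF that] by (simp add: has_field_derivative_def)
    show "norm (f' k y * h) \<le> B k * norm h" if "k \<in> I" "y \<in> {a<..<b}" for k y h
      using bd[OF that] by (simp add: abs_mult mult_right_mono)
  qed auto
  then show ?thesis by (simp only: has_field_derivative_def infsum_cmult_left')
qed

lemma continuous_on_infsum:
  fixes f :: "'i \<Rightarrow> 'a::topological_space \<Rightarrow> 'b::banach"
  assumes "\<And>k. k \<in> I \<Longrightarrow> continuous_on S (f k)"
    and "\<And>k x. k \<in> I \<Longrightarrow> x \<in> S \<Longrightarrow> norm (f k x) \<le> B k" and "B summable_on I"
  shows "continuous_on S (\<lambda>x. \<Sum>\<^sub>\<infinity>k\<in>I. f k x)"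
proof (rule uniform_limit_theorem[OF _ Weierstrass_m_test_general[OF assms(2,3)]])
  show "\<forall>\<^sub>F F in finite_subsets_at_top I. continuous_on S (\<lambda>x. \<Sum>k\<in>F. f k x)"
    by (rule eventually_finite_subsets_at_top_weakI) (intro continuous_on_sum assms(1), blast)
qed auto

lemma countable_M_set: "countable M_set"
  by (rule countable_subset[of _ UNIV]) auto

lemma summable_M_set:
  fixes f :: "int^3 \<Rightarrow> 'a::banach"
  assumes "0 < e" "\<And>k. k \<in> M_set \<Longrightarrow> norm (f k) \<le> C * freq k powr (- e)"
  shows "f summable_on M_set"
  by (rule Infinite_Sum.abs_summable_summable, rule Infinite_Sum.abs_summable_on_comparison_test'[OF summable_on_cmult_right[OF summable_freq_powr[OF assms(1)]]])
     (rule assms(2))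

lemma laplace_symbol_split:
  "k \<in> M_set \<Longrightarrow> laplace_symbol b k = (2 * pi) powr (2 * b) * freq k powr (2 * b)"
  by (simp add: laplace_symbol_freq powr_mult freq_def)

lemma laplace_symbol_nonneg: "0 \<le> laplace_symbol b k"
  by (simp add: laplace_symbol_def)

lemma two_pi_freq_ge_1: "k \<in> M_set \<Longrightarrow> 1 \<le> 2 * pi * freq k"
  using mult_mono[of 1 "2 * pi" 1 "freq k"] freq_ge_1[of k] pi_gt3 by simp

definition triads :: "((int^3) \<times> (int^3)) set" where
  "triads = Sigma M_set pairs"

text \<open>The symmetry \<open>(p, q, -k) \<mapsto> (p, -k, q)\<close> of the triads \<open>p + q - k = 0\<close>.\<close>

lemma triad_flip: "bij_betw (\<lambda>(k, p). (p - k, p)) triads triads"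
proof -
  have "(p - k, p) \<in> triads" if "(k, p) \<in> triads" for k p
    using that uminus_in_M_set_iff[of "k - p"] uminus_in_M_set_iff[of k] by (simp add: triads_def pairs_def)
  then show ?thesis
    by (intro bij_betw_byWitness[where f' = "\<lambda>(k, p). (p - k, p)"]) auto
qed

text \<open>The fibre of the triads over a fixed k has at most 324 elements.\<close>

lemma triads_summable:
  fixes h :: "int^3 \<Rightarrow> real"
  assumes h: "h summable_on M_set" "\<And>k. k \<in> M_set \<Longrightarrow> 0 \<le> h k"
  shows "(\<lambda>(k, p). h k) summable_on triads" "infsum (\<lambda>(k, p). h k) triads \<le> 324 * infsum h M_set"
proof -
  have card: "real (card (pairs k)) * h k \<le> 324 * h k" if "k \<in> M_set" for k
    using pairs_card(2)[OF that] h(2)[OF that] by (intro mult_right_mono) auto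
  have s: "(\<lambda>k. real (card (pairs k)) * h k) summable_on M_set"
    by (rule summable_on_comparison_test[OF summable_on_cmult_right[OF h(1), of 324]]) (use card h in auto)
  show T: "(\<lambda>(k, p). h k) summable_on triads"
    unfolding triads_def
  proof (rule summable_on_SigmaI[OF _ s])
    show "((\<lambda>p. case (k, p) of (k, p) \<Rightarrow> h k) has_sum real (card (pairs k)) * h k) (pairs k)" if "k \<in> M_set" for k
      using has_sum_finite[OF pairs_card(1)[OF that], of "\<lambda>p. h k"] by simp
  qed (use h in auto)
  have "infsum (\<lambda>(k, p). h k) triads = (\<Sum>\<^sub>\<infinity>k\<in>M_set. \<Sum>\<^sub>\<infinity>p\<in>pairs k. h k)"
    using infsum_Sigma'_banach[of "\<lambda>k p. h k" M_set pairs] T by (simp add: triads_def)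
  also have "\<dots> = (\<Sum>\<^sub>\<infinity>k\<in>M_set. real (card (pairs k)) * h k)"
    by (rule infsum_cong) (simp add: pairs_card)
  also have "\<dots> \<le> (\<Sum>\<^sub>\<infinity>k\<in>M_set. 324 * h k)"
    by (rule infsum_mono[OF s summable_on_cmult_right[OF h(1)] card])
  also have "\<dots> = 324 * infsum h M_set" by (rule infsum_cmult_right')
  finally show "infsum (\<lambda>(k, p). h k) triads \<le> 324 * infsum h M_set" .
qed

text \<open>The flip turns the leg k - p, up to sign, into the first component, so an even weight on
  that leg has the same sum as the weight on k.\<close>

lemma triads_summable_flip:
  fixes h :: "int^3 \<Rightarrow> real"
  assumes h: "h summable_on M_set" "\<And>k. k \<in> M_set \<Longrightarrow> 0 \<le> h k" "\<And>k. k \<in> M_set \<Longrightarrow> h (- k) = h k"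
  shows "(\<lambda>(k, p). h (k - p)) summable_on triads" "infsum (\<lambda>(k, p). h (k - p)) triads \<le> 324 * infsum h M_set"
proof -
  have eq: "h (k - p) = h (p - k)" if "(k, p) \<in> triads" for k p
    using h(3)[of "k - p"] that by (simp add: triads_def pairs_def)
  have 1: "(\<lambda>(k, p). h (p - k)) summable_on triads \<longleftrightarrow> (\<lambda>(k, p). h k) summable_on triads"
    using summable_on_reindex_bij_betw[OF triad_flip, of "\<lambda>(k, p). h k"] by (simp add: case_prod_unfold)
  have 2: "infsum (\<lambda>(k, p). h (p - k)) triads = infsum (\<lambda>(k, p). h k) triads"
    using infsum_reindex_bij_betw[OF triad_flip, of "\<lambda>(k, p). h k"] by (simp add: case_prod_unfold)
  have 3: "(\<lambda>(k, p). h (k - p)) summable_on triads \<longleftrightarrow> (\<lambda>(k, p). h (p - k)) summable_on triads"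
    by (rule summable_on_cong) (auto split: prod.split intro: eq)
  have 4: "infsum (\<lambda>(k, p). h (k - p)) triads = infsum (\<lambda>(k, p). h (p - k)) triads"
    by (rule infsum_cong) (auto split: prod.split intro: eq)
  show "(\<lambda>(k, p). h (k - p)) summable_on triads" "infsum (\<lambda>(k, p). h (k - p)) triads \<le> 324 * infsum h M_set"
    using triads_summable[OF h(1,2)] by (simp_all add: 1 2 3 4)
qed

text \<open>Since p is orthogonal to v^p, the factor k . v^p changes sign when k becomes p - k,
  while the product of the other two directions is symmetric. This is the Fourier form of the mean
  of (u . \<nabla>)u . u being zero.\<close>

lemma coef_flip:
  assumes "k \<in> M_set" "p \<in> pairs k" shows "coef (p - k) p = - coef k p"
proof -
  have "rvec p \<bullet> v_dir p = 0"
    by (rule inner_v_dir_self[OF M_set_nonzero]) (use assms in \<open>simp add: pairs_def\<close>)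
  then have "rvec (p - k) \<bullet> v_dir p = - (rvec k \<bullet> v_dir p)"
    by (simp add: rvec_diff inner_diff_left)
  moreover have "v_dir (p - k) = v_dir (k - p)" "v_dir (p - k - p) = v_dir k"
    using v_dir_minus[of "k - p"] v_dir_minus[of k] by simp_all
  ultimately show ?thesis
    by (simp only: coef_def) (simp add: inner_commute)
qed

text \<open>Energy conservation of the nonlinearity: the coefficients are antisymmetric under the flip.\<close>

lemma bil_energy_zero:
  assumes real: "\<And>k. k \<in> M_set \<Longrightarrow> c (- k) = cnj (c k)"
    and decay: "\<And>k. k \<in> M_set \<Longrightarrow> norm (c k) \<le> A * freq k powr (- r)" and r: "lam + 1 \<le> r" and A: "0 \<le> A"
  shows "(\<Sum>\<^sub>\<infinity>k\<in>M_set. c k \<bullet> bil c c k) = 0"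
proof -
  define z where "z = (\<lambda>(k, p). Re (\<i> * coef k p * c p * c (k - p) * cnj (c k)))"
  have flip: "z (case x of (k, p) \<Rightarrow> (p - k, p)) = - z x" if x: "x \<in> triads" for x
  proof -
    obtain k p where kp: "x = (k, p)" "k \<in> M_set" "p \<in> pairs k" using x by (auto simp: triads_def)
    have "c (p - k - p) = cnj (c k)" "c (p - k) = cnj (c (k - p))"
      using real[OF kp(2)] real[OF pairs_M_set(2)[OF kp(3)]] by simp_all
    then show ?thesis unfolding kp z_def by (simp add: coef_flip[OF kp(2,3)] algebra_simps)
  qed
  have "infsum z triads = infsum (\<lambda>x. z (case x of (k, p) \<Rightarrow> (p - k, p))) triads"
    by (rule infsum_reindex_bij_betw[OF triad_flip, symmetric])
  also have "\<dots> = infsum (\<lambda>x. - z x) triads" by (rule infsum_cong) (rule flip)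
  also have "\<dots> = - infsum z triads" by (rule infsum_uminus)
  finally have zero: "infsum z triads = 0" by simp
  have r0: "0 \<le> r" using r lam_pos by linarith
  \<comment> \<open>A summable majorant, used to return from the triads to the iterated sum: the
    coefficient and one amplitude contribute |k|^(lam - r) \<le> |k|^(-1), the other two amplitudes
    are bounded by A.\<close>
  define h where "h k = 128 * A * A * A * 6 powr r * freq k powr (- 1)" for k
  have "h summable_on M_set" unfolding h_def
    by (intro summable_on_cmult_right summable_freq_powr) simp
  then have hs: "(\<lambda>(k, p). h k) summable_on triads"
    by (rule triads_summable) (use A in \<open>simp add: h_def\<close>)
  have zb: "norm (z x) \<le> (case x of (k, p) \<Rightarrow> h k)" if x: "x \<in> triads" for x
  proof -
    obtain k p where kp: "x = (k, p)" "k \<in> M_set" "p \<in> pairs k" using x by (auto simp: triads_def)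
    have f: "1 \<le> freq k" "1 \<le> freq (k - p)" using freq_ge_1 kp pairs_M_set by blast+
    have c1: "norm (c p) \<le> A * (6 powr r * freq k powr (- r))"
      using decay[OF pairs_M_set(1)[OF kp(3)]] mult_left_mono[OF freq_powr_neg_triad[OF kp(2,3) r0, of p k] A] by simp
    have "freq j powr (- r) \<le> 1" if "1 \<le> freq j" for j
      using that r0 powr_mono[of "- r" 0 "freq j"] by simp
    then have "norm (c j) \<le> A" if "j \<in> M_set" for j
      using decay[OF that] mult_left_mono[of "freq j powr (- r)" 1 A] A freq_ge_1[OF that] by fastforce
    then have c2: "norm (c (k - p)) \<le> A" "norm (c k) \<le> A" using kp pairs_M_set by blast+
    have "norm (z x) \<le> \<bar>coef k p\<bar> * norm (c p) * norm (c (k - p)) * norm (c k)"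
      unfolding kp z_def using abs_Re_le_cmod[of "\<i> * coef k p * c p * c (k - p) * cnj (c k)"] by (simp add: norm_mult)
    also have "\<dots> \<le> (128 * freq k powr lam) * (A * (6 powr r * freq k powr (- r))) * A * A"
      using A f by (intro mult_mono c1 c2 coef_bound kp) auto
    also have "\<dots> = 128 * A * A * A * 6 powr r * (freq k powr lam * freq k powr (- r))" by simp
    also have "freq k powr lam * freq k powr (- r) = freq k powr (lam - r)" by (simp flip: powr_add)
    also have "128 * A * A * A * 6 powr r * freq k powr (lam - r) \<le> h k"
      unfolding h_def using f r A by (intro mult_left_mono powr_mono) auto
    finally show ?thesis unfolding kp by simp
  qed
  have "z summable_on triads"
    by (rule Infinite_Sum.abs_summable_summable, rule Infinite_Sum.abs_summable_on_comparison_test'[OF hs zb])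
  then have "infsum z triads = (\<Sum>\<^sub>\<infinity>k\<in>M_set. \<Sum>\<^sub>\<infinity>p\<in>pairs k. z (k, p))"
    unfolding triads_def by (rule infsum_Sigma_banach[symmetric])
  also have "\<dots> = (\<Sum>\<^sub>\<infinity>k\<in>M_set. c k \<bullet> bil c c k)"
  proof (rule infsum_cong)
    fix k assume k: "k \<in> M_set"
    have "c k \<bullet> bil c c k = Re (bil c c k * cnj (c k))" by (simp add: inner_complex_def)
    also have "\<dots> = (\<Sum>p\<in>pairs k. z (k, p))"
      by (simp add: bil_def sum_distrib_right z_def)
    finally show "(\<Sum>\<^sub>\<infinity>p\<in>pairs k. z (k, p)) = c k \<bullet> bil c c k" using pairs_card(1)[OF k] by simp
  qed
  finally show ?thesis using zero by simp
qed


subsection \<open>Smoothing\<close>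

locale bounded_solution = hypodissipative +
  fixes c0 :: "int^3 \<Rightarrow> complex" and c :: "real \<Rightarrow> int^3 \<Rightarrow> complex" and T A :: real
  assumes T: "0 < T" and A: "0 \<le> A"
    and sol: "solves c0 (\<lambda>t. bil (c t) (c t)) c T"
    and bound: "\<And>t k. 0 \<le> t \<Longrightarrow> t \<le> T \<Longrightarrow> k \<in> M_set \<Longrightarrow> norm (c t k) \<le> A * freq k powr (- s)"
begin

lemma c_zero: "k \<in> M_set \<Longrightarrow> c 0 k = c0 k"
  using solvesD(3)[OF sol, of k 0] T by (simp add: duhamel_int_def)

lemma c_continuous: "k \<in> M_set \<Longrightarrow> continuous_on {0..T} (\<lambda>t. c t k)"
  by (rule solvesD(1)[OF sol])

lemma c_has_derivative:
  assumes t: "0 < t" "t < T" and k: "k \<in> M_set"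
  shows "((\<lambda>t. c t k) has_vector_derivative - rate k *\<^sub>R c t k - bil (c t) (c t) k) (at t)"
proof -
  have eq: "c u k = exp (- rate k * u) *\<^sub>R c0 k - duhamel_int (rate k) (\<lambda>\<tau>. bil (c \<tau>) (c \<tau>) k) u" if "u \<in> {0..T}" for u
    using solvesD(3)[OF sol k] that by simp
  have "((\<lambda>u. exp (- rate k * u) *\<^sub>R c0 k - duhamel_int (rate k) (\<lambda>\<tau>. bil (c \<tau>) (c \<tau>) k) u) has_vector_derivative
     - rate k *\<^sub>R (exp (- rate k * t) *\<^sub>R c0 k - duhamel_int (rate k) (\<lambda>\<tau>. bil (c \<tau>) (c \<tau>) k) t) - bil (c t) (c t) k)
     (at t within {0..T})"
    by (rule duhamel_has_derivative[OF solvesD(2)[OF sol k]]) (use t in simp)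
  then have "((\<lambda>u. c u k) has_vector_derivative - rate k *\<^sub>R c t k - bil (c t) (c t) k) (at t within {0..T})"
    unfolding eq[of t, symmetric, OF atLeastAtMost_iff[THEN iffD2, OF conjI[OF less_imp_le less_imp_le], OF t]]
    by (rule has_vector_derivative_transform[rotated 2]) (use t eq in auto)
  then show ?thesis using t by (simp only: at_within_Icc_at)
qed

text \<open>After a restart at e = d / 2, at least the time e has passed at every t \<ge> d, so the
  linear part gains the required power. In the Duhamel part the exponent lam - 2 r - 2\<alpha> is at
  most - (r + gap) because r \<ge> s. The induction hypothesis has to hold for every positive d, as
  it is used at d / 2.\<close>

lemma smoothing_step:
  assumes r: "s \<le> r" and d: "0 < d" "d \<le> T"
    and IH: "\<And>d. 0 < d \<Longrightarrow> d \<le> T \<Longrightarrow> \<exists>C\<ge>0. \<forall>t\<in>{d..T}. \<forall>k\<in>M_set. norm (c t k) \<le> C * freq k powr (- r)"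
  shows "\<exists>C\<ge>0. \<forall>t\<in>{d..T}. \<forall>k\<in>M_set. norm (c t k) \<le> C * freq k powr (- (r + gap))"
proof -
  define e where "e = d / 2"
  have e: "0 < e" "e < d" "e \<le> T" using d by (simp_all add: e_def)
  obtain C where C: "0 \<le> C" "\<And>t k. e \<le> t \<Longrightarrow> t \<le> T \<Longrightarrow> k \<in> M_set \<Longrightarrow> norm (c t k) \<le> C * freq k powr (- r)"
    using IH[OF e(1,3)] by auto
  have r0: "0 \<le> r" using r s_nonneg by simp
  \<comment> \<open>Chosen so that |k|^(2\<alpha>) to the power -b is |k|^(-gap).\<close>
  define b where "b = gap / (2 * \<alpha>)"
  have b: "0 < b" "2 * \<alpha> * b = gap" using gap_pos alpha_pos by (simp_all add: b_def)
  define D1 where "D1 = (\<nu> * e / b) powr (- b) * C"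
  define D2 where "D2 = bil_const r * C * C * exp T / \<nu>"
  have D: "0 \<le> D1" "0 \<le> D2" using C bil_const_nonneg nu by (simp_all add: D1_def D2_def)
  have S: "solves (c e) (\<lambda>t. bil (c (e + t)) (c (e + t))) (\<lambda>t. c (e + t)) (T - e)"
    by (rule solves_shift[OF sol]) (use e in auto)
  have "norm (c t k) \<le> (D1 + D2) * freq k powr (- (r + gap))" if t: "d \<le> t" "t \<le> T" and k: "k \<in> M_set" for t k
  proof -
    define u where "u = t - e"
    have u: "0 \<le> u" "u \<le> T - e" "e \<le> u" using t e by (simp_all add: u_def e_def)
    have f: "1 \<le> freq k" using freq_ge_1[OF k] .
    have "c (e + u) k = exp (- rate k * u) *\<^sub>R c e k - duhamel_int (rate k) (\<lambda>\<tau>. bil (c (e + \<tau>)) (c (e + \<tau>)) k) u"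
      using solvesD(3)[OF S k u(1,2)] .
    then have "norm (c t k) \<le> exp (- rate k * u) * norm (c e k) + norm (duhamel_int (rate k) (\<lambda>\<tau>. bil (c (e + \<tau>)) (c (e + \<tau>)) k) u)"
      using norm_triangle_ineq4[of "exp (- rate k * u) *\<^sub>R c e k"] by (simp add: u_def)
    also have "\<dots> \<le> D1 * freq k powr (- (r + gap)) + D2 * freq k powr (- (r + gap))"
    proof (rule add_mono)
      have "exp (- rate k * u) \<le> exp (- (\<nu> * e * freq k powr (2 * \<alpha>)))"
        using mult_mono[OF rate_ge[OF k] u(3)] e nu rate_pos[OF k] by (simp add: mult_ac)
      also have "\<dots> \<le> (\<nu> * e * freq k powr (2 * \<alpha>) / b) powr (- b)"
        by (rule exp_decay_powr) (use nu e f b in auto)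
      also have "\<dots> = ((\<nu> * e / b) * freq k powr (2 * \<alpha>)) powr (- b)" by (simp add: mult_ac)
      also have "\<dots> = (\<nu> * e / b) powr (- b) * freq k powr (- gap)"
        by (subst powr_mult) (use nu e b in \<open>simp_all add: powr_powr flip: b(2)\<close>)
      finally have "exp (- rate k * u) * norm (c e k) \<le> ((\<nu> * e / b) powr (- b) * freq k powr (- gap)) * (C * freq k powr (- r))"
        using C k e by (intro mult_mono) auto
      also have "\<dots> = D1 * (freq k powr (- gap) * freq k powr (- r))" by (simp add: D1_def)
      also have "freq k powr (- gap) * freq k powr (- r) = freq k powr (- (r + gap))"
        by (simp only: powr_add[symmetric], simp only: minus_add_distrib add.commute)
      finally show "exp (- rate k * u) * norm (c e k) \<le> D1 * freq k powr (- (r + gap))" .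
    next
      define G where "G = bil_const r * C * C * freq k powr (lam - 2 * r)"
      have G: "0 \<le> G" using C bil_const_nonneg by (simp add: G_def)
      \<comment> \<open>The bound G is constant in time; taking L = 1 in
        \<open>duhamel_int_bound\<close> costs only the factor exp T.\<close>
      have "norm (duhamel_int (rate k) (\<lambda>\<tau>. bil (c (e + \<tau>)) (c (e + \<tau>)) k) u) \<le> G * exp (1 * u) / (rate k + 1)"
      proof (rule duhamel_int_bound[OF _ rate_pos[OF k] _ u(1) _ G])
        show "continuous_on {0..u} (\<lambda>\<tau>. bil (c (e + \<tau>)) (c (e + \<tau>)) k)"
          by (rule continuous_on_subset[OF solvesD(2)[OF S k]]) (use u in auto)
        fix \<tau> assume \<tau>: "0 \<le> \<tau>" "\<tau> \<le> u"
        have "norm (bil (c (e + \<tau>)) (c (e + \<tau>)) k) \<le> G"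
          unfolding G_def using \<tau> u C by (intro bil_bound k r0) auto
        also have "G \<le> G * exp (1 * \<tau>)" using \<tau> mult_left_mono[of 1 "exp \<tau>" G] G by simp
        finally show "norm (bil (c (e + \<tau>)) (c (e + \<tau>)) k) \<le> G * exp (1 * \<tau>)" .
      qed simp
      also have "\<dots> \<le> G * exp T / (\<nu> * freq k powr (2 * \<alpha>))"
      proof (rule frac_le)
        show "G * exp (1 * u) \<le> G * exp T" using G u e by (intro mult_left_mono) auto
        show "0 \<le> G * exp T" using G by simp
        show "0 < \<nu> * freq k powr (2 * \<alpha>)" using nu f by simp
        show "\<nu> * freq k powr (2 * \<alpha>) \<le> rate k + 1" using rate_ge[OF k] by simp
      qed
      also have "\<dots> = D2 * (freq k powr (lam - 2 * r) * freq k powr (- (2 * \<alpha>)))"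
      proof -
        have "bil_const r * C * C * z * exp T / (\<nu> * y) = bil_const r * C * C * exp T / \<nu> * (z * (1 / y))" for y z
          by simp
        then show ?thesis unfolding G_def D2_def powr_minus_divide[of "freq k" "2 * \<alpha>"] .
      qed
      also have "freq k powr (lam - 2 * r) * freq k powr (- (2 * \<alpha>)) = freq k powr (lam - 2 * r - 2 * \<alpha>)"
        by (simp flip: powr_add)
      also have "D2 * \<dots> \<le> D2 * freq k powr (- (r + gap))"
      proof (intro mult_left_mono powr_mono D f)
        show "lam - 2 * r - 2 * \<alpha> \<le> - (r + gap)" using r gap_def by linarith
      qed
      finally show "norm (duhamel_int (rate k) (\<lambda>\<tau>. bil (c (e + \<tau>)) (c (e + \<tau>)) k) u) \<le> D2 * freq k powr (- (r + gap))" .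
    qed
    finally show ?thesis by (simp add: distrib_right)
  qed
  then show ?thesis using D by (intro exI[of _ "D1 + D2"]) auto
qed

lemma smoothing:
  "0 < d \<Longrightarrow> d \<le> T \<Longrightarrow> \<exists>C\<ge>0. \<forall>t\<in>{d..T}. \<forall>k\<in>M_set. norm (c t k) \<le> C * freq k powr (- (s + real n * gap))"
proof (induction n arbitrary: d)
  case 0
  then show ?case using A bound by (intro exI[of _ A]) auto
next
  case (Suc n)
  have "s \<le> s + real n * gap" using gap_pos by simp
  from smoothing_step[OF this Suc.prems Suc.IH] show ?case
    by (simp add: algebra_simps)
qed

lemma rapid_decay:
  assumes d: "0 < d" "d \<le> T"
  obtains C where "0 \<le> C" "\<And>t k. d \<le> t \<Longrightarrow> t \<le> T \<Longrightarrow> k \<in> M_set \<Longrightarrow> norm (c t k) \<le> C * freq k powr (- r)"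
proof -
  obtain n :: nat where n: "r / gap < n" using reals_Archimedean2 by blast
  then have r: "r \<le> s + real n * gap" using gap_pos s_nonneg by (simp add: divide_less_eq)
  obtain C where C: "0 \<le> C" "\<forall>t\<in>{d..T}. \<forall>k\<in>M_set. norm (c t k) \<le> C * freq k powr (- (s + real n * gap))"
    using smoothing[OF d] by blast
  have "norm (c t k) \<le> C * freq k powr (- r)" if "d \<le> t" "t \<le> T" "k \<in> M_set" for t k
  proof -
    have "norm (c t k) \<le> C * freq k powr (- (s + real n * gap))" using C that by simp
    also have "\<dots> \<le> C * freq k powr (- r)"
      using C r freq_ge_1[OF that(3)] by (intro mult_left_mono powr_mono) auto
    finally show ?thesis .
  qed
  then show ?thesis using that C(1) by blast
qed

text \<open>No smoothing is available down to t = 0, but the Duhamel part decays by gap / 2 faster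
  than |k|^(-s). So the amplitudes stay, uniformly on [0, T], below one sequence whose H^s sum is
  finite as soon as that of c0 is.\<close>

lemma initial_domination:
  obtains C where "0 \<le> C" "\<And>t k. 0 \<le> t \<Longrightarrow> t \<le> T \<Longrightarrow> k \<in> M_set \<Longrightarrow>
    norm (c t k) \<le> norm (c0 k) + C * freq k powr (- s - gap / 2)"
proof -
  define C where "C = bil_const s * A * A * \<nu> powr (theta - 1) * 1 powr (- theta) * exp (1 * T)"
  have C: "0 \<le> C" using bil_const_nonneg A by (simp add: C_def)
  have "norm (c t k) \<le> norm (c0 k) + C * freq k powr (- s - gap / 2)" if t: "0 \<le> t" "t \<le> T" and k: "k \<in> M_set" for t k
  proof -
    have "norm (c t k) \<le> exp (- rate k * t) * norm (c0 k) + norm (duhamel_int (rate k) (\<lambda>\<tau>. bil (c \<tau>) (c \<tau>) k) t)"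
      unfolding solvesD(3)[OF sol k t] by (rule order_trans[OF norm_triangle_ineq4]) simp
    also have "\<dots> \<le> 1 * norm (c0 k) + C * freq k powr (- s - gap / 2)"
    proof (intro add_mono mult_right_mono)
      show "exp (- rate k * t) \<le> 1" using rate_pos[OF k] t by simp
      have "norm (duhamel_int (rate k) (\<lambda>\<tau>. bil (c \<tau>) (c \<tau>) k) t)
        \<le> (bil_const s * A * A) * \<nu> powr (theta - 1) * 1 powr (- theta) * exp (1 * t) * freq k powr (- s - gap / 2)"
      proof (rule duhamel_gain[OF k _ _ t(1)])
        show "continuous_on {0..t} (\<lambda>\<tau>. bil (c \<tau>) (c \<tau>) k)"
          by (rule continuous_on_subset[OF solvesD(2)[OF sol k]]) (use t in auto)
        show "0 \<le> bil_const s * A * A" using A bil_const_nonneg by simp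
        fix \<tau> assume \<tau>: "0 \<le> \<tau>" "\<tau> \<le> t"
        have "norm (bil (c \<tau>) (c \<tau>) k) \<le> bil_const s * A * A * freq k powr (lam - 2 * s)"
          using \<tau> t bound by (intro bil_bound k s_nonneg A) auto
        also have "\<dots> \<le> bil_const s * A * A * freq k powr (lam - 2 * s) * exp (1 * \<tau>)"
          using \<tau> A bil_const_nonneg mult_left_mono[of 1 "exp \<tau>" "bil_const s * A * A * freq k powr (lam - 2 * s)"] by simp
        finally show "norm (bil (c \<tau>) (c \<tau>) k) \<le> bil_const s * A * A * freq k powr (lam - 2 * s) * exp (1 * \<tau>)" .
      qed simp
      also have "\<dots> \<le> C * freq k powr (- s - gap / 2)"
        unfolding C_def using t A bil_const_nonneg by (intro mult_mono mult_nonneg_nonneg) auto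
      finally show "norm (duhamel_int (rate k) (\<lambda>\<tau>. bil (c \<tau>) (c \<tau>) k) t) \<le> C * freq k powr (- s - gap / 2)" .
    qed simp
    finally show ?thesis by simp
  qed
  then show ?thesis using that C by blast
qed

section \<open>Weighted energies and their evolution\<close>

definition energy :: "real \<Rightarrow> real \<Rightarrow> real" where
  "energy b t = (\<Sum>\<^sub>\<infinity>k\<in>M_set. laplace_symbol b k * (norm (c t k))\<^sup>2)"

lemma weighted_decay:
  assumes "0 < d" "d \<le> T"
  obtains C where "0 \<le> C" "\<And>t k. d \<le> t \<Longrightarrow> t \<le> T \<Longrightarrow> k \<in> M_set \<Longrightarrow>
    laplace_symbol b k * (norm (c t k))\<^sup>2 \<le> C * freq k powr (- r)"
proof -
  obtain C where C: "0 \<le> C" "\<And>t k. d \<le> t \<Longrightarrow> t \<le> T \<Longrightarrow> k \<in> M_set \<Longrightarrow> norm (c t k) \<le> C * freq k powr (- (b + r / 2))"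
    using rapid_decay[OF assms] by blast
  have "laplace_symbol b k * (norm (c t k))\<^sup>2 \<le> ((2 * pi) powr (2 * b) * C\<^sup>2) * freq k powr (- r)"
    if "d \<le> t" "t \<le> T" "k \<in> M_set" for t k
  proof -
    have "laplace_symbol b k * (norm (c t k))\<^sup>2 \<le> laplace_symbol b k * (C * freq k powr (- (b + r / 2)))\<^sup>2"
      by (intro mult_left_mono power_mono C that laplace_symbol_nonneg) simp
    also have "\<dots> = ((2 * pi) powr (2 * b) * C\<^sup>2) * (freq k powr (2 * b) * (freq k powr (- (b + r / 2)) * freq k powr (- (b + r / 2))))"
      unfolding laplace_symbol_split[OF that(3)] by (simp only: power2_eq_square mult_ac)
    also have "freq k powr (2 * b) * (freq k powr (- (b + r / 2)) * freq k powr (- (b + r / 2))) = freq k powr (- r)"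
      by (simp flip: powr_add)
    finally show ?thesis .
  qed
  then show ?thesis using that[of "(2 * pi) powr (2 * b) * C\<^sup>2"] by simp
qed

lemma energy_summable:
  assumes "0 < t" "t \<le> T" shows "(\<lambda>k. laplace_symbol b k * (norm (c t k))\<^sup>2) summable_on M_set"
proof -
  obtain C where C: "0 \<le> C" "\<And>u k. t \<le> u \<Longrightarrow> u \<le> T \<Longrightarrow> k \<in> M_set \<Longrightarrow>
    laplace_symbol b k * (norm (c u k))\<^sup>2 \<le> C * freq k powr (- 1)"
    using weighted_decay[OF assms] by blast
  show ?thesis
    by (rule summable_M_set[of 1 _ C]) (use C(2)[of t] assms in \<open>simp_all add: laplace_symbol_nonneg abs_mult\<close>)
qed

lemma energy_nonneg: "0 \<le> energy b t"
  unfolding energy_def by (intro infsum_nonneg mult_nonneg_nonneg laplace_symbol_nonneg) simp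

text \<open>Termwise differentiation on (t / 2, T), away from the initial time, where rapid decay
  supplies one summable majorant for the derivatives of all terms.\<close>

lemma energy_has_derivative:
  assumes t: "0 < t" "t < T"
  shows "(energy b has_real_derivative
    (\<Sum>\<^sub>\<infinity>k\<in>M_set. laplace_symbol b k * (2 * (c t k \<bullet> (- rate k *\<^sub>R c t k - bil (c t) (c t) k))))) (at t)"
proof -
  define F where "F u k = laplace_symbol b k * (2 * (c u k \<bullet> (- rate k *\<^sub>R c u k - bil (c u) (c u) k)))" for u k
  have d: "((\<lambda>u. laplace_symbol b k * (norm (c u k))\<^sup>2) has_real_derivative F u k) (at u)"
    if k: "k \<in> M_set" and u: "u \<in> {t / 2<..<T}" for k u
  proof -
    have c': "((\<lambda>t. c t k) has_vector_derivative - rate k *\<^sub>R c u k - bil (c u) (c u) k) (at u)"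
      by (rule c_has_derivative) (use k u t in auto)
    have "((\<lambda>u. c u k \<bullet> c u k) has_real_derivative 2 * (c u k \<bullet> (- rate k *\<^sub>R c u k - bil (c u) (c u) k))) (at u)"
      unfolding has_real_derivative_iff_has_vector_derivative
      using bounded_bilinear.has_vector_derivative[OF bounded_bilinear_inner c' c']
      by (simp add: inner_commute)
    then show ?thesis
      unfolding F_def power2_norm_eq_inner by (rule DERIV_cmult)
  qed
  define r where "r = 2 * b + 2 * \<alpha> + lam + 1"
  \<comment> \<open>Large enough that the dissipative and the quadratic part, with the weight of
    order 2 b, both decay like |k|^(-1).\<close>
  define q where "q = max 1 (max r (2 * b + lam + 1))"
  obtain C where C: "0 \<le> C" "\<And>u k. t / 2 \<le> u \<Longrightarrow> u \<le> T \<Longrightarrow> k \<in> M_set \<Longrightarrow> norm (c u k) \<le> C * freq k powr (- q)"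
    using rapid_decay[of "t / 2" q] t by auto
  have q: "0 \<le> q" "2 * b + 2 * \<alpha> + lam + 1 \<le> q" "2 * b + lam + 1 \<le> q" "1 \<le> q" by (auto simp: q_def r_def)
  define B1 where "B1 = (2 * pi) powr (2 * b) * 2 * C * (\<nu> * (2 * pi) powr (2 * \<alpha>) * C)"
  define B2 where "B2 = (2 * pi) powr (2 * b) * 2 * C * (bil_const q * C * C)"
  have B12: "0 \<le> B1" "0 \<le> B2" using C nu bil_const_nonneg by (simp_all add: B1_def B2_def)
  have bd: "\<bar>F u k\<bar> \<le> (B1 + B2) * freq k powr (- 1)" if k: "k \<in> M_set" and u: "u \<in> {t / 2<..<T}" for k u
  proof -
    have f: "1 \<le> freq k" using freq_ge_1[OF k] .
    have cb: "norm (c u k) \<le> C * freq k powr (- q)" using C k u by simp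
    have bb: "norm (bil (c u) (c u) k) \<le> bil_const q * C * C * freq k powr (lam - 2 * q)"
      using C u by (intro bil_bound k q) auto
    have rt: "norm (rate k *\<^sub>R c u k) \<le> \<nu> * ((2 * pi) powr (2 * \<alpha>) * freq k powr (2 * \<alpha>)) * (C * freq k powr (- q))"
      using cb nu unfolding norm_scaleR rate_def laplace_symbol_split[OF k]
      by (intro mult_mono) (auto simp: abs_mult)
    have "\<bar>c u k \<bullet> (- rate k *\<^sub>R c u k - bil (c u) (c u) k)\<bar> \<le> norm (c u k) * norm (- rate k *\<^sub>R c u k - bil (c u) (c u) k)"
      by (rule Cauchy_Schwarz_ineq2)
    also have "\<dots> \<le> (C * freq k powr (- q)) * (\<nu> * ((2 * pi) powr (2 * \<alpha>) * freq k powr (2 * \<alpha>)) * (C * freq k powr (- q)) + bil_const q * C * C * freq k powr (lam - 2 * q))"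
    proof (intro mult_mono cb)
      have "norm (- rate k *\<^sub>R c u k - bil (c u) (c u) k) \<le> norm (rate k *\<^sub>R c u k) + norm (bil (c u) (c u) k)"
        using norm_triangle_ineq4[of "- rate k *\<^sub>R c u k" "bil (c u) (c u) k"] by simp
      then show "norm (- rate k *\<^sub>R c u k - bil (c u) (c u) k) \<le> \<nu> * ((2 * pi) powr (2 * \<alpha>) * freq k powr (2 * \<alpha>)) * (C * freq k powr (- q)) + bil_const q * C * C * freq k powr (lam - 2 * q)"
        using rt bb by linarith
    qed (use C in auto)
    finally have in': "\<bar>c u k \<bullet> (- rate k *\<^sub>R c u k - bil (c u) (c u) k)\<bar> \<le> \<dots>" .
    have "\<bar>F u k\<bar> = (2 * pi) powr (2 * b) * freq k powr (2 * b) * (2 * \<bar>c u k \<bullet> (- rate k *\<^sub>R c u k - bil (c u) (c u) k)\<bar>)"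
      unfolding F_def laplace_symbol_split[OF k] by (simp add: abs_mult)
    also have "\<dots> \<le> (2 * pi) powr (2 * b) * freq k powr (2 * b) * (2 * ((C * freq k powr (- q)) * (\<nu> * ((2 * pi) powr (2 * \<alpha>) * freq k powr (2 * \<alpha>)) * (C * freq k powr (- q)) + bil_const q * C * C * freq k powr (lam - 2 * q))))"
      using in' by (intro mult_left_mono) auto
    also have "\<dots> = B1 * (freq k powr (2 * b) * freq k powr (- q) * freq k powr (2 * \<alpha>) * freq k powr (- q))
        + B2 * (freq k powr (2 * b) * freq k powr (- q) * freq k powr (lam - 2 * q))"
      by (simp add: B1_def B2_def algebra_simps)
    also have "\<dots> = B1 * freq k powr (2 * b + - q + 2 * \<alpha> + - q) + B2 * freq k powr (2 * b + - q + (lam - 2 * q))"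
      by (simp only: powr_add)
    also have "\<dots> \<le> B1 * freq k powr (- 1) + B2 * freq k powr (- 1)"
    proof (intro add_mono mult_left_mono powr_mono)
      show "2 * b + - q + 2 * \<alpha> + - q \<le> - 1" "2 * b + - q + (lam - 2 * q) \<le> - 1"
        using q lam_pos by linarith+
    qed (use B12 f in auto)
    finally show ?thesis by (simp only: distrib_right)
  qed
  have "(\<lambda>k. (B1 + B2) * freq k powr (- 1)) summable_on M_set"
    by (intro summable_on_cmult_right summable_freq_powr) simp
  from has_real_derivative_infsum[where a = "t / 2" and b = T and f' = "\<lambda>k u. F u k", OF countable_M_set d bd this]
  show ?thesis
    unfolding energy_def [abs_def] F_def using t energy_summable by simp
qed

end


subsection \<open>Energy estimates\<close>

context hypodissipative
begin

text \<open>128 bounds the coefficient and 6^s moves s powers from k to k - p. The symbols are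
  powers of 2\<pi>|k|: the left side of \<open>triad_weight\<close> carries (2\<pi>)^(2 s), its
  weights on the right carry (2\<pi>)^(2 s + 2\<alpha>), and the last factor compensates.\<close>

definition triad_const :: real where
  "triad_const = 128 * 6 powr s * (2 * pi) powr (- (2 * \<alpha>))"

text \<open>After Young's inequality the flux leaves 2 * 324^2 * triad_const^2 / (4 \<nu>) times the
  \<alpha>-energy as growth rate of the H^s energy, while the L^2 energy loses 2 \<nu> times the
  \<alpha>-energy; this is the quotient of the two.\<close>

definition growth_rate :: real where
  "growth_rate = 324\<^sup>2 * triad_const\<^sup>2 / (4 * \<nu>\<^sup>2)"

lemma growth_rate_nonneg: "0 \<le> growth_rate"
  by (simp add: growth_rate_def)

end

locale real_solution = bounded_solution +
  assumes real: "\<And>t k. 0 \<le> t \<Longrightarrow> t \<le> T \<Longrightarrow> k \<in> M_set \<Longrightarrow> c t (- k) = cnj (c t k)"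
    and Hs: "(\<lambda>k. laplace_symbol s k * (norm (c0 k))\<^sup>2) summable_on M_set"
begin

text \<open>The squared form of \<open>initial_domination\<close>; the additional decay gap / 2,
  squared, leaves the summable |k|^(-gap).\<close>

lemma energy_domination:
  obtains B where "B summable_on M_set" "\<And>t k. 0 \<le> t \<Longrightarrow> t \<le> T \<Longrightarrow> k \<in> M_set \<Longrightarrow> laplace_symbol s k * (norm (c t k))\<^sup>2 \<le> B k"
proof -
  obtain C where C: "0 \<le> C" "\<And>t k. 0 \<le> t \<Longrightarrow> t \<le> T \<Longrightarrow> k \<in> M_set \<Longrightarrow>
    norm (c t k) \<le> norm (c0 k) + C * freq k powr (- s - gap / 2)" using initial_domination by blast
  define B where "B k = 2 * (laplace_symbol s k * (norm (c0 k))\<^sup>2) + 2 * ((2 * pi) powr (2 * s) * C\<^sup>2) * freq k powr (- gap)" for k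
  have "B summable_on M_set" unfolding B_def
    by (intro summable_on_add summable_on_cmult_right Hs summable_freq_powr gap_pos)
  moreover have "laplace_symbol s k * (norm (c t k))\<^sup>2 \<le> B k" if t: "0 \<le> t" "t \<le> T" and k: "k \<in> M_set" for t k
  proof -
    define y where "y = C * freq k powr (- s - gap / 2)"
    have "(norm (c t k))\<^sup>2 \<le> (norm (c0 k) + y)\<^sup>2" unfolding y_def using C(2)[OF t k] by (intro power_mono) auto
    also have "\<dots> \<le> 2 * (norm (c0 k))\<^sup>2 + 2 * y\<^sup>2"
      using sum_squares_bound[of "norm (c0 k)" y] by (simp add: power2_sum)
    finally have "laplace_symbol s k * (norm (c t k))\<^sup>2 \<le> laplace_symbol s k * (2 * (norm (c0 k))\<^sup>2 + 2 * y\<^sup>2)"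
      by (intro mult_left_mono laplace_symbol_nonneg)
    also have "\<dots> = 2 * (laplace_symbol s k * (norm (c0 k))\<^sup>2) + 2 * (laplace_symbol s k * y\<^sup>2)"
      by (simp add: algebra_simps)
    also have "laplace_symbol s k * y\<^sup>2 = ((2 * pi) powr (2 * s) * C\<^sup>2) * (freq k powr (2 * s) * (freq k powr (- s - gap / 2) * freq k powr (- s - gap / 2)))"
      unfolding laplace_symbol_split[OF k] y_def by (simp only: power2_eq_square mult_ac)
    also have "freq k powr (2 * s) * (freq k powr (- s - gap / 2) * freq k powr (- s - gap / 2)) = freq k powr (- gap)"
      by (simp flip: powr_add)
    finally show ?thesis by (simp add: B_def)
  qed
  ultimately show ?thesis using that by blast
qed

lemma laplace_symbol_mono:
  assumes "k \<in> M_set" "b \<le> b'" shows "laplace_symbol b k \<le> laplace_symbol b' k"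
  unfolding laplace_symbol_freq[OF assms(1)] using two_pi_freq_ge_1[OF assms(1)] assms(2) by (intro powr_mono) auto

text \<open>The point t = 0 is included thanks to the majorant independent of t: the differential
  relations hold for t > 0 and reach the initial data through this continuity.\<close>

lemma energy_continuous:
  assumes "b \<le> s" shows "continuous_on {0..T} (energy b)"
proof -
  obtain B where B: "B summable_on M_set" "\<And>t k. 0 \<le> t \<Longrightarrow> t \<le> T \<Longrightarrow> k \<in> M_set \<Longrightarrow> laplace_symbol s k * (norm (c t k))\<^sup>2 \<le> B k"
    using energy_domination by blast
  show ?thesis
    unfolding energy_def [abs_def]
  proof (rule continuous_on_infsum[OF _ _ B(1)])
    show "continuous_on {0..T} (\<lambda>t. laplace_symbol b k * (norm (c t k))\<^sup>2)" if "k \<in> M_set" for k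
      by (intro continuous_intros c_continuous that)
    show "norm (laplace_symbol b k * (norm (c t k))\<^sup>2) \<le> B k" if "k \<in> M_set" "t \<in> {0..T}" for k t
      using order_trans[OF mult_right_mono[OF laplace_symbol_mono[OF that(1) assms], of "(norm (c t k))\<^sup>2"] B(2)[of t k]]
        that laplace_symbol_nonneg[of b k] by (simp add: abs_mult)
  qed
qed

lemma flux_summable:
  assumes t: "0 < t" "t \<le> T" shows "(\<lambda>k. laplace_symbol b k * (c t k \<bullet> bil (c t) (c t) k)) summable_on M_set"
proof -
  define q where "q = max 1 (2 * b + lam + 1)"
  obtain C where C: "0 \<le> C" "\<And>u k. t \<le> u \<Longrightarrow> u \<le> T \<Longrightarrow> k \<in> M_set \<Longrightarrow> norm (c u k) \<le> C * freq k powr (- q)"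
    using rapid_decay[OF t, of q] by auto
  have q: "0 \<le> q" "2 * b + lam + 1 \<le> q" "1 \<le> q" by (auto simp: q_def)
  define D where "D = (2 * pi) powr (2 * b) * C * (bil_const q * C * C)"
  have D: "0 \<le> D" using C bil_const_nonneg by (simp add: D_def)
  show ?thesis
  proof (rule summable_M_set[of 1 _ D])
    fix k assume k: "k \<in> M_set"
    have f: "1 \<le> freq k" using freq_ge_1[OF k] .
    have "\<bar>c t k \<bullet> bil (c t) (c t) k\<bar> \<le> norm (c t k) * norm (bil (c t) (c t) k)"
      by (rule Cauchy_Schwarz_ineq2)
    also have "\<dots> \<le> (C * freq k powr (- q)) * (bil_const q * C * C * freq k powr (lam - 2 * q))"
      using C t k by (intro mult_mono bil_bound q) auto
    finally have "norm (laplace_symbol b k * (c t k \<bullet> bil (c t) (c t) k))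
      \<le> ((2 * pi) powr (2 * b) * freq k powr (2 * b)) * ((C * freq k powr (- q)) * (bil_const q * C * C * freq k powr (lam - 2 * q)))"
      unfolding laplace_symbol_split[OF k] by (simp add: abs_mult mult_left_mono)
    also have "\<dots> = D * (freq k powr (2 * b) * freq k powr (- q) * freq k powr (lam - 2 * q))"
      by (simp only: D_def mult_ac)
    also have "\<dots> = D * freq k powr (2 * b + - q + (lam - 2 * q))" by (simp only: powr_add)
    also have "\<dots> \<le> D * freq k powr (- 1)"
    proof (intro mult_left_mono powr_mono D f)
      show "2 * b + - q + (lam - 2 * q) \<le> - 1" using q by linarith
    qed
    finally show "norm (laplace_symbol b k * (c t k \<bullet> bil (c t) (c t) k)) \<le> D * freq k powr (- 1)" .
  qed simp
qed

lemma laplace_symbol_add: "k \<in> M_set \<Longrightarrow> laplace_symbol (a + b) k = laplace_symbol a k * laplace_symbol b k"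
  by (simp add: laplace_symbol_freq distrib_left powr_add)

lemma laplace_symbol_0: "k \<in> M_set \<Longrightarrow> laplace_symbol 0 k = 1"
  using freq_pos[of k] by (simp add: laplace_symbol_freq)

lemma energy_balance:
  assumes t: "0 < t" "t < T"
  shows "(energy b has_real_derivative - 2 * \<nu> * energy (b + \<alpha>) t
    - 2 * (\<Sum>\<^sub>\<infinity>k\<in>M_set. laplace_symbol b k * (c t k \<bullet> bil (c t) (c t) k))) (at t)"
proof -
  have t': "t \<le> T" using t by simp
  have "(\<Sum>\<^sub>\<infinity>k\<in>M_set. laplace_symbol b k * (2 * (c t k \<bullet> (- rate k *\<^sub>R c t k - bil (c t) (c t) k))))
    = (\<Sum>\<^sub>\<infinity>k\<in>M_set. (- 2 * \<nu>) * (laplace_symbol (b + \<alpha>) k * (norm (c t k))\<^sup>2) + (- 2) * (laplace_symbol b k * (c t k \<bullet> bil (c t) (c t) k)))"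
  proof (rule infsum_cong)
    fix k assume k: "k \<in> M_set"
    show "laplace_symbol b k * (2 * (c t k \<bullet> (- rate k *\<^sub>R c t k - bil (c t) (c t) k)))
      = (- 2 * \<nu>) * (laplace_symbol (b + \<alpha>) k * (norm (c t k))\<^sup>2) + (- 2) * (laplace_symbol b k * (c t k \<bullet> bil (c t) (c t) k))"
      unfolding laplace_symbol_add[OF k] rate_def power2_norm_eq_inner
      by (simp add: inner_diff_right algebra_simps)
  qed
  also have "\<dots> = (- 2 * \<nu>) * energy (b + \<alpha>) t + (- 2) * (\<Sum>\<^sub>\<infinity>k\<in>M_set. laplace_symbol b k * (c t k \<bullet> bil (c t) (c t) k))"
    unfolding energy_def
    by (subst infsum_add) (intro summable_on_cmult_right energy_summable flux_summable t t',
        intro summable_on_cmult_right energy_summable flux_summable t t', simp only: infsum_cmult_right')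
  finally show ?thesis using energy_has_derivative[OF t, of b] by simp
qed

lemma energy_0_derivative:
  assumes t: "0 < t" "t < T"
  shows "(energy 0 has_real_derivative - 2 * \<nu> * energy \<alpha> t) (at t)"
proof -
  obtain C where C: "0 \<le> C" "\<And>u k. t \<le> u \<Longrightarrow> u \<le> T \<Longrightarrow> k \<in> M_set \<Longrightarrow> norm (c u k) \<le> C * freq k powr (- (lam + 1))"
    using rapid_decay[of t "lam + 1"] t by auto
  have "(\<Sum>\<^sub>\<infinity>k\<in>M_set. laplace_symbol 0 k * (c t k \<bullet> bil (c t) (c t) k)) = (\<Sum>\<^sub>\<infinity>k\<in>M_set. c t k \<bullet> bil (c t) (c t) k)"
    by (rule infsum_cong) (simp add: laplace_symbol_0)
  also have "\<dots> = 0"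
    by (rule bil_energy_zero[where A = C and r = "lam + 1"]) (use C t real in auto)
  finally show ?thesis using energy_balance[OF t, of 0] by simp
qed

text \<open>
  The derivative count of the nonlinearity is \<open>lam \<le> 2\<alpha>\<close>; one factor \<open>\<alpha>\<close> goes to each of two modes.
\<close>

lemma triad_weight:
  assumes k: "k \<in> M_set" and p: "p \<in> pairs k"
  shows "laplace_symbol s k * \<bar>coef k p\<bar> \<le> triad_const * (2 * pi * freq p) powr \<alpha> * (2 * pi * freq (k - p)) powr s * (2 * pi * freq k) powr (s + \<alpha>)"
proof -
  have M: "p \<in> M_set" "k - p \<in> M_set" using pairs_M_set[OF p] by auto
  have f: "1 \<le> freq k" "1 \<le> freq p" "1 \<le> freq (k - p)" using freq_ge_1 k M by auto
  have co: "\<bar>coef k p\<bar> \<le> 128 * (freq p powr \<alpha> * freq k powr \<alpha>)"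
  proof -
    \<comment> \<open>With m the leg of smaller frequency among p and k, |m|^lam \<le>
      |m|^(2\<alpha>) splits evenly into |p|^\<alpha> |k|^\<alpha>.\<close>
    define m where "m = (if freq p \<le> freq k then p else k)"
    have m: "m \<in> {k, p, k - p}" "1 \<le> freq m" "freq m \<le> freq p" "freq m \<le> freq k"
      using f by (auto simp: m_def)
    have "\<bar>coef k p\<bar> \<le> 128 * freq m powr lam" by (rule coef_bound[OF k p m(1)])
    also have "\<dots> \<le> 128 * freq m powr (\<alpha> + \<alpha>)" using m alpha by (intro mult_left_mono powr_mono) auto
    also have "\<dots> = 128 * (freq m powr \<alpha> * freq m powr \<alpha>)" by (simp only: powr_add)
    also have "\<dots> \<le> 128 * (freq p powr \<alpha> * freq k powr \<alpha>)"
      using m alpha_pos by (intro mult_left_mono mult_mono powr_mono2) auto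
    finally show ?thesis .
  qed
  have fs: "freq k powr s \<le> 6 powr s * freq (k - p) powr s"
    by (rule freq_powr_triad[OF k p s_nonneg]) auto
  have "laplace_symbol s k * \<bar>coef k p\<bar> = ((2 * pi) powr (s + s) * (freq k powr s * freq k powr s)) * \<bar>coef k p\<bar>"
    unfolding laplace_symbol_split[OF k] by (simp flip: powr_add)
  also have "\<dots> \<le> ((2 * pi) powr (s + s) * (freq k powr s * (6 powr s * freq (k - p) powr s))) * (128 * (freq p powr \<alpha> * freq k powr \<alpha>))"
    by (intro mult_mono mult_left_mono co fs) auto
  also have "\<dots> = 128 * 6 powr s * (2 * pi) powr (s + s) * freq p powr \<alpha> * freq (k - p) powr s * (freq k powr s * freq k powr \<alpha>)"
    by (simp only: mult_ac)
  also have "(2 * pi) powr (s + s) = (2 * pi) powr (- (2 * \<alpha>)) * (2 * pi) powr \<alpha> * (2 * pi) powr s * (2 * pi) powr (s + \<alpha>)"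
    by (simp flip: powr_add)
  also have "freq k powr s * freq k powr \<alpha> = freq k powr (s + \<alpha>)" by (simp only: powr_add)
  finally show ?thesis
    by (simp add: triad_const_def powr_mult freq_def mult_ac)
qed

text \<open>A single mode at p is bounded by the whole \<alpha>-energy, and Young's inequality
  separates the legs k - p and k; summing over the triads costs 324 for each of them. The
  dissipative share comes out as \<nu> times the (s + \<alpha>)-energy, which is exactly what the
  dissipation absorbs in \<open>energy_growth\<close>.\<close>

lemma flux_bound:
  assumes t: "0 < t" "t \<le> T"
  shows "\<bar>\<Sum>\<^sub>\<infinity>k\<in>M_set. laplace_symbol s k * (c t k \<bullet> bil (c t) (c t) k)\<bar>
    \<le> 324\<^sup>2 * triad_const\<^sup>2 / (4 * \<nu>) * energy \<alpha> t * energy s t + \<nu> * energy (s + \<alpha>) t"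
proof -
  define X where "X = energy \<alpha> t"
  have X0: "0 \<le> X" unfolding X_def by (rule energy_nonneg)
  define h where "h b k = laplace_symbol b k * (norm (c t k))\<^sup>2" for b k
  have hs: "h b summable_on M_set" for b unfolding h_def by (rule energy_summable[OF t])
  have h0: "0 \<le> h b k" for b k by (simp add: h_def laplace_symbol_nonneg)
  have hm: "h b (- k) = h b k" if "k \<in> M_set" for b k
    using real[of t k] t that by (simp add: h_def laplace_symbol_def rvec_minus)
  have hE: "infsum (h b) M_set = energy b t" for b by (simp add: energy_def h_def [abs_def])
  define c1 where "c1 = 324 * triad_const\<^sup>2 * X / (4 * \<nu>)"
  \<comment> \<open>Divided by the bound for the number of triads per mode, so that summation
    returns \<nu>; \<open>c1\<close> is the matching constant in Young's inequality.\<close>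
  define c2 where "c2 = \<nu> / 324"
  have c12: "0 \<le> c1" "0 \<le> c2" using X0 nu by (simp_all add: c1_def c2_def)
  define G where "G = (\<lambda>(k, p). c1 * h s (k - p) + c2 * h (s + \<alpha>) k)"
  have s1: "(\<lambda>(k, p). h s (k - p)) summable_on triads" "infsum (\<lambda>(k, p). h s (k - p)) triads \<le> 324 * energy s t"
    using triads_summable_flip[of "h s"] hs h0 hm hE by auto
  have s2: "(\<lambda>(k, p). h (s + \<alpha>) k) summable_on triads" "infsum (\<lambda>(k, p). h (s + \<alpha>) k) triads \<le> 324 * energy (s + \<alpha>) t"
    using triads_summable[of "h (s + \<alpha>)"] hs h0 hE by auto
  have Geq: "G = (\<lambda>x. c1 * (case x of (k, p) \<Rightarrow> h s (k - p)) + c2 * (case x of (k, p) \<Rightarrow> h (s + \<alpha>) k))"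
    by (auto simp: G_def)
  have Gs: "G summable_on triads" unfolding Geq
    by (intro summable_on_add summable_on_cmult_right s1 s2)
  have "infsum G triads = c1 * infsum (\<lambda>(k, p). h s (k - p)) triads + c2 * infsum (\<lambda>(k, p). h (s + \<alpha>) k) triads"
    unfolding Geq by (subst infsum_add) (intro summable_on_cmult_right s1 s2, intro summable_on_cmult_right s1 s2, simp only: infsum_cmult_right')
  also have "\<dots> \<le> c1 * (324 * energy s t) + c2 * (324 * energy (s + \<alpha>) t)"
    by (intro add_mono mult_left_mono s1 s2 c12)
  also have "\<dots> = 324\<^sup>2 * triad_const\<^sup>2 / (4 * \<nu>) * energy \<alpha> t * energy s t + \<nu> * energy (s + \<alpha>) t"
    by (simp add: c1_def c2_def X_def power2_eq_square)
  finally have total: "infsum G triads \<le> 324\<^sup>2 * triad_const\<^sup>2 / (4 * \<nu>) * energy \<alpha> t * energy s t + \<nu> * energy (s + \<alpha>) t" .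
  have pointwise: "\<bar>laplace_symbol s k * (c t k \<bullet> bil (c t) (c t) k)\<bar> \<le> (\<Sum>p\<in>pairs k. G (k, p))" if k: "k \<in> M_set" for k
  proof -
    have tri: "laplace_symbol s k * (\<bar>coef k p\<bar> * norm (c t p) * norm (c t (k - p)) * norm (c t k)) \<le> G (k, p)" if p: "p \<in> pairs k" for p
    proof -
      have M: "p \<in> M_set" "k - p \<in> M_set" using pairs_M_set[OF p] by auto
      define x y z where "x = (2 * pi * freq p) powr \<alpha> * norm (c t p)"
        and "y = (2 * pi * freq (k - p)) powr s * norm (c t (k - p))"
        and "z = (2 * pi * freq k) powr (s + \<alpha>) * norm (c t k)"
      have sq: "((2 * pi * freq j) powr b * norm (c t j))\<^sup>2 = h b j" if "j \<in> M_set" for j b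
        unfolding h_def laplace_symbol_freq[OF that] power_mult_distrib
        by (simp add: power2_eq_square flip: powr_add)
      have "x\<^sup>2 \<le> X"
        using finite_sum_le_infsum[OF hs[of \<alpha>], of "{p}"] h0 M
        unfolding X_def hE x_def by (simp add: sq)
      have "laplace_symbol s k * (\<bar>coef k p\<bar> * norm (c t p) * norm (c t (k - p)) * norm (c t k))
        = (laplace_symbol s k * \<bar>coef k p\<bar>) * (norm (c t p) * norm (c t (k - p)) * norm (c t k))" by (simp only: mult_ac)
      also have "\<dots> \<le> (triad_const * (2 * pi * freq p) powr \<alpha> * (2 * pi * freq (k - p)) powr s * (2 * pi * freq k) powr (s + \<alpha>)) * (norm (c t p) * norm (c t (k - p)) * norm (c t k))"
        by (intro mult_right_mono triad_weight k p) auto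
      also have "\<dots> = (triad_const * x * y) * z" by (simp only: x_def y_def z_def mult_ac)
      also have "\<dots> \<le> 324 / (4 * \<nu>) * (triad_const * x * y)\<^sup>2 + c2 * z\<^sup>2"
      proof -
        \<comment> \<open>Young's inequality as a completed square.\<close>
        have "0 \<le> \<nu> / 324 * (324 / (2 * \<nu>) * (triad_const * x * y) - z)\<^sup>2" using nu by simp
        also have "\<dots> = 324 / (4 * \<nu>) * (triad_const * x * y)\<^sup>2 + c2 * z\<^sup>2 - (triad_const * x * y) * z"
          using nu by (simp add: c2_def power2_eq_square field_simps)
        finally show ?thesis by simp
      qed
      also have "(triad_const * x * y)\<^sup>2 = triad_const\<^sup>2 * x\<^sup>2 * y\<^sup>2" by (simp add: power_mult_distrib)
      also have "324 / (4 * \<nu>) * (triad_const\<^sup>2 * x\<^sup>2 * y\<^sup>2) \<le> 324 / (4 * \<nu>) * (triad_const\<^sup>2 * X * y\<^sup>2)"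
        using \<open>x\<^sup>2 \<le> X\<close> nu by (intro mult_left_mono mult_right_mono) auto
      also have "324 / (4 * \<nu>) * (triad_const\<^sup>2 * X * y\<^sup>2) = c1 * y\<^sup>2" by (simp add: c1_def)
      finally show ?thesis
        unfolding G_def using sq[OF M(2), of s] sq[OF k, of "s + \<alpha>"] by (simp add: y_def z_def)
    qed
    have "\<bar>laplace_symbol s k * (c t k \<bullet> bil (c t) (c t) k)\<bar> \<le> laplace_symbol s k * (norm (c t k) * norm (bil (c t) (c t) k))"
      using laplace_symbol_nonneg Cauchy_Schwarz_ineq2[of "c t k" "bil (c t) (c t) k"]
      by (simp add: abs_mult mult_left_mono)
    also have "\<dots> \<le> laplace_symbol s k * (norm (c t k) * (\<Sum>p\<in>pairs k. \<bar>coef k p\<bar> * norm (c t p) * norm (c t (k - p))))"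
      unfolding bil_def
      by (intro mult_left_mono laplace_symbol_nonneg norm_ge_zero order_trans[OF norm_sum] sum_mono) (simp add: norm_mult)
    also have "\<dots> = (\<Sum>p\<in>pairs k. laplace_symbol s k * (\<bar>coef k p\<bar> * norm (c t p) * norm (c t (k - p)) * norm (c t k)))"
      by (simp add: sum_distrib_left mult_ac)
    also have "\<dots> \<le> (\<Sum>p\<in>pairs k. G (k, p))" by (intro sum_mono tri)
    finally show ?thesis .
  qed
  have Gp: "(\<lambda>k. \<Sum>p\<in>pairs k. G (k, p)) summable_on M_set" "infsum G triads = (\<Sum>\<^sub>\<infinity>k\<in>M_set. \<Sum>p\<in>pairs k. G (k, p))"
  proof -
    have "(\<lambda>k. \<Sum>\<^sub>\<infinity>p\<in>pairs k. G (k, p)) summable_on M_set"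
      using summable_on_Sigma_banach[of "\<lambda>k p. G (k, p)" M_set pairs] Gs by (simp add: triads_def case_prod_unfold)
    then show "(\<lambda>k. \<Sum>p\<in>pairs k. G (k, p)) summable_on M_set"
      by (rule summable_on_cong[THEN iffD1, rotated]) (simp add: pairs_card)
    have "infsum G triads = (\<Sum>\<^sub>\<infinity>k\<in>M_set. \<Sum>\<^sub>\<infinity>p\<in>pairs k. G (k, p))"
      using infsum_Sigma_banach[of G M_set pairs] Gs by (simp add: triads_def)
    also have "\<dots> = (\<Sum>\<^sub>\<infinity>k\<in>M_set. \<Sum>p\<in>pairs k. G (k, p))" by (rule infsum_cong) (simp add: pairs_card)
    finally show "infsum G triads = (\<Sum>\<^sub>\<infinity>k\<in>M_set. \<Sum>p\<in>pairs k. G (k, p))" .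
  qed
  have "norm (\<Sum>\<^sub>\<infinity>k\<in>M_set. laplace_symbol s k * (c t k \<bullet> bil (c t) (c t) k)) \<le> (\<Sum>\<^sub>\<infinity>k\<in>M_set. \<Sum>p\<in>pairs k. G (k, p))"
    by (rule norm_infsum_le[OF has_sum_infsum has_sum_infsum]) (use flux_summable[OF t] Gp pointwise in auto)
  then show ?thesis using total Gp(2) by simp
qed

theorem energy_growth:
  assumes t: "0 \<le> t" "t < T"
  shows "energy s t \<le> energy s 0 * exp (growth_rate * energy 0 0)"
proof -
  \<comment> \<open>The derivative of the exponent is - 2 \<nu> * growth_rate times the
    \<alpha>-energy and cancels the part of the flux that dissipation does not absorb.\<close>
  define F where "F u = energy s u * exp (growth_rate * energy 0 u)" for u
  have le: "F t \<le> F 0"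
  proof (cases "t = 0")
    case False
    show ?thesis
    proof (rule DERIV_nonpos_imp_decreasing_open[of 0 t F])
      show "continuous_on {0..t} F"
        unfolding F_def using t s_nonneg
        by (intro continuous_intros continuous_on_subset[OF energy_continuous]) auto
      fix u assume u: "0 < u" "u < t"
      have uT: "u < T" using u t by simp
      define J where "J = (\<Sum>\<^sub>\<infinity>k\<in>M_set. laplace_symbol s k * (c u k \<bullet> bil (c u) (c u) k))"
      define Y' where "Y' = - 2 * \<nu> * energy (s + \<alpha>) u - 2 * J"
      have d1: "(energy s has_real_derivative Y') (at u)"
        unfolding Y'_def J_def by (rule energy_balance[OF u(1) uT])
      have d2: "(energy 0 has_real_derivative - 2 * \<nu> * energy \<alpha> u) (at u)" by (rule energy_0_derivative[OF u(1) uT])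
      have "(F has_real_derivative Y' * exp (growth_rate * energy 0 u) + (exp (growth_rate * energy 0 u) * (growth_rate * (- 2 * \<nu> * energy \<alpha> u))) * energy s u) (at u)"
        unfolding F_def by (intro DERIV_mult' DERIV_mult d1 DERIV_fun_exp DERIV_cmult d2)
      moreover have "Y' * exp (growth_rate * energy 0 u) + (exp (growth_rate * energy 0 u) * (growth_rate * (- 2 * \<nu> * energy \<alpha> u))) * energy s u \<le> 0"
      proof -
        have "\<bar>J\<bar> \<le> 324\<^sup>2 * triad_const\<^sup>2 / (4 * \<nu>) * energy \<alpha> u * energy s u + \<nu> * energy (s + \<alpha>) u"
          unfolding J_def by (rule flux_bound) (use u uT in auto)
        then have "Y' \<le> 2 * (324\<^sup>2 * triad_const\<^sup>2 / (4 * \<nu>) * energy \<alpha> u * energy s u)"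
          unfolding Y'_def by linarith
        also have "\<dots> = growth_rate * (2 * \<nu> * energy \<alpha> u) * energy s u"
          using nu by (simp add: growth_rate_def power2_eq_square)
        finally have "exp (growth_rate * energy 0 u) * (Y' - growth_rate * (2 * \<nu> * energy \<alpha> u) * energy s u) \<le> 0"
          by (simp add: mult_nonneg_nonpos)
        then show ?thesis by (simp add: algebra_simps)
      qed
      ultimately show "\<exists>y. (F has_real_derivative y) (at u) \<and> y \<le> 0" by blast
    qed (use t False in simp)
  qed simp
  \<comment> \<open>The exponential in F t is at least 1 and is dropped; at time 0 it provides the
    constant.\<close>
  have "energy s t * 1 \<le> F t"
    unfolding F_def using energy_nonneg growth_rate_nonneg
    by (intro mult_left_mono) simp_all
  with le show ?thesis by (simp add: F_def)
qed

text \<open>The fundamental theorem asks for the derivative inside the interval only. For rough data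
  the \<alpha>-energy may diverge at 0, and its integrability up to 0 is part of the
  conclusion.\<close>

theorem energy_equality:
  assumes t: "0 \<le> t" "t < T"
  shows "(energy \<alpha> has_integral (energy 0 0 - energy 0 t) / (2 * \<nu>)) {0..t}"
proof -
  have "((\<lambda>u. - 2 * \<nu> * energy \<alpha> u) has_integral (energy 0 t - energy 0 0)) {0..t}"
  proof (rule fundamental_theorem_of_calculus_interior[OF t(1)])
    show "continuous_on {0..t} (energy 0)"
      using t s_nonneg by (intro continuous_on_subset[OF energy_continuous]) auto
    show "(energy 0 has_vector_derivative - 2 * \<nu> * energy \<alpha> u) (at u)" if "u \<in> {0<..<t}" for u
      using energy_0_derivative[of u] that t by (simp add: has_real_derivative_iff_has_vector_derivative)
  qed
  from has_integral_mult_right[OF this, of "- 1 / (2 * \<nu>)"]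
  have "((\<lambda>u. - 1 / (2 * \<nu>) * (- 2 * \<nu> * energy \<alpha> u)) has_integral - 1 / (2 * \<nu>) * (energy 0 t - energy 0 0)) {0..t}" .
  moreover have "(\<lambda>u. - 1 / (2 * \<nu>) * (- 2 * \<nu> * energy \<alpha> u)) = energy \<alpha>"
    using nu by (simp add: fun_eq_iff)
  moreover have "- 1 / (2 * \<nu>) * (energy 0 t - energy 0 0) = (energy 0 0 - energy 0 t) / (2 * \<nu>)"
    using nu by (simp add: divide_simps)
  ultimately show ?thesis by (simp only:)
qed

end


subsection \<open>Global solutions of the coefficient system\<close>

context hypodissipative
begin

text \<open>The symbol dominates |k|^(2 s) because 2\<pi> \<ge> 1. This links the H^s norm of the a
  priori bound to the sup norm of the truncation.\<close>

lemma mode_bound: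
  assumes k: "k \<in> M_set" and E: "laplace_symbol s k * (norm z)\<^sup>2 \<le> Q"
  shows "norm z \<le> sqrt Q * freq k powr (- s)"
proof -
  have f: "0 < freq k" "1 \<le> freq k" using freq_pos[OF k] freq_ge_1[OF k] by auto
  have "freq k powr (2 * s) \<le> laplace_symbol s k"
    unfolding laplace_symbol_freq[OF k] using f pi_gt3 s_nonneg
    by (intro powr_mono2) (auto intro: order_trans[of _ "1 * freq k"])
  then have "freq k powr (2 * s) * (norm z)\<^sup>2 \<le> Q"
    using mult_right_mono[of _ _ "(norm z)\<^sup>2"] E by fastforce
  moreover have "freq k powr (2 * s) * (norm z)\<^sup>2 = (freq k powr s * norm z)\<^sup>2"
    by (simp add: power_mult_distrib power2_eq_square flip: powr_add)
  ultimately have "freq k powr s * norm z \<le> sqrt Q"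
    by (simp add: real_le_rsqrt)
  then have "freq k powr (- s) * (freq k powr s * norm z) \<le> freq k powr (- s) * sqrt Q"
    by (intro mult_left_mono) auto
  moreover have "freq k powr (- s) * (freq k powr s * norm z) = norm z"
  proof -
    have "freq k powr (- s) * freq k powr s = 1" using f by (simp flip: powr_add)
    then show ?thesis by (simp only: mult.assoc[symmetric] mult_1)
  qed
  ultimately show ?thesis by (simp only: mult.commute[of "sqrt Q"])
qed

text \<open>
  The a priori bound keeps the truncated solution in the region where the truncation is inactive;
  the length of the time step does not depend on the time already reached.
\<close>

theorem global_solution:
  assumes c0: "\<And>k. k \<in> M_set \<Longrightarrow> c0 (- k) = cnj (c0 k)"
    and Hs: "(\<lambda>k. laplace_symbol s k * (norm (c0 k))\<^sup>2) summable_on M_set"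
  obtains c R where "0 \<le> R" "\<And>T. solves c0 (\<lambda>t. bil (c t) (c t)) c T"
    "\<And>t k. 0 \<le> t \<Longrightarrow> k \<in> M_set \<Longrightarrow> norm (c t k) \<le> R * freq k powr (- s)"
    "\<And>t k. 0 \<le> t \<Longrightarrow> k \<in> M_set \<Longrightarrow> c t (- k) = cnj (c t k)"
proof -
  define e0 where "e0 = (\<Sum>\<^sub>\<infinity>k\<in>M_set. laplace_symbol 0 k * (norm (c0 k))\<^sup>2)"
  define es where "es = (\<Sum>\<^sub>\<infinity>k\<in>M_set. laplace_symbol s k * (norm (c0 k))\<^sup>2)"
  define Q where "Q = es * exp (growth_rate * e0)"
  have es0: "0 \<le> es" "0 \<le> e0" unfolding es_def e0_def
    by (intro infsum_nonneg mult_nonneg_nonneg laplace_symbol_nonneg zero_le_power2)+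
  have esQ: "es \<le> Q" using mult_left_mono[of 1 "exp (growth_rate * e0)" es] es0 growth_rate_nonneg by (simp add: Q_def)
  \<comment> \<open>Leaves room for sqrt Q from the a priori bound plus 1 from the nonlinear growth
    over one time step.\<close>
  define R where "R = 2 * sqrt Q + 1"
  have Q0: "0 \<le> Q" using es0 by (simp add: Q_def)
  have R0: "0 \<le> R" using Q0 by (simp add: R_def)
  obtain c where sol: "\<And>T. solves c0 (\<lambda>t. trunc_bil R (c t)) c T"
    and real: "\<And>t k. 0 \<le> t \<Longrightarrow> k \<in> M_set \<Longrightarrow> c t (- k) = cnj (c t k)"
    using trunc_exists[OF R0, of c0] c0 by metis
  \<comment> \<open>With L = 1 / h the factor L^(-theta) is 1 / K, and exp (L u) \<le> exp 1 for u
    \<le> h; so the Duhamel part over a step of length h is at most |k|^(-s).\<close>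
  define K where "K = bil_const s * R * R * \<nu> powr (theta - 1) * exp 1 + 1"
  have K: "1 \<le> K" using R0 bil_const_nonneg by (simp add: K_def)
  define h where "h = K powr (- (1 / theta))"
  have h: "0 < h" using K by (simp add: h_def)
  have hK: "(1 / h) powr (- theta) = 1 / K"
    using K theta_bounds(1) by (simp add: h_def powr_powr powr_minus_divide powr_divide flip: powr_minus)
  have step: "norm (c t k) \<le> R * freq k powr (- s)"
    if t0: "0 \<le> t0" and small: "\<And>k. k \<in> M_set \<Longrightarrow> norm (c t0 k) \<le> sqrt Q * freq k powr (- s)"
      and t: "t0 \<le> t" "t \<le> t0 + h" and k: "k \<in> M_set" for t0 t k
  proof -
    define u where "u = t - t0"
    have u: "0 \<le> u" "u \<le> h" "t = t0 + u" using t by (simp_all add: u_def)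
    have S: "solves (c t0) (\<lambda>t. trunc_bil R (c (t0 + t))) (\<lambda>t. c (t0 + t)) u"
      using solves_shift[OF sol[of "t0 + u"] t0] u by simp
    have rk: "0 < rate k" by (rule rate_pos[OF k])
    have "norm (c t k) \<le> exp (- rate k * u) * norm (c t0 k) + norm (duhamel_int (rate k) (\<lambda>\<tau>. trunc_bil R (c (t0 + \<tau>)) k) u)"
      using solvesD(3)[OF S k u(1) order_refl] norm_triangle_ineq4[of "exp (- rate k * u) *\<^sub>R c t0 k"] by (simp add: u(3))
    also have "\<dots> \<le> 1 * (sqrt Q * freq k powr (- s)) + 1 * freq k powr (- s)"
    proof (rule add_mono)
      show "exp (- rate k * u) * norm (c t0 k) \<le> 1 * (sqrt Q * freq k powr (- s))"
        using rk u Q0 by (intro mult_mono small k) auto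
      have "norm (duhamel_int (rate k) (\<lambda>\<tau>. trunc_bil R (c (t0 + \<tau>)) k) u)
        \<le> bil_const s * R * R * \<nu> powr (theta - 1) * (1 / h) powr (- theta) * exp (1 / h * u) * freq k powr (- s - gap / 2)"
        by (rule trunc_duhamel_bound[OF k R0 u(1)]) (use h solvesD(1)[OF S] in auto)
      also have "\<dots> \<le> bil_const s * R * R * \<nu> powr (theta - 1) * (1 / h) powr (- theta) * exp 1 * freq k powr (- s)"
        using R0 bil_const_nonneg h u freq_powr_gap_le[OF k] by (intro mult_mono mult_nonneg_nonneg) (auto simp: divide_le_eq)
      also have "\<dots> = (K - 1) / K * freq k powr (- s)" by (simp add: hK K_def)
      also have "\<dots> \<le> 1 * freq k powr (- s)" using K by (intro mult_right_mono) auto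
      finally show "norm (duhamel_int (rate k) (\<lambda>\<tau>. trunc_bil R (c (t0 + \<tau>)) k) u) \<le> 1 * freq k powr (- s)" .
    qed
    also have "\<dots> = (sqrt Q + 1) * freq k powr (- s)" by (simp add: distrib_right)
    also have "\<dots> \<le> R * freq k powr (- s)" using Q0 by (intro mult_right_mono) (auto simp: R_def)
    finally show ?thesis .
  qed
  have czero: "c 0 k = c0 k" if "k \<in> M_set" for k
    using solvesD(3)[OF sol[of 0] that, of 0] by (simp add: duhamel_int_def)
  have es_term: "laplace_symbol s k * (norm (c0 k))\<^sup>2 \<le> es" if "k \<in> M_set" for k
    unfolding es_def using finite_sum_le_infsum[OF Hs, of "{k}"] that laplace_symbol_nonneg by simp
  have start: "norm (c 0 k) \<le> sqrt Q * freq k powr (- s)" if "k \<in> M_set" for k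
    by (rule mode_bound[OF that]) (use es_term[OF that] esQ czero[OF that] in simp)
  \<comment> \<open>Below R the truncation is inactive, so the energy estimate of the true system
    applies and returns the smaller bound sqrt Q.\<close>
  have apriori: "norm (c t k) \<le> sqrt Q * freq k powr (- s)"
    if T: "0 < T" and bd: "\<And>t k. 0 \<le> t \<Longrightarrow> t \<le> T \<Longrightarrow> k \<in> M_set \<Longrightarrow> norm (c t k) \<le> R * freq k powr (- s)"
      and t: "0 \<le> t" "t < T" and k: "k \<in> M_set" for T t k
  proof -
    have S: "solves c0 (\<lambda>t. bil (c t) (c t)) c T"
      by (rule solves_cong[OF sol]) (use bd trunc_bil_eq in auto)
    interpret real_solution \<alpha> \<nu> s c0 c T R
      by unfold_locales (use T R0 S bd real Hs in auto)
    have e: "energy s 0 = es" "energy 0 0 = e0"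
      unfolding energy_def es_def e0_def by (rule infsum_cong, simp add: czero)+
    have "energy s t \<le> Q" using energy_growth[OF t] by (simp add: e Q_def)
    moreover have "laplace_symbol s k * (norm (c t k))\<^sup>2 \<le> energy s t"
    proof -
      obtain B where B: "B summable_on M_set" "\<And>j. j \<in> M_set \<Longrightarrow> laplace_symbol s j * (norm (c t j))\<^sup>2 \<le> B j"
        using energy_domination t by (metis less_imp_le)
      have "(\<lambda>j. laplace_symbol s j * (norm (c t j))\<^sup>2) summable_on M_set"
        by (rule summable_on_comparison_test[OF B(1)]) (use B(2) laplace_symbol_nonneg in auto)
      then show ?thesis
        unfolding energy_def using finite_sum_le_infsum[of _ M_set "{k}"] k laplace_symbol_nonneg by fastforce
    qed
    ultimately show ?thesis by (intro mode_bound[OF k]) simp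
  qed
  \<comment> \<open>The a priori bound on [0, T] is strict in t < T; hence the restart takes place
    at T - h / 2, and each round advances by h / 2.\<close>
  have reach: "\<forall>t k. 0 \<le> t \<longrightarrow> t \<le> h + real n * (h / 2) \<longrightarrow> k \<in> M_set \<longrightarrow> norm (c t k) \<le> R * freq k powr (- s)" for n
  proof (induction n)
    case 0
    show ?case using step[of 0] start by auto
  next
    case (Suc n)
    define T where "T = h + real n * (h / 2)"
    have T: "h \<le> T" "h + real (Suc n) * (h / 2) = T + h / 2" using h by (simp_all add: T_def algebra_simps add_divide_distrib)
    have T0: "0 < T" using T(1) h by linarith
    have bdT: "norm (c t k) \<le> R * freq k powr (- s)" if "0 \<le> t" "t \<le> T" "k \<in> M_set" for t k
      using Suc that by (simp add: T_def)
    have "norm (c t k) \<le> R * freq k powr (- s)" if t: "0 \<le> t" "t \<le> T + h / 2" and k: "k \<in> M_set" for t k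
    proof (cases "t \<le> T")
      case True
      then show ?thesis using Suc t k by (simp add: T_def)
    next
      case False
      show ?thesis
      proof (rule step[OF _ _ _ _ k])
        show "0 \<le> T - h / 2" "T - h / 2 \<le> t" "t \<le> T - h / 2 + h" using h T t False by auto
        show "norm (c (T - h / 2) j) \<le> sqrt Q * freq j powr (- s)" if "j \<in> M_set" for j
          by (rule apriori[of T]) (use h T(1) T0 bdT that in auto)
      qed
    qed
    then show ?case unfolding T(2) by blast
  qed
  have bd: "norm (c t k) \<le> R * freq k powr (- s)" if t: "0 \<le> t" and k: "k \<in> M_set" for t k
  proof -
    obtain n :: nat where "t / (h / 2) < n" using reals_Archimedean2 by blast
    then have "t \<le> h + real n * (h / 2)" using h by (simp add: field_simps)
    then show ?thesis using reach t k by blast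
  qed
  have "solves c0 (\<lambda>t. bil (c t) (c t)) c T" for T
    by (rule solves_cong[OF sol]) (use bd trunc_bil_eq in auto)
  then show ?thesis using that R0 bd real by blast
qed

text \<open>Both solutions are bounded, hence solve the truncated system for a common R, where
  uniqueness is known.\<close>

theorem solution_unique:
  assumes c: "solves c0 (\<lambda>t. bil (c t) (c t)) c T" "\<And>t k. 0 \<le> t \<Longrightarrow> t \<le> T \<Longrightarrow> k \<in> M_set \<Longrightarrow> norm (c t k) \<le> A * freq k powr (- s)"
    and d: "solves c0 (\<lambda>t. bil (d t) (d t)) d T" "\<And>t k. 0 \<le> t \<Longrightarrow> t \<le> T \<Longrightarrow> k \<in> M_set \<Longrightarrow> norm (d t k) \<le> B * freq k powr (- s)"
    and t: "0 \<le> t" "t \<le> T" and k: "k \<in> M_set"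
  shows "c t k = d t k"
proof -
  define R where "R = max 0 (max A B)"
  have R: "0 \<le> R" "A \<le> R" "B \<le> R" by (auto simp: R_def)
  have cR: "norm (c t k) \<le> R * freq k powr (- s)" "norm (d t k) \<le> R * freq k powr (- s)"
    if "0 \<le> t" "t \<le> T" "k \<in> M_set" for t k
    using c(2)[OF that] d(2)[OF that] mult_right_mono[OF R(2), of "freq k powr (- s)"] mult_right_mono[OF R(3), of "freq k powr (- s)"]
    by auto
  have "solves c0 (\<lambda>t. trunc_bil R (c t)) c T" "solves c0 (\<lambda>t. trunc_bil R (d t)) d T"
    by (rule solves_cong[OF c(1)], simp add: trunc_bil_eq cR) (rule solves_cong[OF d(1)], simp add: trunc_bil_eq cR)
  from trunc_unique[OF this R(1) t k] show ?thesis .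
qed

end


subsection \<open>Smoothness in space and time\<close>

text \<open>Uniform only on intervals away from 0, since no decay beyond that of the data is
  available as t tends to 0.\<close>

definition rapid :: "(real \<Rightarrow> int^3 \<Rightarrow> complex) \<Rightarrow> bool" where
  "rapid g \<longleftrightarrow> (\<forall>k\<in>M_set. continuous_on {0<..} (\<lambda>t. g t k)) \<and>
    (\<forall>d T r. 0 < d \<longrightarrow> (\<exists>C\<ge>0. \<forall>t\<in>{d..T}. \<forall>k\<in>M_set. norm (g t k) \<le> C * freq k powr (- r)))"

lemma rapidD:
  assumes "rapid g" "0 < d"
  obtains C where "0 \<le> C" "\<And>t k. d \<le> t \<Longrightarrow> t \<le> T \<Longrightarrow> k \<in> M_set \<Longrightarrow> norm (g t k) \<le> C * freq k powr (- r)"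
proof -
  have "\<exists>C\<ge>0. \<forall>t\<in>{d..T}. \<forall>k\<in>M_set. norm (g t k) \<le> C * freq k powr (- r)"
    using assms unfolding rapid_def by blast
  then show ?thesis using that by force
qed

lemma rapidI:
  assumes "\<And>k. k \<in> M_set \<Longrightarrow> continuous_on {0<..} (\<lambda>t. g t k)"
    "\<And>d T r. 0 < d \<Longrightarrow> \<exists>C\<ge>0. \<forall>t k. d \<le> t \<longrightarrow> t \<le> T \<longrightarrow> k \<in> M_set \<longrightarrow> norm (g t k) \<le> C * freq k powr (- r)"
  shows "rapid g"
  using assms unfolding rapid_def by fastforce

lemma rapid_add:
  assumes g: "rapid g" and h: "rapid h" shows "rapid (\<lambda>t k. g t k + h t k)"
proof (rule rapidI)
  show "continuous_on {0<..} (\<lambda>t. g t k + h t k)" if "k \<in> M_set" for k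
    using g h that by (intro continuous_on_add) (auto simp: rapid_def)
  fix d T r :: real assume d: "0 < d"
  obtain C where C: "0 \<le> C" "\<And>t k. d \<le> t \<Longrightarrow> t \<le> T \<Longrightarrow> k \<in> M_set \<Longrightarrow> norm (g t k) \<le> C * freq k powr (- r)"
    using rapidD[OF g d] by blast
  obtain D where D: "0 \<le> D" "\<And>t k. d \<le> t \<Longrightarrow> t \<le> T \<Longrightarrow> k \<in> M_set \<Longrightarrow> norm (h t k) \<le> D * freq k powr (- r)"
    using rapidD[OF h d] by blast
  have "norm (g t k + h t k) \<le> (C + D) * freq k powr (- r)" if "d \<le> t" "t \<le> T" "k \<in> M_set" for t k
    using norm_triangle_ineq[of "g t k" "h t k"] C(2)[OF that] D(2)[OF that] by (simp add: distrib_right)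
  then show "\<exists>C\<ge>0. \<forall>t k. d \<le> t \<longrightarrow> t \<le> T \<longrightarrow> k \<in> M_set \<longrightarrow> norm (g t k + h t k) \<le> C * freq k powr (- r)"
    using C(1) D(1) by (intro exI[of _ "C + D"]) auto
qed

lemma rapid_symbol:
  assumes g: "rapid g" and m: "\<And>k. k \<in> M_set \<Longrightarrow> norm (m k) \<le> K * freq k powr q"
  shows "rapid (\<lambda>t k. m k * g t k)"
proof (rule rapidI)
  show "continuous_on {0<..} (\<lambda>t. m k * g t k)" if "k \<in> M_set" for k
    using g that by (intro continuous_on_mult continuous_on_const) (auto simp: rapid_def)
  fix d T r :: real assume d: "0 < d"
  obtain C where C: "0 \<le> C" "\<And>t k. d \<le> t \<Longrightarrow> t \<le> T \<Longrightarrow> k \<in> M_set \<Longrightarrow> norm (g t k) \<le> C * freq k powr (- (r + q))"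
    using rapidD[OF g d] by blast
  have "norm (m k * g t k) \<le> (\<bar>K\<bar> * C) * freq k powr (- r)" if "d \<le> t" "t \<le> T" "k \<in> M_set" for t k
  proof -
    have "norm (m k) \<le> \<bar>K\<bar> * freq k powr q"
      using m[OF that(3)] mult_right_mono[OF abs_ge_self[of K], of "freq k powr q"] by simp
    then have "norm (m k * g t k) \<le> (\<bar>K\<bar> * freq k powr q) * (C * freq k powr (- (r + q)))"
      unfolding norm_mult using C(2)[OF that] by (intro mult_mono) auto
    also have "\<dots> = (\<bar>K\<bar> * C) * (freq k powr q * freq k powr (- (r + q)))" by (simp only: mult_ac)
    also have "freq k powr q * freq k powr (- (r + q)) = freq k powr (- r)" by (simp flip: powr_add)
    finally show ?thesis .
  qed
  then show "\<exists>C\<ge>0. \<forall>t k. d \<le> t \<longrightarrow> t \<le> T \<longrightarrow> k \<in> M_set \<longrightarrow> norm (m k * g t k) \<le> C * freq k powr (- r)"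
    using C(1) by (intro exI[of _ "\<bar>K\<bar> * C"]) auto
qed

lemma rapid_bil:
  assumes g: "rapid g" and h: "rapid h" shows "rapid (\<lambda>t. bil (g t) (h t))"
proof (rule rapidI)
  show "continuous_on {0<..} (\<lambda>t. bil (g t) (h t) k)" if "k \<in> M_set" for k
    using g h that by (intro bil_continuous) (auto simp: rapid_def)
  fix d T r :: real assume d: "0 < d"
  \<comment> \<open>The quadratic term decays like |k|^(lam - 2 q); this q makes the exponent at
    most -r.\<close>
  define q where "q = max 0 ((r + lam) / 2)"
  have q: "0 \<le> q" "r + lam \<le> 2 * q" by (simp_all add: q_def max_def)
  obtain C where C: "0 \<le> C" "\<And>t k. d \<le> t \<Longrightarrow> t \<le> T \<Longrightarrow> k \<in> M_set \<Longrightarrow> norm (g t k) \<le> C * freq k powr (- q)"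
    using rapidD[OF g d] by blast
  obtain D where D: "0 \<le> D" "\<And>t k. d \<le> t \<Longrightarrow> t \<le> T \<Longrightarrow> k \<in> M_set \<Longrightarrow> norm (h t k) \<le> D * freq k powr (- q)"
    using rapidD[OF h d] by blast
  have "norm (bil (g t) (h t) k) \<le> (bil_const q * C * D) * freq k powr (- r)" if "d \<le> t" "t \<le> T" "k \<in> M_set" for t k
  proof -
    have "norm (bil (g t) (h t) k) \<le> (bil_const q * C * D) * freq k powr (lam - 2 * q)"
      using C D that by (intro bil_bound q) auto
    also have "\<dots> \<le> (bil_const q * C * D) * freq k powr (- r)"
    proof (intro mult_left_mono powr_mono)
      show "lam - 2 * q \<le> - r" using q by linarith
    qed (use C D bil_const_nonneg freq_ge_1 that in auto)
    finally show ?thesis .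
  qed
  then show "\<exists>C\<ge>0. \<forall>t k. d \<le> t \<longrightarrow> t \<le> T \<longrightarrow> k \<in> M_set \<longrightarrow> norm (bil (g t) (h t) k) \<le> C * freq k powr (- r)"
    using C(1) D(1) bil_const_nonneg by (intro exI[of _ "bil_const q * C * D"]) auto
qed

text \<open>Only time derivatives are counted: space derivatives multiply by symbols of polynomial
  growth, which rapid decay absorbs.\<close>

fun smooth_fam :: "nat \<Rightarrow> (real \<Rightarrow> int^3 \<Rightarrow> complex) \<Rightarrow> bool" where
  "smooth_fam 0 g \<longleftrightarrow> rapid g"
| "smooth_fam (Suc n) g \<longleftrightarrow> rapid g \<and>
    (\<exists>g'. (\<forall>k\<in>M_set. \<forall>t>0. ((\<lambda>t. g t k) has_vector_derivative g' t k) (at t)) \<and> smooth_fam n g')"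

lemma smooth_fam_SucI:
  assumes "rapid g" "\<And>k t. k \<in> M_set \<Longrightarrow> 0 < t \<Longrightarrow> ((\<lambda>t. g t k) has_vector_derivative g' t k) (at t)" "smooth_fam n g'"
  shows "smooth_fam (Suc n) g"
  unfolding smooth_fam.simps using assms by blast

lemma smooth_fam_rapid: "smooth_fam n g \<Longrightarrow> rapid g"
  by (cases n) auto

lemma smooth_fam_Suc_D: "smooth_fam (Suc n) g \<Longrightarrow> smooth_fam n g"
proof (induction n arbitrary: g)
  case (Suc n)
  then obtain g' where "rapid g" "\<forall>k\<in>M_set. \<forall>t>0. ((\<lambda>t. g t k) has_vector_derivative g' t k) (at t)" "smooth_fam (Suc n) g'"
    by auto
  then show ?case using Suc.IH[of g'] by auto
qed simp

lemma smooth_fam_add: "smooth_fam n g \<Longrightarrow> smooth_fam n h \<Longrightarrow> smooth_fam n (\<lambda>t k. g t k + h t k)"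
proof (induction n arbitrary: g h)
  case 0
  then show ?case by (simp add: rapid_add)
next
  case (Suc n)
  obtain g' where g': "\<forall>k\<in>M_set. \<forall>t>0. ((\<lambda>t. g t k) has_vector_derivative g' t k) (at t)" "smooth_fam n g'"
    using Suc.prems(1) by auto
  obtain h' where h': "\<forall>k\<in>M_set. \<forall>t>0. ((\<lambda>t. h t k) has_vector_derivative h' t k) (at t)" "smooth_fam n h'"
    using Suc.prems(2) by auto
  show ?case
  proof (rule smooth_fam_SucI[OF _ _ Suc.IH[OF g'(2) h'(2)]])
    show "((\<lambda>t. g t k + h t k) has_vector_derivative g' t k + h' t k) (at t)" if "k \<in> M_set" "0 < t" for k t
      using g'(1) h'(1) that by (intro has_vector_derivative_add) auto
    show "rapid (\<lambda>t k. g t k + h t k)" using Suc.prems by (intro rapid_add) auto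
  qed
qed

lemma smooth_fam_symbol:
  assumes m: "\<And>k. k \<in> M_set \<Longrightarrow> norm (m k) \<le> K * freq k powr q"
  shows "smooth_fam n g \<Longrightarrow> smooth_fam n (\<lambda>t k. m k * g t k)"
proof (induction n arbitrary: g)
  case 0
  then show ?case using rapid_symbol[OF _ m] by simp
next
  case (Suc n)
  obtain g' where g': "\<forall>k\<in>M_set. \<forall>t>0. ((\<lambda>t. g t k) has_vector_derivative g' t k) (at t)" "smooth_fam n g'"
    using Suc.prems by auto
  show ?case
  proof (rule smooth_fam_SucI[OF _ _ Suc.IH[OF g'(2)]])
    show "((\<lambda>t. m k * g t k) has_vector_derivative m k * g' t k) (at t)" if "k \<in> M_set" "0 < t" for k t
      using g'(1) that by (intro has_vector_derivative_mult_right) auto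
    show "rapid (\<lambda>t k. m k * g t k)" using Suc.prems by (intro rapid_symbol[OF _ m]) auto
  qed
qed

lemma bil_has_derivative:
  assumes k: "k \<in> M_set"
    and g: "\<And>p. p \<in> M_set \<Longrightarrow> ((\<lambda>t. g t p) has_vector_derivative g' p) (at t)"
    and h: "\<And>p. p \<in> M_set \<Longrightarrow> ((\<lambda>t. h t p) has_vector_derivative h' p) (at t)"
  shows "((\<lambda>t. bil (g t) (h t) k) has_vector_derivative bil (g t) h' k + bil g' (h t) k) (at t)"
proof -
  have "((\<lambda>t. bil (g t) (h t) k) has_vector_derivative
     (\<Sum>p\<in>pairs k. (\<i> * coef k p * g t p) * h' (k - p) + (\<i> * coef k p * g' p) * h t (k - p))) (at t)"
    unfolding bil_def
    by (intro has_vector_derivative_sum has_vector_derivative_mult has_vector_derivative_mult_right g h pairs_M_set)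
  then show ?thesis by (simp add: bil_def sum.distrib)
qed

lemma smooth_fam_bil: "smooth_fam n g \<Longrightarrow> smooth_fam n h \<Longrightarrow> smooth_fam n (\<lambda>t. bil (g t) (h t))"
proof (induction n arbitrary: g h)
  case 0
  then show ?case by (simp add: rapid_bil)
next
  case (Suc n)
  obtain g' where g': "\<forall>k\<in>M_set. \<forall>t>0. ((\<lambda>t. g t k) has_vector_derivative g' t k) (at t)" "smooth_fam n g'"
    using Suc.prems(1) by auto
  obtain h' where h': "\<forall>k\<in>M_set. \<forall>t>0. ((\<lambda>t. h t k) has_vector_derivative h' t k) (at t)" "smooth_fam n h'"
    using Suc.prems(2) by auto
  show ?case
  proof (rule smooth_fam_SucI)
    show "((\<lambda>t. bil (g t) (h t) k) has_vector_derivative bil (g t) (h' t) k + bil (g' t) (h t) k) (at t)"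
      if "k \<in> M_set" "0 < t" for k t
      using g'(1) h'(1) that by (intro bil_has_derivative) auto
    show "smooth_fam n (\<lambda>t k. bil (g t) (h' t) k + bil (g' t) (h t) k)"
      by (rule smooth_fam_add[OF Suc.IH[OF smooth_fam_Suc_D[OF Suc.prems(1)] h'(2)]
            Suc.IH[OF g'(2) smooth_fam_Suc_D[OF Suc.prems(2)]]])
    show "rapid (\<lambda>t. bil (g t) (h t))" using Suc.prems by (intro rapid_bil) auto
  qed
qed

text \<open>Bootstrap on the order: the system expresses the time derivative through c itself, so n
  derivatives of c give n + 1.\<close>

lemma smooth_fam_solution:
  assumes c: "rapid c"
    and c': "\<And>k t. k \<in> M_set \<Longrightarrow> 0 < t \<Longrightarrow> ((\<lambda>t. c t k) has_vector_derivative m k * c t k + - 1 * bil (c t) (c t) k) (at t)"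
    and m: "\<And>k. k \<in> M_set \<Longrightarrow> norm (m k) \<le> K * freq k powr q"
  shows "smooth_fam n c"
proof (induction n)
  case (Suc n)
  have one: "norm (- 1 :: complex) \<le> 1 * freq k powr 0" if "k \<in> M_set" for k
    using freq_pos[OF that] by simp
  have a: "smooth_fam n (\<lambda>t k. m k * c t k)" by (rule smooth_fam_symbol[OF m Suc])
  have b: "smooth_fam n (\<lambda>t k. - 1 * bil (c t) (c t) k)"
    by (rule smooth_fam_symbol[of "\<lambda>_. - 1" 1 0, OF one smooth_fam_bil[OF Suc Suc]])
  show ?case by (rule smooth_fam_SucI[OF c c' smooth_fam_add[OF a b]])
qed (simp add: c)

text \<open>Real parts keep the values real for arbitrary coefficients; under the reality condition
  this is the full Fourier series, by \<open>field_component\<close>.\<close>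

definition synth :: "(real \<Rightarrow> int^3 \<Rightarrow> complex) \<Rightarrow> real \<times> (real^3) \<Rightarrow> real^3" where
  "synth g z = (\<Sum>\<^sub>\<infinity>k\<in>M_set. Re (g (fst z) k * character k (snd z)) *\<^sub>R v_dir k)"

lemma character_has_derivative:
  "(character k has_derivative (\<lambda>h. character k x * (2 * pi * \<i> * (rvec k \<bullet> h)))) (at x)"
proof -
  have "((\<lambda>x. 2 * pi * \<i> * (rvec k \<bullet> x)) has_derivative (\<lambda>h. 2 * pi * \<i> * (rvec k \<bullet> h))) (at x)"
    by (intro has_derivative_mult_right has_derivative_of_real has_derivative_inner_right has_derivative_ident)
  moreover have "(exp has_derivative (*) (character k x)) (at (2 * pi * \<i> * (rvec k \<bullet> x)))"
    using DERIV_exp[of "2 * pi * \<i> * (rvec k \<bullet> x)"] by (simp add: has_field_derivative_def character_def)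
  ultimately have "((\<lambda>x. exp (2 * pi * \<i> * (rvec k \<bullet> x))) has_derivative (\<lambda>h. character k x * (2 * pi * \<i> * (rvec k \<bullet> h)))) (at x)"
    by (rule has_derivative_compose)
  then show ?thesis by (simp add: character_def [abs_def])
qed

lemma synth_summand_bound:
  assumes "k \<in> M_set" shows "norm (Re (a * character k x) *\<^sub>R v_dir k) \<le> norm a"
  using abs_Re_le_cmod[of "a * character k x"] by (simp add: norm_v_dir[OF assms] norm_mult)

lemma synth_summable:
  assumes g: "rapid g" and t: "0 < fst z"
  shows "(\<lambda>k. Re (g (fst z) k * character k (snd z)) *\<^sub>R v_dir k) summable_on M_set"
proof -
  obtain C where C: "0 \<le> C" "\<And>t k. fst z \<le> t \<Longrightarrow> t \<le> fst z \<Longrightarrow> k \<in> M_set \<Longrightarrow> norm (g t k) \<le> C * freq k powr (- 1)"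
    using rapidD[OF g t] by blast
  show ?thesis
  proof (rule summable_M_set[of 1 _ C])
    fix k assume k: "k \<in> M_set"
    show "norm (Re (g (fst z) k * character k (snd z)) *\<^sub>R v_dir k) \<le> C * freq k powr (- 1)"
      by (rule order_trans[OF synth_summand_bound[OF k] C(2)[OF order_refl order_refl k]])
  qed simp
qed

lemma synth_continuous:
  assumes g: "rapid g" shows "continuous_on ({0<..} \<times> UNIV) (synth g)"
proof -
  have S: "open ({0<..} \<times> UNIV :: (real \<times> (real^3)) set)" by (intro open_Times) auto
  have "isCont (synth g) z" if z: "z \<in> {0<..} \<times> UNIV" for z
  proof -
    define d T where "d = fst z / 2" and "T = fst z + 1"
    have d: "0 < d" "z \<in> {d<..<T} \<times> UNIV" using z by (auto simp: d_def T_def mem_Times_iff)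
    have O: "open ({d<..<T} \<times> UNIV :: (real \<times> (real^3)) set)" by (intro open_Times) auto
    obtain C where C: "0 \<le> C" "\<And>t k. d \<le> t \<Longrightarrow> t \<le> T \<Longrightarrow> k \<in> M_set \<Longrightarrow> norm (g t k) \<le> C * freq k powr (- 1)"
      using rapidD[OF g d(1)] by blast
    have "continuous_on ({d<..<T} \<times> UNIV) (synth g)"
      unfolding synth_def [abs_def]
    proof (rule continuous_on_infsum)
      fix k assume k: "k \<in> M_set"
      have "continuous_on ({d<..<T} \<times> UNIV) (\<lambda>z::real \<times> (real^3). g (fst z) k)"
        using g k d(1) unfolding rapid_def
        by (intro continuous_on_compose2[of "{0<..}" "\<lambda>t. g t k" _ fst]) (auto intro: continuous_on_fst continuous_on_id)
      then show "continuous_on ({d<..<T} \<times> UNIV) (\<lambda>z::real \<times> (real^3). Re (g (fst z) k * character k (snd z)) *\<^sub>R v_dir k)"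
        by (intro continuous_intros continuous_on_compose2[OF continuous_character[of UNIV], of _ snd]) auto
    next
      fix k :: "int^3" and z :: "real \<times> (real^3)" assume k: "k \<in> M_set" and z: "z \<in> {d<..<T} \<times> UNIV"
      show "norm (Re (g (fst z) k * character k (snd z)) *\<^sub>R v_dir k) \<le> C * freq k powr (- 1)"
        using z by (intro order_trans[OF synth_summand_bound[OF k]] C k) (auto simp: mem_Times_iff)
    next
      show "(\<lambda>k. C * freq k powr (- 1)) summable_on M_set"
        by (intro summable_on_cmult_right summable_freq_powr) simp
    qed
    then show ?thesis using d(2) unfolding continuous_on_eq_continuous_at[OF O] by blast
  qed
  then show ?thesis unfolding continuous_on_eq_continuous_at[OF S] by blast
qed

text \<open>The derivative in a fixed direction is again a synthesis, of a family with one time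
  derivative less to spare. This closed form drives the induction in
  \<open>synth_Cn\<close>.\<close>

lemma synth_has_derivative:
  assumes g: "rapid g" and g': "rapid g'"
    and der: "\<And>k t. k \<in> M_set \<Longrightarrow> 0 < t \<Longrightarrow> ((\<lambda>t. g t k) has_vector_derivative g' t k) (at t)"
    and z: "0 < fst z"
  shows "(synth g has_derivative (\<lambda>h. synth (\<lambda>t k. complex_of_real (fst h) * g' t k + (2 * pi * \<i> * (rvec k \<bullet> snd h)) * g t k) z)) (at z)"
proof -
  define d T where "d = fst z / 2" and "T = fst z + 1"
  have d: "0 < d" "z \<in> {d<..<T} \<times> UNIV" using z by (auto simp: d_def T_def mem_Times_iff)
  define f' where "f' k w h = Re ((complex_of_real (fst h) * g' (fst w) k + (2 * pi * \<i> * (rvec k \<bullet> snd h)) * g (fst w) k) * character k (snd w)) *\<^sub>R v_dir k"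
    for k :: "int^3" and w h :: "real \<times> (real^3)"
  obtain C where C: "0 \<le> C" "\<And>t k. d \<le> t \<Longrightarrow> t \<le> T \<Longrightarrow> k \<in> M_set \<Longrightarrow> norm (g t k) \<le> C * freq k powr (- 2)"
    using rapidD[OF g d(1)] by blast
  obtain D where D: "0 \<le> D" "\<And>t k. d \<le> t \<Longrightarrow> t \<le> T \<Longrightarrow> k \<in> M_set \<Longrightarrow> norm (g' t k) \<le> D * freq k powr (- 1)"
    using rapidD[OF g' d(1)] by blast
  have "((\<lambda>w. \<Sum>\<^sub>\<infinity>k\<in>M_set. Re (g (fst w) k * character k (snd w)) *\<^sub>R v_dir k) has_derivative (\<lambda>h. \<Sum>\<^sub>\<infinity>k\<in>M_set. f' k z h)) (at z)"
  proof (rule has_derivative_infsum[OF countable_M_set _ _ _ _ _ _ d(2)])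
    show "convex ({d<..<T} \<times> (UNIV :: (real^3) set))" by (intro convex_Times) auto
    show "open ({d<..<T} \<times> (UNIV :: (real^3) set))" by (intro open_Times) auto
    show "(\<lambda>k. (D + 2 * pi * C) * freq k powr (- 1)) summable_on M_set"
      by (intro summable_on_cmult_right summable_freq_powr) simp
    fix w :: "real \<times> (real^3)" assume w: "w \<in> {d<..<T} \<times> UNIV"
    then have w0: "0 < fst w" "d \<le> fst w" "fst w \<le> T" using d(1) by (auto simp: mem_Times_iff)
    show "(\<lambda>k. Re (g (fst w) k * character k (snd w)) *\<^sub>R v_dir k) summable_on M_set"
      by (rule synth_summable[OF g w0(1)])
    fix k assume k: "k \<in> M_set"
    show "((\<lambda>w. Re (g (fst w) k * character k (snd w)) *\<^sub>R v_dir k) has_derivative f' k w) (at w)"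
    proof -
      have "((\<lambda>t. g t k) has_derivative (\<lambda>\<tau>. \<tau> *\<^sub>R g' (fst w) k)) (at (fst w))"
        using der[OF k w0(1)] by (simp add: has_vector_derivative_def)
      then have 1: "((\<lambda>w. g (fst w) k) has_derivative (\<lambda>h. fst h *\<^sub>R g' (fst w) k)) (at w)"
        by (rule has_derivative_compose[OF has_derivative_fst[OF has_derivative_ident]])
      have 2: "((\<lambda>w. character k (snd w)) has_derivative (\<lambda>h. character k (snd w) * (2 * pi * \<i> * (rvec k \<bullet> snd h)))) (at w)"
        by (rule has_derivative_compose[OF has_derivative_snd[OF has_derivative_ident] character_has_derivative])
      have "((\<lambda>w. Re (g (fst w) k * character k (snd w)) *\<^sub>R v_dir k) has_derivative
         (\<lambda>h. Re (g (fst w) k * (character k (snd w) * (2 * pi * \<i> * (rvec k \<bullet> snd h))) + fst h *\<^sub>R g' (fst w) k * character k (snd w)) *\<^sub>R v_dir k)) (at w)"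
        by (intro has_derivative_scaleR_left has_derivative_Re has_derivative_mult 1 2)
      then show ?thesis
        by (rule has_derivative_eq_rhs) (simp add: f'_def fun_eq_iff scaleR_conv_of_real algebra_simps)
    qed
    fix h :: "real \<times> (real^3)"
    have f: "1 \<le> freq k" using freq_ge_1[OF k] .
    have hb: "\<bar>fst h\<bar> \<le> norm h" "norm (snd h) \<le> norm h"
      using norm_fst_le[of "fst h" "snd h"] norm_snd_le[of "snd h" "fst h"] by simp_all
    have "norm (f' k w h) \<le> norm (complex_of_real (fst h) * g' (fst w) k + (2 * pi * \<i> * (rvec k \<bullet> snd h)) * g (fst w) k)"
      unfolding f'_def by (rule synth_summand_bound[OF k])
    also have "\<dots> \<le> \<bar>fst h\<bar> * norm (g' (fst w) k) + 2 * pi * \<bar>rvec k \<bullet> snd h\<bar> * norm (g (fst w) k)"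
      by (rule order_trans[OF norm_triangle_ineq]) (simp add: norm_mult)
    also have "\<dots> \<le> norm h * (D * freq k powr (- 1)) + 2 * pi * (freq k * norm h) * (C * freq k powr (- 2))"
    proof (intro add_mono mult_mono hb D C k w0)
      show "\<bar>rvec k \<bullet> snd h\<bar> \<le> freq k * norm h"
        using Cauchy_Schwarz_ineq2[of "rvec k" "snd h"] mult_left_mono[OF hb(2), of "freq k"] by (simp add: freq_def)
    qed (use f in auto)
    also have "\<dots> = (D * freq k powr (- 1) + 2 * pi * C * (freq k powr 1 * freq k powr (- 2))) * norm h"
      using f by (simp add: algebra_simps)
    also have "freq k powr 1 * freq k powr (- 2) = freq k powr (- 1)"
      by (simp only: powr_add[symmetric]) simp
    finally show "norm (f' k w h) \<le> (D + 2 * pi * C) * freq k powr (- 1) * norm h"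
      by (simp only: distrib_right)
  qed
  then show ?thesis by (simp only: synth_def [abs_def] f'_def)
qed

text \<open>Derivatives at points of an open set see only nearby values. The lemma serves to replace
  the Frechet derivative of \<open>synth\<close> by its closed form.\<close>

lemma Cn_on_cong:
  assumes "open S"
  shows "(\<And>x. x \<in> S \<Longrightarrow> f x = g x) \<Longrightarrow> Cn_on n S f \<Longrightarrow> Cn_on n S g"
proof (induction n arbitrary: f g)
  case 0
  then show ?case by (metis Cn_on.simps(1) continuous_on_cong)
next
  case (Suc n)
  have d: "f differentiable (at x)" if "x \<in> S" for x using Suc.prems(2) that by simp
  have "g differentiable (at x)" if x: "x \<in> S" for x
  proof -
    obtain D where "(f has_derivative D) (at x)" using d[OF x] by (auto simp: differentiable_def)
    then have "(g has_derivative D) (at x)"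
      by (rule has_derivative_transform_within_open[OF _ assms x]) (rule Suc.prems(1))
    then show ?thesis by (auto simp: differentiable_def)
  qed
  moreover have "Cn_on n S (\<lambda>x. frechet_derivative g (at x) v)" for v
  proof (rule Suc.IH)
    show "Cn_on n S (\<lambda>x. frechet_derivative f (at x) v)" using Suc.prems(2) by simp
    show "frechet_derivative f (at x) v = frechet_derivative g (at x) v" if "x \<in> S" for x
      using frechet_derivative_transform_within_open[OF d[OF that] assms that Suc.prems(1)] by simp
  qed
  ultimately show ?case by simp
qed

lemma synth_Cn:
  "smooth_fam n g \<Longrightarrow> Cn_on n ({0<..} \<times> UNIV) (synth g)"
proof (induction n arbitrary: g)
  case 0
  then show ?case by (simp add: synth_continuous)
next
  case (Suc n)
  obtain g' where g': "\<And>k t. k \<in> M_set \<Longrightarrow> 0 < t \<Longrightarrow> ((\<lambda>t. g t k) has_vector_derivative g' t k) (at t)" "smooth_fam n g'" "rapid g"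
    using Suc.prems by auto
  define D where "D h = (\<lambda>t k. complex_of_real (fst h) * g' t k + (2 * pi * \<i> * (rvec k \<bullet> snd h)) * g t k)" for h :: "real \<times> (real^3)"
  have der: "(synth g has_derivative (\<lambda>h. synth (D h) z)) (at z)" if "z \<in> {0<..} \<times> UNIV" for z
    unfolding D_def by (rule synth_has_derivative[OF g'(3) smooth_fam_rapid[OF g'(2)] g'(1)]) (use that in auto)
  have S: "open ({0<..} \<times> UNIV :: (real \<times> (real^3)) set)" by (intro open_Times) auto
  have "Cn_on n ({0<..} \<times> UNIV) (\<lambda>z. frechet_derivative (synth g) (at z) h)" for h
  proof (rule Cn_on_cong[OF S])
    have "smooth_fam n (D h)"
      unfolding D_def
    proof (intro smooth_fam_add smooth_fam_symbol)
      show "smooth_fam n g'" "smooth_fam n g" using g'(2) smooth_fam_Suc_D[OF Suc.prems] by auto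
      show "norm (complex_of_real (fst h)) \<le> \<bar>fst h\<bar> * freq k powr 0" if "k \<in> M_set" for k
        using freq_pos[OF that] by simp
      show "norm (2 * pi * \<i> * (rvec k \<bullet> snd h)) \<le> (2 * pi * norm (snd h)) * freq k powr 1" if "k \<in> M_set" for k
        using Cauchy_Schwarz_ineq2[of "rvec k" "snd h"] by (simp add: norm_mult freq_def mult.commute)
    qed
    then show "Cn_on n ({0<..} \<times> UNIV) (synth (D h))" by (rule Suc.IH)
    show "synth (D h) z = frechet_derivative (synth g) (at z) h" if "z \<in> {0<..} \<times> UNIV" for z
      by (rule fun_cong[OF frechet_derivative_at[OF der[OF that]]])
  qed
  moreover have "synth g differentiable (at z)" if "z \<in> {0<..} \<times> UNIV" for z
    using der[OF that] by (auto simp: differentiable_def)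
  ultimately show ?case by simp
qed


subsection \<open>From coefficients to vector fields\<close>

definition field :: "(int^3 \<Rightarrow> complex) \<Rightarrow> real^3 \<Rightarrow> real^3" where
  "field a x = (\<Sum>\<^sub>\<infinity>k\<in>M_set. Re (a k * character k x) *\<^sub>R v_dir k)"

lemma synth_field: "synth g (t, x) = field (g t) x"
  by (simp add: synth_def field_def)

text \<open>The partial sums converge uniformly, and integration against a character over a set of
  measure 1 passes through uniform limits.\<close>

lemma series_cfourier:
  assumes a: "(\<lambda>k. norm (a k)) summable_on M_set"
  defines "U \<equiv> \<lambda>x. \<Sum>\<^sub>\<infinity>k\<in>M_set. a k * character k x"
  shows "continuous_on UNIV U" "U \<in> L2c" "cfourier U m = (if m \<in> M_set then a m else 0)"
proof -
  have nb: "norm (a k * character k x) \<le> norm (a k)" for k x by (simp add: norm_mult)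
  show c: "continuous_on UNIV U"
    unfolding U_def
    by (rule continuous_on_infsum[OF _ nb a]) (intro continuous_intros continuous_character)
  have sb: "norm (U x) \<le> (\<Sum>\<^sub>\<infinity>k\<in>M_set. norm (a k))" for x
  proof -
    have s: "(\<lambda>k. norm (a k * character k x)) summable_on M_set" using a by (simp add: norm_mult)
    have "norm (U x) \<le> (\<Sum>\<^sub>\<infinity>k\<in>M_set. norm (a k * character k x))"
      unfolding U_def by (rule norm_infsum_bound[OF s])
    then show ?thesis by (simp add: norm_mult)
  qed
  show U: "U \<in> L2c"
    by (rule L2c_bounded[OF continuous_measurable_cube[OF c] AE_I2]) (rule sb)
  define P where "P F x = (\<Sum>k\<in>F. a k * character k x)" for F x
  have PL: "P F \<in> L2c" if "finite F" for F
    unfolding P_def by (intro L2c_trig_poly) (use that in \<open>auto simp: trig_poly_def intro!: exI[of _ F] exI[of _ a]\<close>)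
  have Pf: "cfourier (P F) m = (if m \<in> F then a m else 0)" if F: "finite F" for F
  proof -
    have "cfourier (P F) m = (\<Sum>k\<in>F. a k * cfourier (character k) m)"
      unfolding P_def cfourier_def sum_distrib_right
      by (subst Bochner_Integration.integral_sum)
         (auto simp: mult.assoc intro!: integrable_mult_right integrable_mult_character L2c_character)
    also have "\<dots> = (\<Sum>k\<in>F. if m = k then a k else 0)"
      by (rule sum.cong) (auto simp: cfourier_character)
    finally show ?thesis using F by simp
  qed
  have "uniform_limit UNIV P U (finite_subsets_at_top M_set)"
    unfolding P_def [abs_def] U_def by (rule Weierstrass_m_test_general[OF nb a])
  then have lim: "((\<lambda>F. cfourier (P F) m) \<longlongrightarrow> cfourier U m) (finite_subsets_at_top M_set)"
  proof (intro tendstoI)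
    fix e :: real assume e: "0 < e" and ul: "uniform_limit UNIV P U (finite_subsets_at_top M_set)"
    have "\<forall>\<^sub>F F in finite_subsets_at_top M_set. \<forall>x\<in>UNIV. dist (P F x) (U x) < e / 2"
      using ul e by (intro uniform_limitD) auto
    moreover have "\<forall>\<^sub>F F in finite_subsets_at_top M_set. finite F \<and> F \<subseteq> M_set"
      by (rule eventually_finite_subsets_at_top_weakI) auto
    ultimately show "\<forall>\<^sub>F F in finite_subsets_at_top M_set. dist (cfourier (P F) m) (cfourier U m) < e"
    proof eventually_elim
      case (elim F)
      have i: "integrable cube (\<lambda>x. P F x * character (- m) x)" "integrable cube (\<lambda>x. U x * character (- m) x)"
        using elim by (auto intro: integrable_mult_character PL U)
      have "norm (cfourier (P F) m - cfourier U m) = norm (integral\<^sup>L cube (\<lambda>x. P F x * character (- m) x - U x * character (- m) x))"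
        unfolding cfourier_def using i by simp
      also have "\<dots> \<le> integral\<^sup>L cube (\<lambda>x. norm (P F x * character (- m) x - U x * character (- m) x))"
        by (rule integral_norm_bound)
      also have "\<dots> \<le> integral\<^sup>L cube (\<lambda>x. e / 2)"
      proof (rule integral_mono)
        show "integrable cube (\<lambda>x. norm (P F x * character (- m) x - U x * character (- m) x))"
          using i by (intro integrable_norm Bochner_Integration.integrable_diff)
        show "norm (P F x * character (- m) x - U x * character (- m) x) \<le> e / 2" for x
        proof -
          have "P F x * character (- m) x - U x * character (- m) x = (P F x - U x) * character (- m) x"
            by (simp add: left_diff_distrib)
          then show ?thesis using elim by (simp add: norm_mult dist_norm less_imp_le)
        qed
      qed simp
      also have "\<dots> = e / 2" using measure_cube by (simp del: measure_cube)
      finally show ?case using e by (simp add: dist_norm)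
    qed
  qed
  have ev: "\<forall>\<^sub>F F in finite_subsets_at_top M_set. cfourier (P F) m = (if m \<in> M_set then a m else 0)"
  proof (cases "m \<in> M_set")
    case True
    then have "\<forall>\<^sub>F F in finite_subsets_at_top M_set. finite F \<and> {m} \<subseteq> F \<and> F \<subseteq> M_set"
      unfolding eventually_finite_subsets_at_top by (intro exI[of _ "{m}"]) auto
    then show ?thesis by eventually_elim (use True in \<open>auto simp: Pf\<close>)
  next
    case False
    then show ?thesis
      by (intro eventually_finite_subsets_at_top_weakI) (auto simp: Pf)
  qed
  show "cfourier U m = (if m \<in> M_set then a m else 0)"
    by (rule tendsto_unique[OF _ lim tendsto_eventually[OF ev]]) simp
qed

lemma character_periodic: "character k (x + rvec l) = character k x"
proof -
  have e: "rvec k \<bullet> rvec l = real_of_int (\<Sum>i\<in>UNIV. k $ i * l $ i)"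
    by (simp add: inner_vec_def rvec_def)
  have "character k (rvec l) = exp (2 * of_int (\<Sum>i\<in>UNIV. k $ i * l $ i) * pi * \<i>)"
    unfolding character_def e of_real_of_int_eq by (intro arg_cong[of _ _ exp]) (simp add: mult_ac)
  also have "\<dots> = 1" by (rule exp_integer_2pi) auto
  finally have "character k (rvec l) = 1" .
  moreover have "character k (x + rvec l) = character k x * character k (rvec l)"
    by (simp add: character_def inner_add_right distrib_left exp_add)
  ultimately show ?thesis by simp
qed

lemma uminus_M_bij: "bij_betw uminus M_set M_set"
  by (rule bij_betw_byWitness[where f' = uminus]) auto

text \<open>By reality, the real part of the term at k is half the sum of the terms at k and -k;
  reindexing by the sign restores the full sum.\<close>

lemma field_component:
  assumes a: "(\<lambda>k. norm (a k)) summable_on M_set" and real: "\<And>k. k \<in> M_set \<Longrightarrow> a (- k) = cnj (a k)"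
  shows "complex_of_real (field a x $ i) = (\<Sum>\<^sub>\<infinity>k\<in>M_set. (a k * v_dir k $ i) * character k x)"
proof -
  have vb: "\<bar>v_dir k $ i\<bar> \<le> 1" for k
    using component_le_norm_cart[of "v_dir k" i] norm_v_dir_le_1[of k] by linarith
  define b where "b k = (a k * v_dir k $ i) * character k x" for k
  have nb: "norm (b k) \<le> norm (a k)" for k
    unfolding b_def using mult_left_mono[OF vb[of k], of "norm (a k)"] by (simp add: norm_mult)
  have bs: "b summable_on M_set"
    by (rule Infinite_Sum.abs_summable_summable, rule Infinite_Sum.abs_summable_on_comparison_test'[OF a nb])
  have "(\<lambda>k. Re (a k * character k x) *\<^sub>R v_dir k) summable_on M_set"
    by (rule Infinite_Sum.abs_summable_summable, rule Infinite_Sum.abs_summable_on_comparison_test'[OF a synth_summand_bound])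
  from has_sum_bounded_linear[OF bounded_linear_vec_nth[of i] has_sum_infsum[OF this]]
  have "((\<lambda>k. Re (a k * character k x) * v_dir k $ i) has_sum field a x $ i) M_set"
    by (simp add: field_def o_def)
  then have h: "((\<lambda>k. complex_of_real (Re (a k * character k x) * v_dir k $ i)) has_sum complex_of_real (field a x $ i)) M_set"
    by (rule has_sum_of_real)
  have eq: "complex_of_real (Re (a k * character k x) * v_dir k $ i) = (1/2) * b k + (1/2) * b (- k)" if "k \<in> M_set" for k
    unfolding b_def using real[OF that]
    by (simp add: v_dir_minus complex_eq_iff field_simps flip: cnj_character)
  have "((\<lambda>k. b (- k)) has_sum infsum b M_set) M_set"
    using has_sum_infsum[OF bs] by (simp only: has_sum_reindex_bij_betw[OF uminus_M_bij])
  then have "((\<lambda>k. (1/2) * b k + (1/2) * b (- k)) has_sum (1/2) * infsum b M_set + (1/2) * infsum b M_set) M_set"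
    by (intro has_sum_add has_sum_cmult_right has_sum_infsum bs)
  then have "((\<lambda>k. complex_of_real (Re (a k * character k x) * v_dir k $ i)) has_sum infsum b M_set) M_set"
    by (subst has_sum_cong[OF eq]) simp_all
  from has_sum_unique[OF h this] show ?thesis by (simp add: b_def [abs_def])
qed

lemma field_fourier:
  assumes a: "(\<lambda>k. norm (a k)) summable_on M_set" and real: "\<And>k. k \<in> M_set \<Longrightarrow> a (- k) = cnj (a k)"
  shows "field a \<in> L2_torus" "fourier (field a) k = (if k \<in> M_set then a k else 0) *s cvec (v_dir k)"
proof -
  have vb: "\<bar>v_dir k $ i\<bar> \<le> 1" for k i
    using component_le_norm_cart[of "v_dir k" i] norm_v_dir_le_1[of k] by linarith
  have ai: "(\<lambda>k. norm (a k * v_dir k $ i)) summable_on M_set" for i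
    by (rule Infinite_Sum.abs_summable_on_comparison_test'[OF a])
       (use vb mult_left_mono[OF vb] in \<open>fastforce simp: norm_mult\<close>)
  have cont: "continuous_on UNIV (field a)"
    unfolding field_def [abs_def]
    by (rule continuous_on_infsum[OF _ synth_summand_bound a]) (intro continuous_intros continuous_character)
  have "norm (field a x) \<le> (\<Sum>\<^sub>\<infinity>k\<in>M_set. norm (a k))" for x
    unfolding field_def
  proof (rule norm_infsum_le[OF has_sum_infsum has_sum_infsum[OF a]])
    show "(\<lambda>k. Re (a k * character k x) *\<^sub>R v_dir k) summable_on M_set"
      by (rule Infinite_Sum.abs_summable_summable, rule Infinite_Sum.abs_summable_on_comparison_test'[OF a synth_summand_bound])
  qed (rule synth_summand_bound)
  then have bnd: "norm ((norm (field a x))\<^sup>2) \<le> (infsum (\<lambda>k. norm (a k)) M_set)\<^sup>2" for x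
    by (simp add: power_mono)
  have m: "field a \<in> borel_measurable lebesgue"
    using cont by (intro measurable_completion) (simp add: borel_measurable_continuous_onI)
  have "integrable cube (\<lambda>x. (norm (field a x))\<^sup>2)"
    by (rule cube.integrable_const_bound[where B = "(infsum (\<lambda>k. norm (a k)) M_set)\<^sup>2"])
       (use bnd m in \<open>auto intro!: borel_measurable_power borel_measurable_norm measurable_restrict_space1\<close>)
  moreover have "torus_periodic (field a)"
    by (simp add: torus_periodic_def field_def character_periodic)
  ultimately show "field a \<in> L2_torus"
    using m by (simp add: L2_torus_def integrable_cube)
  have "fourier (field a) k $ i = ((if k \<in> M_set then a k else 0) *s cvec (v_dir k)) $ i" for i
  proof -
    have "complex_of_real (field a x $ i) = (\<Sum>\<^sub>\<infinity>k\<in>M_set. (a k * v_dir k $ i) * character k x)" for x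
      by (rule field_component[OF a]) (rule real)
    then show ?thesis unfolding fourier_nth by (simp add: series_cfourier(3)[OF ai])
  qed
  then show "fourier (field a) k = (if k \<in> M_set then a k else 0) *s cvec (v_dir k)"
    by (simp only: vec_eq_iff) simp
qed

lemma field_HdotM:
  assumes a: "(\<lambda>k. norm (a k)) summable_on M_set" and real: "\<And>k. k \<in> M_set \<Longrightarrow> a (- k) = cnj (a k)"
    and s: "(\<lambda>k. laplace_symbol s k * (norm (a k))\<^sup>2) summable_on M_set"
  shows "field a \<in> HdotM s" "k \<in> M_set \<Longrightarrow> amp (field a) k = a k"
proof -
  have F: "field a \<in> L2_torus" "fourier (field a) k = (if k \<in> M_set then a k else 0) *s cvec (v_dir k)" for k
    by (rule field_fourier[OF a], rule real, assumption)+
  show amp: "amp (field a) k = a k" if "k \<in> M_set" for k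
    by (rule amp_fourierI[OF that]) (simp add: F(2) that)
  have fa: "fourier (field a) k = amp (field a) k *s cvec (v_dir k)" for k
    unfolding F(2) using amp[of k] by (simp add: amp_outside)
  have "(\<lambda>k. laplace_symbol s k * (norm (fourier (field a) k))\<^sup>2) summable_on UNIV - {0}"
    unfolding Hdot_sum_amp(2)[OF fa]
    by (rule summable_on_cong[THEN iffD1, OF _ s]) (simp add: amp)
  moreover have "0 \<notin> M_set" using M_set_nonzero by blast
  then have "fourier (field a) 0 = 0" using F(2)[of 0] by simp
  ultimately show "field a \<in> HdotM s"
    unfolding HdotM_def Hdot_def using F by auto
qed

lemma Hdot_norm_diff:
  assumes u: "u \<in> HdotM s" and w: "w \<in> HdotM s"
  shows "(Hdot_norm b (\<lambda>x. u x - w x))\<^sup>2 = (\<Sum>\<^sub>\<infinity>k\<in>M_set. laplace_symbol b k * (norm (amp u k - amp w k))\<^sup>2)"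
    and "(\<lambda>k. laplace_symbol s k * (norm (amp u k - amp w k))\<^sup>2) summable_on M_set"
proof -
  have fd: "fourier (\<lambda>x. u x - w x) k = fourier u k - fourier w k" for k
    by (rule fourier_diff[OF HdotM_L2[OF u] HdotM_L2[OF w]])
  have am: "amp (\<lambda>x. u x - w x) k = amp u k - amp w k" for k
    unfolding amp_def fd by (simp add: sum_subtractf right_diff_distrib)
  have "fourier (\<lambda>x. u x - w x) k = amp (\<lambda>x. u x - w x) k *s cvec (v_dir k)" for k
    unfolding am fd fourier_amp[OF u, of k] fourier_amp[OF w, of k]
    by (simp add: vec_eq_iff left_diff_distrib)
  from Hdot_norm_amp[OF this] show "(Hdot_norm b (\<lambda>x. u x - w x))\<^sup>2 = (\<Sum>\<^sub>\<infinity>k\<in>M_set. laplace_symbol b k * (norm (amp u k - amp w k))\<^sup>2)"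
    by (simp only: am)
  have us: "(\<lambda>k. laplace_symbol s k * (norm (amp v k))\<^sup>2) summable_on M_set" if "v \<in> HdotM s" for v
    using that Hdot_sum_amp(2)[OF fourier_amp[OF that], of s] by (simp add: HdotM_def Hdot_def)
  have "(\<lambda>k. 2 * (laplace_symbol s k * (norm (amp u k))\<^sup>2) + 2 * (laplace_symbol s k * (norm (amp w k))\<^sup>2)) summable_on M_set"
    by (intro summable_on_add summable_on_cmult_right us u w)
  then show "(\<lambda>k. laplace_symbol s k * (norm (amp u k - amp w k))\<^sup>2) summable_on M_set"
  proof (rule summable_on_comparison_test)
    fix k
    have "(norm (amp u k - amp w k))\<^sup>2 \<le> 2 * (norm (amp u k))\<^sup>2 + 2 * (norm (amp w k))\<^sup>2"
      using norm_add_power2_le[of "amp u k" "- amp w k"] by simp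
    from mult_left_mono[OF this laplace_symbol_nonneg[of s k]]
    show "laplace_symbol s k * (norm (amp u k - amp w k))\<^sup>2
      \<le> 2 * (laplace_symbol s k * (norm (amp u k))\<^sup>2) + 2 * (laplace_symbol s k * (norm (amp w k))\<^sup>2)"
      by (simp add: algebra_simps)
  qed (simp add: laplace_symbol_nonneg)
qed


subsection \<open>Mild solutions in terms of coefficients\<close>

context hypodissipative
begin

text \<open>With continuous amplitudes the integrand is a continuous scalar function times the fixed
  vector v^k, so the Lebesgue integral of the definition agrees with the gauge integral in
  \<open>duhamel_int\<close>.\<close>

lemma duhamel_fourier:
  assumes v: "\<And>\<tau>. 0 \<le> \<tau> \<Longrightarrow> \<tau> \<le> t \<Longrightarrow> v \<tau> \<in> HdotM s"
    and cont: "\<And>k. k \<in> M_set \<Longrightarrow> continuous_on {0..t} (\<lambda>\<tau>. amp (v \<tau>) k)"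
  shows "set_integrable lborel {0..t} (\<lambda>\<tau>. dissipation_semigroup \<alpha> (\<nu> * (t - \<tau>)) (proj_M (div_tensor (v \<tau>))) k)"
    "(LINT \<tau>:{0..t}|lborel. dissipation_semigroup \<alpha> (\<nu> * (t - \<tau>)) (proj_M (div_tensor (v \<tau>))) k)
      = (if k \<in> M_set then duhamel_int (rate k) (\<lambda>\<tau>. bil (amp (v \<tau>)) (amp (v \<tau>)) k) t else 0) *s cvec (v_dir k)"
proof -
  define g where "g \<tau> = (if k \<in> M_set then bil (amp (v \<tau>)) (amp (v \<tau>)) k else 0)" for \<tau>
  define f where "f \<tau> = (exp (- rate k * (t - \<tau>)) *\<^sub>R g \<tau>) *s cvec (v_dir k)" for \<tau>
  have eq: "dissipation_semigroup \<alpha> (\<nu> * (t - \<tau>)) (proj_M (div_tensor (v \<tau>))) k = f \<tau>" if "\<tau> \<in> {0..t}" for \<tau>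
  proof -
    have "proj_M (div_tensor (v \<tau>)) k = g \<tau> *s cvec (v_dir k)"
      unfolding g_def by (rule proj_div_tensor[OF v]) (use that in auto)
    moreover have "- (\<nu> * (t - \<tau>)) * laplace_symbol \<alpha> k = - rate k * (t - \<tau>)"
      by (simp add: rate_def)
    ultimately show ?thesis
      unfolding dissipation_semigroup_def f_def by (simp add: vec_eq_iff mult.assoc)
  qed
  have bl: "bounded_linear (\<lambda>z::complex. z *s cvec (v_dir k))"
  proof (rule bounded_linear_intro)
    show "norm (z *s cvec (v_dir k)) \<le> norm z * norm (cvec (v_dir k))" for z :: complex
    proof -
      have "(norm (z *s cvec (v_dir k)))\<^sup>2 = (norm z * norm (cvec (v_dir k)))\<^sup>2"
        unfolding power_mult_distrib norm_vec_power2 by (simp add: norm_mult power_mult_distrib sum_distrib_left)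
      then show ?thesis by (simp add: power2_eq_iff_nonneg)
    qed
  qed (simp_all add: vec_eq_iff distrib_right)
  have gc: "continuous_on {0..t} g"
    unfolding g_def by (cases "k \<in> M_set") (auto intro!: bil_continuous cont)
  then have ec: "continuous_on {0..t} (\<lambda>\<tau>. exp (- rate k * (t - \<tau>)) *\<^sub>R g \<tau>)"
    by (rule duhamel_integrand_continuous)
  then have "continuous_on {0..t} f" unfolding f_def by (rule bounded_linear.continuous_on[OF bl])
  then have fi: "set_integrable lborel {0..t} f" by (rule borel_integrable_atLeastAtMost')
  then show "set_integrable lborel {0..t} (\<lambda>\<tau>. dissipation_semigroup \<alpha> (\<nu> * (t - \<tau>)) (proj_M (div_tensor (v \<tau>))) k)"
    by (subst set_integrable_cong[OF refl refl eq])
  have "(LINT \<tau>:{0..t}|lborel. dissipation_semigroup \<alpha> (\<nu> * (t - \<tau>)) (proj_M (div_tensor (v \<tau>))) k) = (LINT \<tau>:{0..t}|lborel. f \<tau>)"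
    by (rule set_lebesgue_integral_cong) (use eq in auto)
  also have "\<dots> = integral {0..t} f" by (rule set_borel_integral_eq_integral(2)[OF fi])
  also have "\<dots> = integral {0..t} (\<lambda>\<tau>. exp (- rate k * (t - \<tau>)) *\<^sub>R g \<tau>) *s cvec (v_dir k)"
    using integral_linear[OF integrable_continuous_real[OF ec] bl] by (simp add: o_def f_def [abs_def])
  also have "integral {0..t} (\<lambda>\<tau>. exp (- rate k * (t - \<tau>)) *\<^sub>R g \<tau>)
     = (if k \<in> M_set then duhamel_int (rate k) (\<lambda>\<tau>. bil (amp (v \<tau>)) (amp (v \<tau>)) k) t else 0)"
    by (simp add: g_def duhamel_int_def)
  finally show "(LINT \<tau>:{0..t}|lborel. dissipation_semigroup \<alpha> (\<nu> * (t - \<tau>)) (proj_M (div_tensor (v \<tau>))) k)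
      = (if k \<in> M_set then duhamel_int (rate k) (\<lambda>\<tau>. bil (amp (v \<tau>)) (amp (v \<tau>)) k) t else 0) *s cvec (v_dir k)" .
qed

lemma smult_v_dir_inject:
  assumes "k \<in> M_set" "a *s cvec (v_dir k) = b *s cvec (v_dir k)" shows "a = b"
proof -
  have "(a - b) *s cvec (v_dir k) = 0" using assms(2) by (simp add: vec_eq_iff left_diff_distrib)
  then have "norm (a - b) = 0" by (simp only: norm_smult_v_dir[OF assms(1), symmetric] norm_zero)
  then show ?thesis by simp
qed

lemma amp_diff_bound:
  assumes u: "u \<in> HdotM s" and w: "w \<in> HdotM s" and k: "k \<in> M_set"
  shows "norm (amp u k - amp w k) \<le> Hdot_norm s (\<lambda>x. u x - w x) * freq k powr (- s)"
proof -
  have "laplace_symbol s k * (norm (amp u k - amp w k))\<^sup>2 \<le> (Hdot_norm s (\<lambda>x. u x - w x))\<^sup>2"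
    unfolding Hdot_norm_diff(1)[OF u w]
    using finite_sum_le_infsum[OF Hdot_norm_diff(2)[OF u w], of "{k}"] k laplace_symbol_nonneg by simp
  from mode_bound[OF k this] show ?thesis
    by (simp add: Hdot_norm_def infsum_nonneg laplace_symbol_nonneg)
qed

lemma HdotM_summable:
  "u \<in> HdotM s \<Longrightarrow> (\<lambda>k. laplace_symbol s k * (norm (amp u k))\<^sup>2) summable_on M_set"
  using Hdot_sum_amp(2)[OF fourier_amp[of u s], of s] by (simp add: HdotM_def Hdot_def)

lemma amp_bounded:
  assumes "u \<in> HdotM s" obtains A where "\<And>k. k \<in> M_set \<Longrightarrow> norm (amp u k) \<le> A * freq k powr (- s)"
proof -
  have "norm (amp u k) \<le> sqrt (\<Sum>\<^sub>\<infinity>k\<in>M_set. laplace_symbol s k * (norm (amp u k))\<^sup>2) * freq k powr (- s)" if "k \<in> M_set" for k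
    by (rule mode_bound[OF that])
       (use finite_sum_le_infsum[OF HdotM_summable[OF assms], of "{k}"] that laplace_symbol_nonneg in simp)
  then show ?thesis using that by blast
qed

text \<open>Each mode inherits continuity by \<open>amp_diff_bound\<close>. The bound uniform in
  time is compactness of [0, T]: local bounds from continuity in H^s are glued by
  \<open>Bolzano\<close>.\<close>

lemma time_continuous_amp:
  assumes tc: "time_continuous s \<infinity> w"
  shows "\<And>t. 0 \<le> t \<Longrightarrow> w t \<in> HdotM s"
    "\<And>k T. k \<in> M_set \<Longrightarrow> continuous_on {0..T} (\<lambda>t. amp (w t) k)"
    "\<exists>A. \<forall>t\<in>{0..T}. \<forall>k\<in>M_set. norm (amp (w t) k) \<le> A * freq k powr (- s)"
proof -
  have I: "{t. 0 \<le> t \<and> ereal t < \<infinity>} = {0..}" by auto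
  have w: "w t \<in> HdotM s" if "0 \<le> t" for t
    using tc that unfolding time_continuous_def Let_def I by auto
  then show "\<And>t. 0 \<le> t \<Longrightarrow> w t \<in> HdotM s" .
  have lim: "((\<lambda>t. Hdot_norm s (\<lambda>x. w t x - w t0 x)) \<longlongrightarrow> 0) (at t0 within {0..})" if "0 \<le> t0" for t0
    using tc that unfolding time_continuous_def Let_def I by auto
  have "continuous_on {0..} (\<lambda>t. amp (w t) k)" if k: "k \<in> M_set" for k
    unfolding continuous_on_def
  proof
    fix t0 :: real assume t0: "t0 \<in> {0..}"
    have "((\<lambda>t. amp (w t) k - amp (w t0) k) \<longlongrightarrow> 0) (at t0 within {0..})"
    proof (rule Lim_null_comparison)
      show "\<forall>\<^sub>F t in at t0 within {0..}. norm (amp (w t) k - amp (w t0) k) \<le> Hdot_norm s (\<lambda>x. w t x - w t0 x) * freq k powr (- s)"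
        unfolding eventually_at_filter using t0 by (intro always_eventually allI impI amp_diff_bound w k) auto
      show "((\<lambda>t. Hdot_norm s (\<lambda>x. w t x - w t0 x) * freq k powr (- s)) \<longlongrightarrow> 0) (at t0 within {0..})"
        using tendsto_mult_right[OF lim, of t0 "freq k powr (- s)"] t0 by simp
    qed
    then show "((\<lambda>t. amp (w t) k) \<longlongrightarrow> amp (w t0) k) (at t0 within {0..})"
      by (simp add: LIM_zero_iff)
  qed
  then show "\<And>k T. k \<in> M_set \<Longrightarrow> continuous_on {0..T} (\<lambda>t. amp (w t) k)"
    by (meson atLeastAtMost_iff atLeast_iff continuous_on_subset subsetI)
  \<comment> \<open>The restriction to 0 \<le> t matters because \<open>Bolzano\<close> tests
    intervals around 0 that reach below it.\<close>
  define P where "P a b \<longleftrightarrow> (\<exists>A. \<forall>t. a \<le> t \<longrightarrow> t \<le> b \<longrightarrow> 0 \<le> t \<longrightarrow> (\<forall>k\<in>M_set. norm (amp (w t) k) \<le> A * freq k powr (- s)))" for a b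
  have PT: "P 0 T" if "0 \<le> T"
    using that
  proof (rule Bolzano)
    fix a b c :: real assume "P a b" "P b c" "a \<le> b" "b \<le> c"
    obtain A where A: "\<And>t k. a \<le> t \<Longrightarrow> t \<le> b \<Longrightarrow> 0 \<le> t \<Longrightarrow> k \<in> M_set \<Longrightarrow> norm (amp (w t) k) \<le> A * freq k powr (- s)" using \<open>P a b\<close> by (auto simp: P_def)
    obtain B where B: "\<And>t k. b \<le> t \<Longrightarrow> t \<le> c \<Longrightarrow> 0 \<le> t \<Longrightarrow> k \<in> M_set \<Longrightarrow> norm (amp (w t) k) \<le> B * freq k powr (- s)" using \<open>P b c\<close> by (auto simp: P_def)
    have "norm (amp (w t) k) \<le> max A B * freq k powr (- s)" if t: "a \<le> t" "t \<le> c" "0 \<le> t" and k: "k \<in> M_set" for t k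
    proof (cases "t \<le> b")
      case True
      then have "norm (amp (w t) k) \<le> A * freq k powr (- s)" using A t k by simp
      also have "\<dots> \<le> max A B * freq k powr (- s)" by (intro mult_right_mono) auto
      finally show ?thesis .
    next
      case False
      then have "norm (amp (w t) k) \<le> B * freq k powr (- s)" using B t k by simp
      also have "\<dots> \<le> max A B * freq k powr (- s)" by (intro mult_right_mono) auto
      finally show ?thesis .
    qed
    then show "P a c" unfolding P_def by blast
  next
    fix x :: real assume x: "0 \<le> x" "x \<le> T"
    have "\<forall>\<^sub>F t in at x within {0..}. Hdot_norm s (\<lambda>y. w t y - w x y) < 1"
      using order_tendstoD(2)[OF lim[OF x(1)], of 1] by simp
    then obtain d where d: "0 < d" "\<And>t. 0 \<le> t \<Longrightarrow> t \<noteq> x \<Longrightarrow> dist t x < d \<Longrightarrow> Hdot_norm s (\<lambda>y. w t y - w x y) < 1"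
      unfolding eventually_at by auto
    obtain A where A: "\<And>k. k \<in> M_set \<Longrightarrow> norm (amp (w x) k) \<le> A * freq k powr (- s)"
      using amp_bounded[OF w[OF x(1)]] by blast
    have near: "norm (amp (w t) k) \<le> (1 + A) * freq k powr (- s)" if t: "0 \<le> t" "dist t x < d" and k: "k \<in> M_set" for t k
    proof (cases "t = x")
      case True
      then show ?thesis using A[OF k] by (simp add: distrib_right add_increasing)
    next
      case False
      have "norm (amp (w t) k - amp (w x) k) \<le> Hdot_norm s (\<lambda>y. w t y - w x y) * freq k powr (- s)"
        by (rule amp_diff_bound[OF w[OF t(1)] w[OF x(1)] k])
      also have "\<dots> \<le> 1 * freq k powr (- s)"
        using d(2)[OF t(1) False t(2)] by (intro mult_right_mono) auto
      finally show ?thesis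
        using A[OF k] norm_triangle_ineq[of "amp (w t) k - amp (w x) k" "amp (w x) k"] by (simp add: distrib_right)
    qed
    have "P a b" if ab: "a \<le> x \<and> x \<le> b \<and> b - a < d" for a b
      unfolding P_def by (rule exI[of _ "1 + A"]) (use ab near in \<open>auto simp: dist_real_def\<close>)
    then show "\<exists>d>0. \<forall>a b. a \<le> x \<and> x \<le> b \<and> b - a < d \<longrightarrow> P a b"
      using d(1) by blast
  qed
  show "\<exists>A. \<forall>t\<in>{0..T}. \<forall>k\<in>M_set. norm (amp (w t) k) \<le> A * freq k powr (- s)"
  proof (cases "0 \<le> T")
    case True
    then have "P 0 T" by (rule PT)
    then obtain A where "\<And>t k. 0 \<le> t \<Longrightarrow> t \<le> T \<Longrightarrow> k \<in> M_set \<Longrightarrow> norm (amp (w t) k) \<le> A * freq k powr (- s)"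
      unfolding P_def by blast
    then show ?thesis by (intro exI[of _ A]) simp
  qed simp
qed

text \<open>For k in \<open>M_set\<close> both sides of the Duhamel identity are multiples of v^k,
  so it can be read on amplitudes. The time 0 is outside the identity and comes from equality of the
  data almost everywhere.\<close>

lemma mild_solution_solves:
  assumes ms: "mild_solution \<alpha> \<nu> s \<infinity> u0 w" and u0: "u0 \<in> HdotM s"
  shows "solves (amp u0) (\<lambda>t. bil (amp (w t)) (amp (w t))) (\<lambda>t. amp (w t)) T"
proof -
  have tc: "time_continuous s \<infinity> w" and z: "ae_eq (w 0) u0"
    and fe: "\<And>t k. 0 < t \<Longrightarrow> fourier (w t) k = dissipation_semigroup \<alpha> (\<nu> * t) (fourier u0) k
          - (LINT \<tau>:{0..t}|lborel. dissipation_semigroup \<alpha> (\<nu> * (t - \<tau>)) (proj_M (div_tensor (w \<tau>))) k)"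
    using ms unfolding mild_solution_def by auto
  note W = time_continuous_amp[OF tc]
  show ?thesis
    unfolding solves_def
  proof (intro ballI conjI)
    fix k assume k: "k \<in> M_set"
    show "continuous_on {0..T} (\<lambda>t. amp (w t) k)" by (rule W(2)[OF k])
    show "continuous_on {0..T} (\<lambda>t. bil (amp (w t)) (amp (w t)) k)" by (intro bil_continuous k W(2))
    fix t assume t: "t \<in> {0..T}"
    show "amp (w t) k = exp (- rate k * t) *\<^sub>R amp u0 k - duhamel_int (rate k) (\<lambda>\<tau>. bil (amp (w \<tau>)) (amp (w \<tau>)) k) t"
    proof (cases "t = 0")
      case True
      have "fourier (w 0) k = fourier u0 k"
        by (rule fourier_cong_ae[OF HdotM_L2[OF W(1)] HdotM_L2[OF u0] z]) simp
      then show ?thesis using True by (simp add: amp_def duhamel_int_def)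
    next
      case False
      then have t0: "0 < t" using t by simp
      have e: "- (\<nu> * t) * laplace_symbol \<alpha> k = - rate k * t" by (simp add: rate_def)
      have "amp (w t) k *s cvec (v_dir k) = fourier (w t) k"
        using fourier_amp[OF W(1), of t k] t by simp
      also have "\<dots> = (exp (- rate k * t) *\<^sub>R amp u0 k - duhamel_int (rate k) (\<lambda>\<tau>. bil (amp (w \<tau>)) (amp (w \<tau>)) k) t) *s cvec (v_dir k)"
        unfolding fe[OF t0] dissipation_semigroup_def[of \<alpha> "\<nu> * t"] e
        by (subst duhamel_fourier(2)[OF W(1) W(2)])
           (use k in \<open>simp_all add: fourier_amp[OF u0, of k] vec_eq_iff left_diff_distrib\<close>)
      finally show ?thesis by (rule smult_v_dir_inject[OF k])
    qed
  qed
qed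

end


subsection \<open>Well-posedness\<close>

context hypodissipative
begin

theorem well_posedness:
  assumes u0: "u0 \<in> HdotM s"
  shows "\<exists>u. mild_solution \<alpha> \<nu> s \<infinity> u0 u \<and>
    (\<forall>w. mild_solution \<alpha> \<nu> s \<infinity> u0 w \<longrightarrow> (\<forall>t\<ge>0. ae_eq (w t) (u t))) \<and>
    (\<forall>t\<ge>0. (Hdot_norm s (u t))\<^sup>2 \<le> (Hdot_norm s u0)\<^sup>2 * exp (growth_rate * (L2_norm_torus u0)\<^sup>2)) \<and>
    (\<forall>t\<ge>0. (AE \<tau> in lborel. \<tau> \<in> {0..t} \<longrightarrow> u \<tau> \<in> Hdot \<alpha>) \<and>
       set_integrable lborel {0..t} (\<lambda>\<tau>. (Hdot_norm \<alpha> (u \<tau>))\<^sup>2) \<and>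
       1 / 2 * (L2_norm_torus (u t))\<^sup>2 + \<nu> * (LINT \<tau>:{0..t}|lborel. (Hdot_norm \<alpha> (u \<tau>))\<^sup>2)
         = 1 / 2 * (L2_norm_torus u0)\<^sup>2) \<and>
    Cinf_on ({0<..} \<times> UNIV) (\<lambda>(t, x). u t x)"
proof -
  define c0 where "c0 = amp u0"
  have real0: "c0 (- k) = cnj (c0 k)" for k unfolding c0_def by (rule amp_minus)
  have Hs: "(\<lambda>k. laplace_symbol s k * (norm (c0 k))\<^sup>2) summable_on M_set"
    unfolding c0_def by (rule HdotM_summable[OF u0])
  obtain c R where R: "0 \<le> R" and sol: "\<And>T. solves c0 (\<lambda>t. bil (c t) (c t)) c T"
    and bd: "\<And>t k. 0 \<le> t \<Longrightarrow> k \<in> M_set \<Longrightarrow> norm (c t k) \<le> R * freq k powr (- s)"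
    and real: "\<And>t k. 0 \<le> t \<Longrightarrow> k \<in> M_set \<Longrightarrow> c t (- k) = cnj (c t k)"
  proof (rule global_solution[of c0])
    show "c0 (- k) = cnj (c0 k)" for k by (rule real0)
    show "(\<lambda>k. laplace_symbol s k * (norm (c0 k))\<^sup>2) summable_on M_set" by (rule Hs)
    fix c R
    assume "0 \<le> R" "\<And>T. solves c0 (\<lambda>t. bil (c t) (c t)) c T"
      "\<And>t k. 0 \<le> t \<Longrightarrow> k \<in> M_set \<Longrightarrow> norm (c t k) \<le> R * freq k powr (- s)"
      "\<And>t k. 0 \<le> t \<Longrightarrow> k \<in> M_set \<Longrightarrow> c t (- k) = cnj (c t k)"
    then show thesis by (rule that)
  qed
  have rs: "real_solution \<alpha> \<nu> s c0 c T R" if "0 < T" for T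
    by unfold_locales (use that R sol bd real Hs in auto)
  have cz: "c 0 k = c0 k" if "k \<in> M_set" for k
    using bounded_solution.c_zero[of \<alpha> \<nu> s c0 c 1 R k] rs[of 1] that by (simp add: real_solution_def)
  define E where "E b t = (\<Sum>\<^sub>\<infinity>k\<in>M_set. laplace_symbol b k * (norm (c t k))\<^sup>2)" for b t
  have en: "bounded_solution.energy c = E" if "0 < T" for T :: real
    using bounded_solution.energy_def[OF real_solution.axioms(1)[OF rs[OF that]]]
    by (simp add: E_def fun_eq_iff)
  have decay: "\<exists>C\<ge>0. \<forall>t k. d \<le> t \<longrightarrow> t \<le> T \<longrightarrow> k \<in> M_set \<longrightarrow> norm (c t k) \<le> C * freq k powr (- r)" if d: "0 < d" for d T r
  proof -
    \<comment> \<open>The interval has to contain d also when T < d.\<close>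
    interpret real_solution \<alpha> \<nu> s c0 c "max d T" R by (rule rs) (use d in simp)
    obtain C where "0 \<le> C" "\<And>t k. d \<le> t \<Longrightarrow> t \<le> max d T \<Longrightarrow> k \<in> M_set \<Longrightarrow> norm (c t k) \<le> C * freq k powr (- r)"
      using rapid_decay[of d r] d by auto
    then show ?thesis by (intro exI[of _ C]) auto
  qed
  have cont: "continuous_on {0..T} (\<lambda>t. c t k)" if "k \<in> M_set" for T k
    by (rule solvesD(1)[OF sol that])
  have rapid_c: "rapid c"
  proof (rule rapidI)
    fix k assume k: "k \<in> M_set"
    have "isCont (\<lambda>t. c t k) t" if "t \<in> {0<..}" for t
      by (rule continuous_on_interior[OF cont[OF k, of "t + 1"]]) (use that in simp)
    then show "continuous_on {0<..} (\<lambda>t. c t k)"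
      by (simp add: continuous_at_imp_continuous_on)
  qed (rule decay)
  have norm_sum: "(\<lambda>k. norm (c t k)) summable_on M_set" if t: "0 < t" for t
  proof -
    obtain C where "\<forall>u k. t \<le> u \<longrightarrow> u \<le> t \<longrightarrow> k \<in> M_set \<longrightarrow> norm (c u k) \<le> C * freq k powr (- 1)"
      using decay[OF t] by blast
    then show ?thesis by (intro summable_M_set[of 1 _ C]) auto
  qed
  have Es: "(\<lambda>k. laplace_symbol b k * (norm (c t k))\<^sup>2) summable_on M_set" if t: "0 < t" for b t
  proof -
    interpret real_solution \<alpha> \<nu> s c0 c t R by (rule rs[OF t])
    show ?thesis by (rule energy_summable) (use t in auto)
  qed
  \<comment> \<open>The series of \<open>field\<close> need not converge absolutely for data in H^s,
    so at t = 0 the datum itself is taken.\<close>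
  define u where "u t = (if t \<le> 0 then u0 else field (c t))" for t
  have uH: "u t \<in> HdotM b" if "0 < t" for b t
    using field_HdotM(1)[OF norm_sum[OF that] real Es[OF that]] that by (simp add: u_def)
  have uHs: "u t \<in> HdotM s" if "0 \<le> t" for t
    using uH[of t s] u0 that by (cases "t = 0") (auto simp: u_def)
  have amp_u: "amp (u t) k = c t k" if "0 \<le> t" "k \<in> M_set" for t k
  proof (cases "t = 0")
    case True
    then show ?thesis using cz[OF that(2)] by (simp add: u_def c0_def)
  next
    case False
    then have t: "0 < t" using that by simp
    show ?thesis using field_HdotM(2)[OF norm_sum[OF t] real Es[OF t] that(2)] t by (simp add: u_def)
  qed
  have norm_E: "(Hdot_norm b (u t))\<^sup>2 = E b t" if "0 \<le> t" for b t
    unfolding Hdot_norm_amp[OF fourier_amp[OF uHs[OF that]]] E_def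
    by (rule infsum_cong) (simp add: amp_u[OF that])
  have L2_E: "(L2_norm_torus (u t))\<^sup>2 = E 0 t" if "0 \<le> t" for t
  proof -
    have "E 0 t = (\<Sum>\<^sub>\<infinity>k\<in>M_set. (norm (amp (u t) k))\<^sup>2)"
      unfolding E_def
    proof (rule infsum_cong)
      fix k assume k: "k \<in> M_set"
      then show "laplace_symbol 0 k * (norm (c t k))\<^sup>2 = (norm (amp (u t) k))\<^sup>2"
        using freq_pos[OF k] by (simp add: amp_u[OF that] laplace_symbol_freq)
    qed
    then show ?thesis using infsumI[OF L2_norm_amp[OF uHs[OF that]]] by simp
  qed
  have u_0: "u 0 = u0" by (simp add: u_def)

  have tc: "time_continuous s \<infinity> u"
    unfolding time_continuous_def Let_def
  proof (intro conjI ballI)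
    show "u t \<in> HdotM s" if "t \<in> {t. 0 \<le> t \<and> ereal t < \<infinity>}" for t using that uHs by simp
    fix t0 assume "t0 \<in> {t. 0 \<le> t \<and> ereal t < \<infinity>}"
    then have t0: "0 \<le> t0" by simp
    define T where "T = t0 + 1"
    interpret real_solution \<alpha> \<nu> s c0 c T R by (rule rs) (use t0 in \<open>simp add: T_def\<close>)
    obtain B where B: "B summable_on M_set" "\<And>t k. 0 \<le> t \<Longrightarrow> t \<le> T \<Longrightarrow> k \<in> M_set \<Longrightarrow> laplace_symbol s k * (norm (c t k))\<^sup>2 \<le> B k"
      using energy_domination by blast
    define F where "F t = (\<Sum>\<^sub>\<infinity>k\<in>M_set. laplace_symbol s k * (norm (c t k - c t0 k))\<^sup>2)" for t
    have "continuous_on {0..T} F"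
      unfolding F_def
    proof (rule continuous_on_infsum)
      show "continuous_on {0..T} (\<lambda>t. laplace_symbol s k * (norm (c t k - c t0 k))\<^sup>2)" if "k \<in> M_set" for k
        by (intro continuous_intros cont that)
      show "(\<lambda>k. 4 * B k) summable_on M_set" by (intro summable_on_cmult_right B)
      show "norm (laplace_symbol s k * (norm (c t k - c t0 k))\<^sup>2) \<le> 4 * B k" if k: "k \<in> M_set" and t: "t \<in> {0..T}" for k t
      proof -
        have "(norm (c t k - c t0 k))\<^sup>2 \<le> 2 * (norm (c t k))\<^sup>2 + 2 * (norm (c t0 k))\<^sup>2"
          using norm_add_power2_le[of "c t k" "- c t0 k"] by simp
        from mult_left_mono[OF this laplace_symbol_nonneg[of s k]]
        show ?thesis
          using B(2)[of t k] B(2)[of t0 k] t t0 k laplace_symbol_nonneg[of s k]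
          by (simp add: abs_mult T_def algebra_simps)
      qed
    qed
    then have "(F \<longlongrightarrow> F t0) (at t0 within {0..T})"
      using t0 by (simp add: continuous_on_def T_def)
    moreover have "F t0 = 0" by (simp add: F_def)
    \<comment> \<open>T = t0 + 1 keeps the right end away from t0.\<close>
    moreover have "at t0 within {0..T} = at t0 within {0..}"
      by (rule at_within_nhd[where S = "{..<T}"]) (auto simp: T_def)
    ultimately have "((\<lambda>t. sqrt (F t)) \<longlongrightarrow> sqrt 0) (at t0 within {0..})" by (intro tendsto_real_sqrt) simp
    then have lim: "((\<lambda>t. sqrt (F t)) \<longlongrightarrow> 0) (at t0 within {0..})" by simp
    have "{t. 0 \<le> t \<and> ereal t < \<infinity>} = {0..}" by auto
    moreover have "((\<lambda>t. Hdot_norm s (\<lambda>x. u t x - u t0 x)) \<longlongrightarrow> 0) (at t0 within {0..})"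
    proof (rule Lim_transform_eventually[OF lim])
      have "sqrt (F t) = Hdot_norm s (\<lambda>x. u t x - u t0 x)" if "0 \<le> t" for t
      proof -
        have "(Hdot_norm s (\<lambda>x. u t x - u t0 x))\<^sup>2 = F t"
          unfolding Hdot_norm_diff(1)[OF uHs[OF that] uHs[OF t0]] F_def
          by (rule infsum_cong) (simp add: amp_u that t0)
        moreover have "0 \<le> Hdot_norm s (\<lambda>x. u t x - u t0 x)"
          by (simp add: Hdot_norm_def infsum_nonneg laplace_symbol_nonneg)
        ultimately show ?thesis by (metis real_sqrt_unique)
      qed
      then show "\<forall>\<^sub>F t in at t0 within {0..}. sqrt (F t) = Hdot_norm s (\<lambda>x. u t x - u t0 x)"
        unfolding eventually_at_filter by (intro always_eventually) auto
    qed
    ultimately show "((\<lambda>t. Hdot_norm s (\<lambda>x. u t x - u t0 x)) \<longlongrightarrow> 0) (at t0 within {t. 0 \<le> t \<and> ereal t < \<infinity>})"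
      by simp
  qed

  have mild: "mild_solution \<alpha> \<nu> s \<infinity> u0 u"
    unfolding mild_solution_def
  proof (intro conjI allI impI tc)
    show "ae_eq (u 0) u0" by (simp add: ae_eq_def u_0)
    fix t k assume "0 < t \<and> ereal t < \<infinity>"
    then have t: "0 < t" by simp
    have uc: "continuous_on {0..t} (\<lambda>\<tau>. amp (u \<tau>) k)" if "k \<in> M_set" for k
      by (rule continuous_on_eq[OF cont[OF that]]) (simp add: amp_u that)
    have uH': "u \<tau> \<in> HdotM s" if "0 \<le> \<tau>" "\<tau> \<le> t" for \<tau> by (rule uHs[OF that(1)])
    show "set_integrable lborel {0..t} (\<lambda>\<tau>. dissipation_semigroup \<alpha> (\<nu> * (t - \<tau>)) (proj_M (div_tensor (u \<tau>))) k)"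
      by (rule duhamel_fourier(1)[OF uH' uc])
    have D: "(LINT \<tau>:{0..t}|lborel. dissipation_semigroup \<alpha> (\<nu> * (t - \<tau>)) (proj_M (div_tensor (u \<tau>))) k)
      = (if k \<in> M_set then duhamel_int (rate k) (\<lambda>\<tau>. bil (amp (u \<tau>)) (amp (u \<tau>)) k) t else 0) *s cvec (v_dir k)"
      by (rule duhamel_fourier(2)[OF uH' uc])
    show "fourier (u t) k = dissipation_semigroup \<alpha> (\<nu> * t) (fourier u0) k
          - (LINT \<tau>:{0..t}|lborel. dissipation_semigroup \<alpha> (\<nu> * (t - \<tau>)) (proj_M (div_tensor (u \<tau>))) k)"
    proof (cases "k \<in> M_set")
      case k: True
      have b: "duhamel_int (rate k) (\<lambda>\<tau>. bil (amp (u \<tau>)) (amp (u \<tau>)) k) t = duhamel_int (rate k) (\<lambda>\<tau>. bil (c \<tau>) (c \<tau>) k) t"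
        by (rule duhamel_int_cong) (simp add: bil_def amp_u pairs_M_set)
      have e: "- (\<nu> * t) * laplace_symbol \<alpha> k = - rate k * t" by (simp add: rate_def)
      have "fourier (u t) k = c t k *s cvec (v_dir k)"
        using fourier_amp[OF uHs, of t k] t k by (simp add: amp_u)
      also have "c t k = exp (- rate k * t) *\<^sub>R c0 k - duhamel_int (rate k) (\<lambda>\<tau>. bil (c \<tau>) (c \<tau>) k) t"
        using solvesD(3)[OF sol[of t] k] t by simp
      finally show ?thesis
        unfolding D b dissipation_semigroup_def[of \<alpha> "\<nu> * t"] e fourier_amp[OF u0, of k]
        using k by (simp add: c0_def vec_eq_iff left_diff_distrib)
    next
      case False
      have "fourier v k = 0" if "v \<in> HdotM s" for v using that False by (simp add: HdotM_def)
      then show ?thesis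
        unfolding D using False uHs[of t] u0 t by (simp add: dissipation_semigroup_def)
    qed
  qed

  have unique: "ae_eq (w t) (u t)" if w: "mild_solution \<alpha> \<nu> s \<infinity> u0 w" and t: "0 \<le> t" for w t
  proof -
    have tcw: "time_continuous s \<infinity> w" using w by (simp add: mild_solution_def)
    note W = time_continuous_amp[OF tcw]
    obtain A where A: "\<forall>\<tau>\<in>{0..t}. \<forall>k\<in>M_set. norm (amp (w \<tau>) k) \<le> A * freq k powr (- s)"
      using W(3)[of t] by blast
    have S: "solves c0 (\<lambda>t. bil (amp (w t)) (amp (w t))) (\<lambda>t. amp (w t)) t"
      unfolding c0_def by (rule mild_solution_solves[OF w u0])
    have "amp (w t) k = c t k" if k: "k \<in> M_set" for k
      by (rule solution_unique[OF S _ sol[of t] _ t order_refl k, of A R]) (use A bd in auto)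
    then have "amp (w t) k = amp (u t) k" for k
      using amp_u[OF t] by (cases "k \<in> M_set") (simp_all add: amp_outside)
    then have "fourier (w t) k = fourier (u t) k" for k
      using fourier_amp[OF W(1)[OF t], of k] fourier_amp[OF uHs[OF t], of k] by simp
    then show ?thesis by (rule fourier_unique[OF HdotM_L2[OF W(1)[OF t]] HdotM_L2[OF uHs[OF t]]])
  qed

  have growth: "(Hdot_norm s (u t))\<^sup>2 \<le> (Hdot_norm s u0)\<^sup>2 * exp (growth_rate * (L2_norm_torus u0)\<^sup>2)" if t: "0 \<le> t" for t
  proof -
    have T: "0 < t + 1" using t by simp
    have "E s t \<le> E s 0 * exp (growth_rate * E 0 0)"
      using real_solution.energy_growth[OF rs[OF T], of t] t by (simp add: en[OF T])
    then show ?thesis using norm_E[OF t, of s] norm_E[of 0 s] L2_E[of 0] by (simp add: u_0)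
  qed

  have balance: "(AE \<tau> in lborel. \<tau> \<in> {0..t} \<longrightarrow> u \<tau> \<in> Hdot \<alpha>) \<and>
       set_integrable lborel {0..t} (\<lambda>\<tau>. (Hdot_norm \<alpha> (u \<tau>))\<^sup>2) \<and>
       1 / 2 * (L2_norm_torus (u t))\<^sup>2 + \<nu> * (LINT \<tau>:{0..t}|lborel. (Hdot_norm \<alpha> (u \<tau>))\<^sup>2)
         = 1 / 2 * (L2_norm_torus u0)\<^sup>2" if t: "0 \<le> t" for t
  proof -
    have T: "0 < t + 1" using t by simp
    have HI: "(E \<alpha> has_integral (E 0 0 - E 0 t) / (2 * \<nu>)) {0..t}"
      using real_solution.energy_equality[OF rs[OF T], of t] t by (simp add: en[OF T])
    have Epos: "0 \<le> E \<alpha> \<tau>" for \<tau> unfolding E_def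
      by (intro infsum_nonneg mult_nonneg_nonneg laplace_symbol_nonneg) simp
    have Ec: "continuous_on {0<..t} (E \<alpha>)"
    proof (rule continuous_at_imp_continuous_on, rule ballI)
      fix \<tau> assume "\<tau> \<in> {0<..t}"
      then have "0 < \<tau>" "\<tau> < t + 1" by auto
      from bounded_solution.energy_has_derivative[OF real_solution.axioms(1)[OF rs[OF T]] this, of \<alpha>]
      show "isCont (E \<alpha>) \<tau>" unfolding en[OF T] by (rule DERIV_isCont)
    qed
    \<comment> \<open>Continuity of the \<alpha>-energy is known for positive times only; the point
      0, where the sum may diverge, is split off as a singleton.\<close>
    have meas: "(\<lambda>\<tau>. indicator {0..t} \<tau> *\<^sub>R E \<alpha> \<tau>) \<in> borel_measurable borel"
    proof -
      have "(\<lambda>\<tau>. indicator {0<..t} \<tau> *\<^sub>R E \<alpha> \<tau>) \<in> borel_measurable borel"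
        by (rule borel_measurable_continuous_on_indicator[OF _ Ec]) simp
      moreover have "(\<lambda>\<tau>. indicator {0::real} \<tau> *\<^sub>R E \<alpha> 0) \<in> borel_measurable borel"
        by (intro borel_measurable_scaleR borel_measurable_indicator borel_measurable_const) simp
      ultimately have "(\<lambda>\<tau>. indicator {0<..t} \<tau> *\<^sub>R E \<alpha> \<tau> + indicator {0} \<tau> *\<^sub>R E \<alpha> 0) \<in> borel_measurable borel"
        by (rule borel_measurable_add)
      moreover have "indicator {0..t} \<tau> *\<^sub>R E \<alpha> \<tau> = indicator {0<..t} \<tau> *\<^sub>R E \<alpha> \<tau> + indicator {0} \<tau> *\<^sub>R E \<alpha> 0" for \<tau>
        using t by (auto simp: indicator_def)
      ultimately show ?thesis by (simp only:)
    qed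
    \<comment> \<open>Nonnegativity upgrades the gauge integral of \<open>energy_equality\<close> to
      Lebesgue integrability.\<close>
    have "E \<alpha> absolutely_integrable_on {0..t}"
      using HI Epos by (intro nonnegative_absolutely_integrable_1) auto
    then have "integrable lborel (\<lambda>\<tau>. indicator {0..t} \<tau> *\<^sub>R E \<alpha> \<tau>)"
      unfolding set_integrable_def by (subst (asm) integrable_completion) (use meas in simp_all)
    then have SI: "set_integrable lborel {0..t} (E \<alpha>)" by (simp add: set_integrable_def)
    have hn: "(Hdot_norm \<alpha> (u \<tau>))\<^sup>2 = E \<alpha> \<tau>" if "\<tau> \<in> {0..t}" for \<tau>
      using norm_E[of \<tau> \<alpha>] that by simp
    have 1: "set_integrable lborel {0..t} (\<lambda>\<tau>. (Hdot_norm \<alpha> (u \<tau>))\<^sup>2)"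
      using SI by (subst set_integrable_cong[OF refl refl hn])
    have "(LINT \<tau>:{0..t}|lborel. (Hdot_norm \<alpha> (u \<tau>))\<^sup>2) = (LINT \<tau>:{0..t}|lborel. E \<alpha> \<tau>)"
      by (rule set_lebesgue_integral_cong) (use hn in auto)
    also have "\<dots> = integral {0..t} (E \<alpha>)" by (rule set_borel_integral_eq_integral(2)[OF SI])
    also have "\<dots> = (E 0 0 - E 0 t) / (2 * \<nu>)" by (rule integral_unique[OF HI])
    finally have "\<nu> * (LINT \<tau>:{0..t}|lborel. (Hdot_norm \<alpha> (u \<tau>))\<^sup>2) = (E 0 0 - E 0 t) / 2"
      using nu by simp
    then have 2: "1 / 2 * (L2_norm_torus (u t))\<^sup>2 + \<nu> * (LINT \<tau>:{0..t}|lborel. (Hdot_norm \<alpha> (u \<tau>))\<^sup>2) = 1 / 2 * (L2_norm_torus u0)\<^sup>2"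
      using L2_E[OF t] L2_E[of 0] by (simp add: u_0 field_simps)
    \<comment> \<open>At positive times u lies in the space of every order; only the null set {0} is
      excluded.\<close>
    have "AE \<tau> in lborel. \<tau> \<noteq> (0::real)" by (rule AE_lborel_singleton)
    then have "AE \<tau> in lborel. \<tau> \<in> {0..t} \<longrightarrow> u \<tau> \<in> Hdot \<alpha>"
    proof eventually_elim
      case (elim \<tau>)
      then show ?case using uH[of \<tau> \<alpha>] by (auto simp: HdotM_def)
    qed
    with 1 2 show ?thesis by blast
  qed

  have smooth: "Cinf_on ({0<..} \<times> UNIV) (\<lambda>(t, x). u t x)"
    unfolding Cinf_on_def
  proof
    fix n
    have "smooth_fam n c"
    proof (rule smooth_fam_solution[OF rapid_c])
      fix k t assume k: "k \<in> M_set" and t: "0 < (t::real)"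
      interpret real_solution \<alpha> \<nu> s c0 c "t + 1" R by (rule rs) (use t in simp)
      show "((\<lambda>t. c t k) has_vector_derivative complex_of_real (- rate k) * c t k + - 1 * bil (c t) (c t) k) (at t)"
        using c_has_derivative[OF t _ k] by (simp add: scaleR_conv_of_real)
    next
      fix k assume k: "k \<in> M_set"
      show "norm (complex_of_real (- rate k)) \<le> (\<nu> * (2 * pi) powr (2 * \<alpha>)) * freq k powr (2 * \<alpha>)"
      proof -
        have "norm (complex_of_real (- rate k)) = rate k" using rate_pos[OF k] by simp
        then show ?thesis by (simp add: rate_def laplace_symbol_split[OF k])
      qed
    qed
    then have "Cn_on n ({0<..} \<times> UNIV) (synth c)" by (rule synth_Cn)
    moreover have "open ({0<..} \<times> UNIV :: (real \<times> (real^3)) set)" by (intro open_Times) auto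
    ultimately show "Cn_on n ({0<..} \<times> UNIV) (\<lambda>(t, x). u t x)"
      by (rule Cn_on_cong[rotated 2]) (auto simp: u_def synth_field)
  qed

  show ?thesis
    using mild unique growth balance smooth by (intro exI[of _ u]) simp
qed

end

theorem theorem1p9:
  fixes s :: real
  assumes "0 \<le> s"
  shows "\<exists>C::real. 0 < C \<and>
    (\<forall>(\<alpha>::real) (\<nu>::real) (u\<^sub>0 :: real^3 \<Rightarrow> real^3).
       ln 3 / (4 * ln 2) \<le> \<alpha> \<longrightarrow> ln 3 / (2 * ln 2) - 2 * \<alpha> < s \<longrightarrow> 0 < \<nu> \<longrightarrow> u\<^sub>0 \<in> HdotM s \<longrightarrow>
       (\<exists>u :: real \<Rightarrow> real^3 \<Rightarrow> real^3.
          mild_solution \<alpha> \<nu> s \<infinity> u\<^sub>0 u \<and>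
          (\<forall>w. mild_solution \<alpha> \<nu> s \<infinity> u\<^sub>0 w \<longrightarrow> (\<forall>t\<ge>0. ae_eq (w t) (u t))) \<and>
          (\<forall>t\<ge>0. (Hdot_norm s (u t))\<^sup>2 \<le> (Hdot_norm s u\<^sub>0)\<^sup>2 *
             exp (C\<^sup>2 / (4 * (2 * pi) powr (4 * \<alpha> - ln 3 / (2 * ln 2)))
                  * ((L2_norm_torus u\<^sub>0)\<^sup>2 / \<nu>\<^sup>2))) \<and>
          (\<forall>t\<ge>0.
             (AE \<tau> in lborel. \<tau> \<in> {0..t} \<longrightarrow> u \<tau> \<in> Hdot \<alpha>) \<and>
             set_integrable lborel {0..t} (\<lambda>\<tau>. (Hdot_norm \<alpha> (u \<tau>))\<^sup>2) \<and>
             1 / 2 * (L2_norm_torus (u t))\<^sup>2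
               + \<nu> * (LINT \<tau>:{0..t}|lborel. (Hdot_norm \<alpha> (u \<tau>))\<^sup>2)
             = 1 / 2 * (L2_norm_torus u\<^sub>0)\<^sup>2) \<and>
          Cinf_on ({0<..} \<times> UNIV) (\<lambda>(t, x). u t x)))"
proof -
  \<comment> \<open>\<open>growth_rate\<close> contains (2\<pi>)^(-4\<alpha>). Writing this as
    (2\<pi>)^(-lam) / (2\<pi>)^(4\<alpha> - lam) leaves a constant that depends on s alone; the
    square root of its power of 2\<pi> is the last factor of C.\<close>
  define C where "C = 324 * 128 * 6 powr s * (2 * pi) powr (- (lam / 2))"
  have C: "0 < C" by (simp add: C_def)
  have const: "C\<^sup>2 / (4 * (2 * pi) powr (4 * \<alpha> - lam)) * (L / \<nu>\<^sup>2) = hypodissipative.growth_rate \<alpha> \<nu> s * L"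
    if H: "hypodissipative \<alpha> \<nu> s" for \<alpha> \<nu> L :: real
  proof -
    have p: "((2 * pi) powr x)\<^sup>2 = (2 * pi) powr (2 * x)" for x :: real
      by (simp add: power2_eq_square flip: powr_add)
    have q: "(2 * pi) powr (2 * - (2 * \<alpha>)) = (2 * pi) powr (2 * - (lam / 2)) * (1 / (2 * pi) powr (4 * \<alpha> - lam))"
      unfolding powr_minus_divide[symmetric] powr_add[symmetric] by simp
    have "hypodissipative.growth_rate \<alpha> \<nu> s = 324\<^sup>2 * (128\<^sup>2 * (6 powr s)\<^sup>2 * (2 * pi) powr (2 * - (2 * \<alpha>))) / (4 * \<nu>\<^sup>2)"
      unfolding hypodissipative.growth_rate_def[OF H] hypodissipative.triad_const_def[OF H] by (simp only: power_mult_distrib p)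
    moreover have "C\<^sup>2 = 324\<^sup>2 * 128\<^sup>2 * (6 powr s)\<^sup>2 * (2 * pi) powr (2 * - (lam / 2))"
      unfolding C_def by (simp only: power_mult_distrib p)
    ultimately show ?thesis unfolding q by (simp only:) simp
  qed
  have main: "hypodissipative \<alpha> \<nu> s"
    if "ln 3 / (4 * ln 2) \<le> \<alpha>" "ln 3 / (2 * ln 2) - 2 * \<alpha> < s" "0 < \<nu>" for \<alpha> \<nu> :: real
  proof
    show "lam \<le> 2 * \<alpha>" using that(1) by (simp add: field_simps)
  qed (use assms that in auto)
  show ?thesis
  proof (intro exI[of _ C] conjI C allI impI)
    fix \<alpha> \<nu> :: real and u\<^sub>0 :: "real^3 \<Rightarrow> real^3"
    assume "ln 3 / (4 * ln 2) \<le> \<alpha>" "ln 3 / (2 * ln 2) - 2 * \<alpha> < s" "0 < \<nu>" and u0: "u\<^sub>0 \<in> HdotM s"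
    then have H: "hypodissipative \<alpha> \<nu> s" by (intro main)
    show "\<exists>u :: real \<Rightarrow> real^3 \<Rightarrow> real^3.
          mild_solution \<alpha> \<nu> s \<infinity> u\<^sub>0 u \<and>
          (\<forall>w. mild_solution \<alpha> \<nu> s \<infinity> u\<^sub>0 w \<longrightarrow> (\<forall>t\<ge>0. ae_eq (w t) (u t))) \<and>
          (\<forall>t\<ge>0. (Hdot_norm s (u t))\<^sup>2 \<le> (Hdot_norm s u\<^sub>0)\<^sup>2 *
             exp (C\<^sup>2 / (4 * (2 * pi) powr (4 * \<alpha> - ln 3 / (2 * ln 2)))
                  * ((L2_norm_torus u\<^sub>0)\<^sup>2 / \<nu>\<^sup>2))) \<and>
          (\<forall>t\<ge>0.
             (AE \<tau> in lborel. \<tau> \<in> {0..t} \<longrightarrow> u \<tau> \<in> Hdot \<alpha>) \<and>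
             set_integrable lborel {0..t} (\<lambda>\<tau>. (Hdot_norm \<alpha> (u \<tau>))\<^sup>2) \<and>
             1 / 2 * (L2_norm_torus (u t))\<^sup>2
               + \<nu> * (LINT \<tau>:{0..t}|lborel. (Hdot_norm \<alpha> (u \<tau>))\<^sup>2)
             = 1 / 2 * (L2_norm_torus u\<^sub>0)\<^sup>2) \<and>
          Cinf_on ({0<..} \<times> UNIV) (\<lambda>(t, x). u t x)"
      unfolding const[OF H] by (rule hypodissipative.well_posedness[OF H u0])
  qed
qed

end
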